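(* Let $\mathcal{G}\leq\operatorname{GL}_n$ be a linear algebraic group defined over $\mathbb{F}_q(t)$. Let $(M,\Phi)$ be an $n$-dimensional $\phi_q$-difference module over $k(t)$ with representing matrix $D\in\mathcal{G}(k(t)\cap\mathfrak{o}[[t]])$. Assume that there exists a fundamental matrix $Y\in\mathcal{G}(K[[t]])$ for $M$ generating a separable Picard-Vessiot extension $E/k(t)$ of $M$. Let $\mathcal{H}\leq\mathcal{G}$ be the Galois group scheme of $M$ corresponding to the Picard-Vessiot ring $R:=k(t)[Y,Y^{-1}]\subseteq E$. Then $\mathcal{H}(\mathbb{F}_q[[t]])$ contains a $\mathcal{G}(\overline{\mathbb{F}}_q[[t]])$-conjugate of $\kappa\bigl(D\,\phi_q(D)\cdots\phi_{q^{d-1}}(D)\bigr)$. More precisely, the conjugating matrix can be chosen as $\kappa(Y)\in\mathcal{G}(\overline{\mathbb{F}}_q[[t]])$, i.e. $\kappa(Y)^{-1}\,\kappa\bigl(D\,\phi_q(D)\cdots\phi_{q^{d-1}}(D)\bigr)\,\kappa(Y)\in\mathcal{H}(\mathbb{F}_q[[t]])$.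
   Context: Fields. $q$ is a power of a prime. $k$ is a field containing $\mathbb{F}_q$ with a fixed non-trivial non-archimedean absolute value $|\cdot|$. $K$ is the completion of an algebraic closure of the completion of $k$ with respect to $|\cdot|$ (algebraically closed). $\overline{k}^{\,\mathrm{sep}}$ is the separable algebraic closure of $k$ inside $K$. $\phi_q$ acts on $K((t))$ (and $\phi_q$-stable subrings such as $k(t)$) by raising coefficients to the $q$-th power and fixing $t$; $\phi_{q^j}=\phi_q^j$. The field of constants (fixed elements) of $(k(t),\phi_q)$ is $\mathbb{F}_q(t)$. Specialization. Fix $d\in\mathbb{N}$, $d\ge1$, and a (not necessarily discrete) valuation ring $\mathfrak{o}$ inside $k$ with maximal ideal $\mathfrak{p}$ such that $\mathfrak{o}/\mathfrak{p}\cong\mathbb{F}_{q^d}$. Fix an extension $(\mathcal{O},\mathcal{P})$ of $(\mathfrak{o},\mathfrak{p})$ to $\overline{k}^{\,\mathrm{sep}}$; then $\mathcal{O}/\mathcal{P}\cong\overline{\mathbb{F}}_q$. $\kappa\colon\mathcal{O}\to\overline{\mathbb{F}}_q$ is the residue homomorphism, extended coefficientwise to $\kappa\colon\mathcal{O}[[t]]\to\overline{\mathbb{F}}_q[[t]]$, and applied entrywise to matrices. (For $D\in\operatorname{GL}_n(\mathfrak{o}[[t]])$, every $Y\in\operatorname{GL}_n(K[[t]])$ with $D\phi_q(Y)=Y$ lies in $\operatorname{GL}_n(\mathcal{O}[[t]])$, so $\kappa(Y)$ is defined.) For a group $\mathcal{G}\le\operatorname{GL}_n$ defined over $\mathbb{F}_q(t)$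 and a ring $A$ contained in an extension field $\Omega$ of $\mathbb{F}_q(t)$, $\mathcal{G}(A)$ means $\mathcal{G}(\Omega)\cap\operatorname{GL}_n(A)$. Difference Galois theory. A difference ring $(R,\phi)$ is a commutative ring with an endomorphism; $C_R$ denotes its elements fixed by $\phi$; it is simple if its only $\phi$-stable ideals are $(0)$ and $R$. Let $(F,\phi)$ be a difference field with constants $C$. A difference module $(M,\Phi)$ over $F$ is a finite-dimensional $F$-vector space with a $\phi$-semilinear map $\Phi$ whose representing matrix $D$ (columns are the images of the basis elements under $\Phi$) lies in $\operatorname{GL}_n(F)$. A fundamental matrix is $Y\in\operatorname{GL}_n(R)$, for a difference ring extension $R$ of $F$, with $D\phi(Y)=Y$. A Picard-Vessiot ring for $M$ is a difference ring extension $R/F$ that is a simple difference ring with $C_R=C$ and $R=F[Y,Y^{-1}]:=F[Y_{ij},\det(Y)^{-1}\mid 1\le i,j\le n]$ for a fundamental matrix $Y\in\operatorname{GL}_n(R)$. If $R$ is a domain, $E=\operatorname{Quot}(R)$ is called a Picard-Vessiot extension. The Galois group scheme of $M$ corresponding to $R$ is the functor $S\mapsto\operatorname{Aut}^{\phi}(R\otimes_CS/F\otimes_CS)$ on $C$-algebras (automorphisms fixing $F\otimes_C S$ and commuting with $\phi\otimes\mathrm{id}$); for $R/F$ separable it is a linear algebraic group over $C$, and it is regarded as a closed subgroup of $\operatorname{GL}_n$ via $\sigma\mapsto Y^{-1}\sigma(Y)$. If $Y$ has entries in $\mathcal{G}$, this subgroup is contained in $\mathcal{G}$. *)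

theory Defs
  imports
    "HOL-Analysis.Analysis"
    "HOL-Algebra.Algebra"
    "HOL-Algebra.Algebraic_Closure_Type"
    "HOL-Computational_Algebra.Computational_Algebra"
    "HOL-Library.Poly_Mapping"
begin

section \<open>Subrings of a field given by a type\<close>

text \<open>
  All rings that occur live inside one field: \<open>K\<close> (a type), the field \<open>K((t))\<close> of Laurent
  series (\<^typ>\<open>'a fls\<close>), or an algebraic closure of \<open>K((t))\<close>.  They are sets, turned
  into HOL-Algebra rings by the following abbreviation.
\<close>

abbreviation ring_on :: "'a::comm_ring_1 set \<Rightarrow> 'a ring" where
  "ring_on A \<equiv> ring_of_type_algebra\<lparr>carrier := A\<rparr>"

text \<open>For \<open>m\<close> a power of the characteristic of an algebraically closed field, this is the
  unique subfield with \<open>m\<close> elements.\<close>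

definition GF :: "nat \<Rightarrow> 'a::field set" where
  "GF m = {x. x ^ m = x}"

definition algebraic_over :: "'a::field set \<Rightarrow> 'a \<Rightarrow> bool" where
  "algebraic_over k x \<longleftrightarrow> (\<exists>f. f \<noteq> 0 \<and> set (coeffs f) \<subseteq> k \<and> poly f x = 0)"

text \<open>Used in algebraically closed fields only, so that \<^const>\<open>rsquarefree\<close> (all roots in
  the ambient field are simple) says that the polynomial is separable.\<close>

definition separable_over :: "'a::field set \<Rightarrow> 'a \<Rightarrow> bool" where
  "separable_over k x \<longleftrightarrow>
     (\<exists>f. rsquarefree f \<and> set (coeffs f) \<subseteq> k \<and> poly f x = 0)"

definition algebraic_closure_of :: "'a::field set \<Rightarrow> 'a set" where
  "algebraic_closure_of k = {x. algebraic_over k x}"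

definition separable_closure_of :: "'a::field set \<Rightarrow> 'a set" where
  "separable_closure_of k = {x. separable_over k x}"

definition quotient_field :: "'a::field set \<Rightarrow> 'a set" where
  "quotient_field A = {a / b | a b. a \<in> A \<and> b \<in> A \<and> b \<noteq> 0}"

text \<open>
  Separability of a not necessarily algebraic extension \<open>E/F\<close>: inside an algebraic closure of
  the ambient field, \<open>E\<close> is linearly disjoint over \<open>F\<close> from the perfect closure of \<open>F\<close>.
\<close>

definition perfect_closure :: "'a::field set \<Rightarrow> 'a set" where
  "perfect_closure F = {x. \<exists>m. x ^ (CHAR('a) ^ m) \<in> F}"

definition linearly_disjoint :: "'a::field set \<Rightarrow> 'a set \<Rightarrow> 'a set \<Rightarrow> bool" where
  "linearly_disjoint F E L \<longleftrightarrow>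
     (\<forall>us. set us \<subseteq> E \<longrightarrow> ring.independent ring_of_type_algebra F us
        \<longrightarrow> ring.independent ring_of_type_algebra L us)"

definition separable_extension :: "'a::field set \<Rightarrow> 'a set \<Rightarrow> bool" where
  "separable_extension F E \<longleftrightarrow>
     linearly_disjoint (to_ac ` F) (to_ac ` E) (perfect_closure (to_ac ` F))"


section \<open>The valued fields and the specialization\<close>

definition nonarchimedean_abs :: "('a::field \<Rightarrow> real) \<Rightarrow> bool" where
  "nonarchimedean_abs v \<longleftrightarrow>
     (\<forall>x. v x \<ge> 0) \<and> (\<forall>x. v x = 0 \<longleftrightarrow> x = 0) \<and>
     (\<forall>x y. v (x * y) = v x * v y) \<and> (\<forall>x y. v (x + y) \<le> max (v x) (v y))"

text \<open>
  The ambient field \<open>K\<close> is complete, so the topological closure of \<open>k\<close> in \<open>K\<close> is the completion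
  of \<open>k\<close>; \<open>K\<close> is algebraically closed, so the elements algebraic over that completion form an
  algebraic closure of it; \<open>K\<close> is the completion of the latter if it is dense.
\<close>

definition completed_alg_closure_of ::
  "('a::{alg_closed_field, complete_space} \<Rightarrow> real) \<Rightarrow> 'a set \<Rightarrow> bool" where
  "completed_alg_closure_of v k \<longleftrightarrow>
     nonarchimedean_abs v \<and> (\<forall>x y. dist x y = v (x - y)) \<and>
     closure (algebraic_closure_of (closure k)) = UNIV"

definition valuation_ring_of :: "'a::field set \<Rightarrow> 'a set \<Rightarrow> bool" where
  "valuation_ring_of L A \<longleftrightarrow>
     subring A ring_of_type_algebra \<and> A \<subseteq> L \<and> (\<forall>x\<in>L. x \<in> A \<or> inverse x \<in> A)"

text \<open>
  The residue homomorphism, with the residue field \<open>\<O>/\<P>\<close> identified, as a field extension of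
  the subfield with \<open>q\<close> elements, with the algebraic closure of that field inside \<open>K\<close>.  Values
  of \<open>\<kappa>\<close> outside \<open>\<O>\<close> are irrelevant.
\<close>

definition residue_homomorphism :: "nat \<Rightarrow> 'a::field set \<Rightarrow> 'a set \<Rightarrow> ('a \<Rightarrow> 'a) \<Rightarrow> bool" where
  "residue_homomorphism q \<O> \<P> \<kappa> \<longleftrightarrow>
     \<kappa> \<in> ring_hom (ring_on \<O>) (ring_on (algebraic_closure_of (GF q))) \<and>
     \<kappa> ` \<O> = algebraic_closure_of (GF q) \<and>
     (\<forall>x\<in>\<O>. \<kappa> x = 0 \<longleftrightarrow> x \<in> \<P>) \<and>
     (\<forall>x\<in>GF q. \<kappa> x = x)"


section \<open>Laurent series\<close>

text \<open>Coefficientwise application of a function; meaningful if the function maps 0 to 0.\<close>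

definition fls_map :: "('a::zero \<Rightarrow> 'b::zero) \<Rightarrow> 'a fls \<Rightarrow> 'b fls" where
  "fls_map h f = Abs_fls (\<lambda>n. h (fls_nth f n))"

lemma fls_nth_fls_map:
  assumes "h 0 = 0"
  shows "fls_nth (fls_map h f) n = h (fls_nth f n)"
  unfolding fls_map_def
  by (rule nth_Abs_fls_lower_bound[of "fls_subdegree f"]) (simp add: assms)

definition frobenius :: "nat \<Rightarrow> 'a::field fls \<Rightarrow> 'a fls" where
  "frobenius q = fls_map (\<lambda>x. x ^ q)"

definition laurent_series_over :: "'a::field set \<Rightarrow> 'a fls set" where
  "laurent_series_over A = {f. \<forall>n. fls_nth f n \<in> A}"

definition power_series_over :: "'a::field set \<Rightarrow> 'a fls set" where
  "power_series_over A = {f. (\<forall>n. fls_nth f n \<in> A) \<and> (\<forall>n<0. fls_nth f n = 0)}"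

definition rational_functions_over :: "'a::field set \<Rightarrow> 'a fls set" where
  "rational_functions_over k =
     {fps_to_fls (fps_of_poly a) / fps_to_fls (fps_of_poly b) | a b.
        set (coeffs a) \<subseteq> k \<and> set (coeffs b) \<subseteq> k \<and> b \<noteq> 0}"


section \<open>Linear algebraic groups\<close>

definition GL :: "'a::comm_ring_1 set \<Rightarrow> ('a^'n^'n) set" where
  "GL A = {g. (\<forall>i j. g $ i $ j \<in> A) \<and>
              (\<exists>h. (\<forall>i j. h $ i $ j \<in> A) \<and> g ** h = mat 1 \<and> h ** g = mat 1)}"

text \<open>Polynomials in the matrix entries \<open>X\<^sub>i\<^sub>j\<close>, and their values at a matrix.\<close>

type_synonym ('a, 'n) matrix_poly = "(('n \<times> 'n) \<Rightarrow>\<^sub>0 nat) \<Rightarrow>\<^sub>0 'a"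

definition eval_matrix_poly :: "('a::field, 'n::finite) matrix_poly \<Rightarrow> 'a^'n^'n \<Rightarrow> 'a" where
  "eval_matrix_poly f g =
     (\<Sum>m\<in>Poly_Mapping.keys f. Poly_Mapping.lookup f m *
        (\<Prod>(i, j)\<in>Poly_Mapping.keys m. (g $ i $ j) ^ Poly_Mapping.lookup m (i, j)))"

definition vanishing_ideal :: "('a::field^'n^'n) set \<Rightarrow> ('a, 'n::finite) matrix_poly set" where
  "vanishing_ideal G = {f. \<forall>g\<in>G. eval_matrix_poly f g = 0}"

text \<open>
  A Zariski closed subgroup of \<open>GL\<^sub>n\<close> over an algebraically closed field (a universal domain)
  whose vanishing ideal is generated by polynomials with coefficients in the subfield \<open>F\<close>.
\<close>

definition linear_algebraic_group_over ::
  "'a::alg_closed_field set \<Rightarrow> ('a^'n::finite^'n) set \<Rightarrow> bool" where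
  "linear_algebraic_group_over F G \<longleftrightarrow>
     G \<subseteq> GL UNIV \<and>
     mat 1 \<in> G \<and> (\<forall>g\<in>G. \<forall>h\<in>G. g ** h \<in> G) \<and> (\<forall>g\<in>G. matrix_inv g \<in> G) \<and>
     (\<forall>g\<in>GL UNIV. (\<forall>f\<in>vanishing_ideal G. eval_matrix_poly f g = 0) \<longrightarrow> g \<in> G) \<and>
     vanishing_ideal G =
       Idl\<^bsub>ring_of_type_algebra\<^esub> {f \<in> vanishing_ideal G. range (Poly_Mapping.lookup f) \<subseteq> F}"

text \<open>\<open>\<G>(A)\<close> for a subring \<open>A\<close> of a field whose algebraic closure is the universal domain.\<close>

definition group_points :: "('a::field alg_closure^'n::finite^'n) set \<Rightarrow> 'a set \<Rightarrow> ('a^'n^'n) set" where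
  "group_points G A = {g \<in> GL A. map_matrix to_ac g \<in> G}"


section \<open>Difference modules and Picard-Vessiot rings\<close>

definition constants :: "('a \<Rightarrow> 'a) \<Rightarrow> 'a set \<Rightarrow> 'a set" where
  "constants \<phi> R = {x \<in> R. \<phi> x = x}"

definition difference_module ::
  "'a::field set \<Rightarrow> ('a \<Rightarrow> 'a) \<Rightarrow> ('a, 'm) module \<Rightarrow> ('m \<Rightarrow> 'm) \<Rightarrow> bool" where
  "difference_module F \<phi> M \<Phi> \<longleftrightarrow>
     module (ring_on F) M \<and> \<Phi> \<in> carrier M \<rightarrow> carrier M \<and>
     (\<forall>x\<in>carrier M. \<forall>y\<in>carrier M. \<Phi> (x \<oplus>\<^bsub>M\<^esub> y) = \<Phi> x \<oplus>\<^bsub>M\<^esub> \<Phi> y) \<and>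
     (\<forall>a\<in>F. \<forall>x\<in>carrier M. \<Phi> (a \<odot>\<^bsub>M\<^esub> x) = \<phi> a \<odot>\<^bsub>M\<^esub> \<Phi> x)"

definition module_basis :: "'a::field set \<Rightarrow> ('a, 'm) module \<Rightarrow> ('n::finite \<Rightarrow> 'm) \<Rightarrow> bool" where
  "module_basis F M b \<longleftrightarrow>
     range b \<subseteq> carrier M \<and>
     (\<forall>x\<in>carrier M. \<exists>!c. range c \<subseteq> F \<and> x = (\<Oplus>\<^bsub>M\<^esub>i\<in>UNIV. c i \<odot>\<^bsub>M\<^esub> b i))"

definition representing_matrix ::
  "('a::field, 'm) module \<Rightarrow> ('m \<Rightarrow> 'm) \<Rightarrow> ('n::finite \<Rightarrow> 'm) \<Rightarrow> 'a^'n^'n \<Rightarrow> bool" where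
  "representing_matrix M \<Phi> b D \<longleftrightarrow>
     (\<forall>j. \<Phi> (b j) = (\<Oplus>\<^bsub>M\<^esub>i\<in>UNIV. D $ i $ j \<odot>\<^bsub>M\<^esub> b i))"

definition fundamental_matrix ::
  "('a::field \<Rightarrow> 'a) \<Rightarrow> 'a^'n::finite^'n \<Rightarrow> 'a set \<Rightarrow> 'a^'n^'n \<Rightarrow> bool" where
  "fundamental_matrix \<phi> D R Y \<longleftrightarrow> Y \<in> GL R \<and> D ** map_matrix \<phi> Y = Y"

text \<open>\<open>F[Y, Y\<^sup>-\<^sup>1] = F[Y\<^sub>i\<^sub>j, det(Y)\<^sup>-\<^sup>1]\<close>\<close>

definition matrix_algebra :: "'a::field set \<Rightarrow> 'a^'n::finite^'n \<Rightarrow> 'a set" where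
  "matrix_algebra F Y =
     generate_ring ring_of_type_algebra (F \<union> {Y $ i $ j | i j. True} \<union> {inverse (det Y)})"

definition simple_difference_ring :: "('a::field \<Rightarrow> 'a) \<Rightarrow> 'a set \<Rightarrow> bool" where
  "simple_difference_ring \<phi> R \<longleftrightarrow>
     (\<forall>I. ideal I (ring_on R) \<and> \<phi> ` I \<subseteq> I \<longrightarrow> I = {0} \<or> I = R)"

definition picard_vessiot_ring ::
  "'a::field set \<Rightarrow> ('a \<Rightarrow> 'a) \<Rightarrow> 'a^'n::finite^'n \<Rightarrow> 'a^'n^'n \<Rightarrow> 'a set \<Rightarrow> bool" where
  "picard_vessiot_ring F \<phi> D Y R \<longleftrightarrow>
     subring R ring_of_type_algebra \<and> F \<subseteq> R \<and> \<phi> \<in> ring_hom (ring_on R) (ring_on R) \<and>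
     simple_difference_ring \<phi> R \<and> constants \<phi> R = constants \<phi> F \<and>
     fundamental_matrix \<phi> D R Y \<and> R = matrix_algebra F Y"


section \<open>Tensor products and the Galois group scheme\<close>

text \<open>
  The tensor product \<open>R \<otimes>\<^sub>C S\<close> of two subrings \<open>R\<close>, \<open>S\<close> of a field over a common subring \<open>C\<close>:
  the free abelian group on \<open>R \<times> S\<close>, with the multiplication extending
  \<open>(r, s)(r', s') = (rr', ss')\<close>, modulo the ideal generated by the bilinearity relations.
\<close>

definition frag_times ::
  "(('a::comm_ring_1 \<times> 'a) \<Rightarrow>\<^sub>0 int) \<Rightarrow> (('a \<times> 'a) \<Rightarrow>\<^sub>0 int) \<Rightarrow> (('a \<times> 'a) \<Rightarrow>\<^sub>0 int)" where
  "frag_times f g =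
     frag_extend (\<lambda>(a, b). frag_extend (\<lambda>(c, d). frag_of (a * c, b * d)) g) f"

definition pair_ring :: "'a::comm_ring_1 set \<Rightarrow> 'a set \<Rightarrow> (('a \<times> 'a) \<Rightarrow>\<^sub>0 int) ring" where
  "pair_ring R S =
     \<lparr>carrier = carrier (free_Abelian_group (R \<times> S)), monoid.mult = frag_times,
      one = frag_of (1, 1), ring.zero = 0, add = (+)\<rparr>"

definition tensor_relations ::
  "'a::comm_ring_1 set \<Rightarrow> 'a set \<Rightarrow> 'a set \<Rightarrow> (('a \<times> 'a) \<Rightarrow>\<^sub>0 int) set" where
  "tensor_relations C R S =
     {frag_of (r + r', s) - frag_of (r, s) - frag_of (r', s) | r r' s. r \<in> R \<and> r' \<in> R \<and> s \<in> S} \<union>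
     {frag_of (r, s + s') - frag_of (r, s) - frag_of (r, s') | r s s'. r \<in> R \<and> s \<in> S \<and> s' \<in> S} \<union>
     {frag_of (c * r, s) - frag_of (r, c * s) | c r s. c \<in> C \<and> r \<in> R \<and> s \<in> S}"

definition tensor_ideal ::
  "'a::comm_ring_1 set \<Rightarrow> 'a set \<Rightarrow> 'a set \<Rightarrow> (('a \<times> 'a) \<Rightarrow>\<^sub>0 int) set" where
  "tensor_ideal C R S = Idl\<^bsub>pair_ring R S\<^esub> (tensor_relations C R S)"

definition tensor_ring ::
  "'a::comm_ring_1 set \<Rightarrow> 'a set \<Rightarrow> 'a set \<Rightarrow> (('a \<times> 'a) \<Rightarrow>\<^sub>0 int) set ring" where
  "tensor_ring C R S = pair_ring R S Quot tensor_ideal C R S"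

text \<open>The pure tensor \<open>r \<otimes> s\<close>.\<close>

definition pure_tensor ::
  "'a::comm_ring_1 set \<Rightarrow> 'a set \<Rightarrow> 'a set \<Rightarrow> 'a \<Rightarrow> 'a \<Rightarrow> (('a \<times> 'a) \<Rightarrow>\<^sub>0 int) set" where
  "pure_tensor C R S r s = tensor_ideal C R S +>\<^bsub>pair_ring R S\<^esub> frag_of (r, s)"

text \<open>The endomorphism \<open>\<phi> \<otimes> id\<close> of \<open>R \<otimes>\<^sub>C S\<close>.  The union is one of equal cosets.\<close>

definition tensor_endo ::
  "'a::comm_ring_1 set \<Rightarrow> 'a set \<Rightarrow> 'a set \<Rightarrow> ('a \<Rightarrow> 'a)
    \<Rightarrow> (('a \<times> 'a) \<Rightarrow>\<^sub>0 int) set \<Rightarrow> (('a \<times> 'a) \<Rightarrow>\<^sub>0 int) set" where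
  "tensor_endo C R S \<phi> W =
     (\<Union>x\<in>W. tensor_ideal C R S +>\<^bsub>pair_ring R S\<^esub>
               (frag_extend (\<lambda>z. frag_of (\<phi> (fst z), snd z)) x))"

text \<open>\<open>Aut\<^sup>\<phi>(R \<otimes>\<^sub>C S / F \<otimes>\<^sub>C S)\<close>, where \<open>C\<close> is the field of constants of \<open>F\<close>\<close>

definition difference_automorphisms ::
  "'a::field set \<Rightarrow> ('a \<Rightarrow> 'a) \<Rightarrow> 'a set \<Rightarrow> 'a set
    \<Rightarrow> ((('a \<times> 'a) \<Rightarrow>\<^sub>0 int) set \<Rightarrow> (('a \<times> 'a) \<Rightarrow>\<^sub>0 int) set) set" where
  "difference_automorphisms F \<phi> R S =
     (let C = constants \<phi> F; T = tensor_ring C R S in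
      {\<sigma> \<in> ring_iso T T.
         (\<forall>f\<in>F. \<forall>s\<in>S. \<sigma> (pure_tensor C R S f s) = pure_tensor C R S f s) \<and>
         (\<forall>x\<in>carrier T. \<sigma> (tensor_endo C R S \<phi> x) = tensor_endo C R S \<phi> (\<sigma> x))})"

text \<open>
  The \<open>S\<close>-points of the Galois group scheme as a subgroup of \<open>GL\<^sub>n(S)\<close>: all \<open>A\<close> with
  \<open>1 \<otimes> A = (Y \<otimes> 1)\<^sup>-\<^sup>1 \<sigma>(Y \<otimes> 1)\<close> for some automorphism \<open>\<sigma>\<close>.
\<close>

definition galois_group_points ::
  "'a::field set \<Rightarrow> ('a \<Rightarrow> 'a) \<Rightarrow> 'a set \<Rightarrow> 'a^'n::finite^'n \<Rightarrow> 'a set \<Rightarrow> ('a^'n^'n) set" where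
  "galois_group_points F \<phi> R Y S =
     (let C = constants \<phi> F; T = tensor_ring C R S in
      {A \<in> GL S. \<exists>\<sigma>\<in>difference_automorphisms F \<phi> R S. \<forall>i j.
         pure_tensor C R S 1 (A $ i $ j) =
           (\<Oplus>\<^bsub>T\<^esub>l\<in>UNIV. pure_tensor C R S (matrix_inv Y $ i $ l) 1 \<otimes>\<^bsub>T\<^esub>
                             \<sigma> (pure_tensor C R S (Y $ l $ j) 1))})"

text \<open>\<open>D \<phi>(D) \<cdots> \<phi>\<^sup>d\<^sup>-\<^sup>1(D)\<close>\<close>

primrec twisted_product :: "('a::semiring_1 \<Rightarrow> 'a) \<Rightarrow> 'a^'n::finite^'n \<Rightarrow> nat \<Rightarrow> 'a^'n^'n" where
  "twisted_product \<phi> D 0 = mat 1"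
| "twisted_product \<phi> D (Suc j) = twisted_product \<phi> D j ** map_matrix (\<phi> ^^ j) D"

end

theory Submission
  imports Defs
begin

text \<open>
  Specializing \<open>Y = D \<phi>(D) \<cdots> \<phi>\<^sup>d\<^sup>-\<^sup>1(D) \<phi>\<^sup>d(Y)\<close> shows that the matrix in question is
  \<open>A = \<phi>\<^sup>d(\<kappa>(Y))\<^sup>-\<^sup>1 \<kappa>(Y)\<close>.  It lies in the Galois group if \<open>f(Y A) = 0\<close> for every polynomial
  \<open>f\<close> over \<open>k(t)\<close> with \<open>f(Y) = 0\<close>.  The space of the polynomials \<open>f(Y X)\<close>, for \<open>f\<close> in the span
  of these relations, is \<open>\<phi>\<close>-stable, hence spanned by polynomials \<open>h\<close> with constant coefficients,
  and \<open>h(Y\<^sup>-\<^sup>1 X)\<close> is a combination of relations.  Over the Gauss valuation ring of \<open>k(t)\<close> the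
  relations have a basis such that the coordinates of an integral combination are integral.
  So \<open>h(Y\<^sup>-\<^sup>1 X)\<close> can be specialized, by \<open>\<phi>\<^sup>d \<circ> \<kappa>\<close>, which agrees with \<open>\<kappa>\<close> on the basis since
  \<open>\<kappa>\<close> maps \<open>\<oo>\<close> to the field with \<open>q\<^sup>d\<close> elements; inserting \<open>\<kappa>(Y)\<close> for \<open>X\<close> gives \<open>h(A) = 0\<close>.
\<close>

text \<open>Specializing a relation f(Y) = 0 directly gives \<kappa>(f) at \<kappa>(Y), whereas
  membership in the Galois group asks for f itself at Y A. Constant coefficients remove this
  obstacle: F_q[[t]] is fixed by \<kappa> and by \<phi>, so h keeps its coefficients. That
  \<kappa>(Y) makes sense is a separate matter: \<O> lives in the separable closure of k, so the
  coefficients of Y, a priori in K, have to be shown separable over k before they can be shown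
  integral; both follow from equations x^q = P x. On the side of group schemes, R and S = F_q((t))
  are linearly disjoint over the constants, so R \<otimes> S is a subring of K((t)), and an
  automorphism is the substitution of Y A for Y there. Exchanging the roles of \<kappa> and its
  twist by the d-th iterate of \<phi> gives the relations for the inverse of A, hence invertibility.
  As F_q[[t]] is not an algebra over F_q(t), its points are the points over F_q((t)) that lie in
  GL_n(F_q[[t]]).\<close>

no_notation fps_nth (infixl \<open>$\<close> 75)

section \<open>Subrings and linear algebra with supports\<close>

locale subring_set =
  fixes A :: "'a::comm_ring_1 set"
  assumes one_closed: "1 \<in> A"
    and add_closed: "x \<in> A \<Longrightarrow> y \<in> A \<Longrightarrow> x + y \<in> A"
    and uminus_closed: "x \<in> A \<Longrightarrow> - x \<in> A"
    and mult_closed: "x \<in> A \<Longrightarrow> y \<in> A \<Longrightarrow> x * y \<in> A"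
begin

lemma zero_closed: "0 \<in> A"
  using add_closed[OF one_closed uminus_closed[OF one_closed]] by simp

lemma diff_closed: "x \<in> A \<Longrightarrow> y \<in> A \<Longrightarrow> x - y \<in> A"
  using add_closed[of x "- y"] uminus_closed by simp

lemma sum_closed: "(\<And>i. i \<in> I \<Longrightarrow> f i \<in> A) \<Longrightarrow> sum f I \<in> A"
  by (induction I rule: infinite_finite_induct) (auto simp: zero_closed add_closed)

lemma prod_closed: "(\<And>i. i \<in> I \<Longrightarrow> f i \<in> A) \<Longrightarrow> prod f I \<in> A"
  by (induction I rule: infinite_finite_induct) (auto simp: one_closed mult_closed)

lemma power_closed: "x \<in> A \<Longrightarrow> x ^ n \<in> A"
  by (induction n) (auto simp: one_closed mult_closed)

lemma of_int_closed: "of_int n \<in> A"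
proof -
  have "of_nat m \<in> A" for m
    by (induction m) (auto simp: zero_closed one_closed add_closed)
  then show ?thesis
    by (cases n) (auto intro: uminus_closed simp del: of_nat_Suc)
qed

lemmas ring_closed =
  zero_closed one_closed add_closed uminus_closed diff_closed mult_closed power_closed

end

locale subfield_set = subring_set F for F :: "'a::field set" +
  assumes inverse_closed: "x \<in> F \<Longrightarrow> inverse x \<in> F"
begin

lemma divide_closed: "x \<in> F \<Longrightarrow> y \<in> F \<Longrightarrow> x / y \<in> F"
  using mult_closed[of x "inverse y"] inverse_closed by (simp add: divide_inverse)

end

locale subring_hom = subring_set A for A :: "'a::comm_ring_1 set" +
  fixes h :: "'a \<Rightarrow> 'b::comm_ring_1"
  assumes hom_one: "h 1 = 1"
    and hom_add: "x \<in> A \<Longrightarrow> y \<in> A \<Longrightarrow> h (x + y) = h x + h y"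
    and hom_mult: "x \<in> A \<Longrightarrow> y \<in> A \<Longrightarrow> h (x * y) = h x * h y"
begin

lemma hom_zero: "h 0 = 0"
  using hom_add[OF zero_closed zero_closed] by simp

lemma hom_uminus: "x \<in> A \<Longrightarrow> h (- x) = - h x"
  using hom_add[of x "- x"] uminus_closed[of x] hom_zero by (simp add: add_eq_0_iff)

lemma hom_diff: "x \<in> A \<Longrightarrow> y \<in> A \<Longrightarrow> h (x - y) = h x - h y"
  using hom_add[of x "- y"] uminus_closed[of y] hom_uminus[of y] by simp

lemma hom_sum: "(\<And>i. i \<in> I \<Longrightarrow> f i \<in> A) \<Longrightarrow> h (sum f I) = (\<Sum>i\<in>I. h (f i))"
  by (induction I rule: infinite_finite_induct) (auto simp: hom_zero hom_add sum_closed)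

lemma hom_prod: "(\<And>i. i \<in> I \<Longrightarrow> f i \<in> A) \<Longrightarrow> h (prod f I) = (\<Prod>i\<in>I. h (f i))"
  by (induction I rule: infinite_finite_induct) (auto simp: hom_one hom_mult prod_closed)

lemma hom_power: "x \<in> A \<Longrightarrow> h (x ^ n) = h x ^ n"
  by (induction n) (auto simp: hom_one hom_mult power_closed)

lemma hom_of_int: "h (of_int n) = of_int n"
proof -
  have "h (of_nat m) = of_nat m \<and> of_nat m \<in> A" for m
    by (induction m) (auto simp: hom_zero hom_one hom_add zero_closed one_closed add_closed)
  then show ?thesis
    by (cases n) (auto simp: hom_uminus simp del: of_nat_Suc)
qed

end

lemma subring_set_UNIV: "subring_set UNIV"
  by unfold_locales auto

lemma subring_imp_subring_set:
  fixes A :: "'a::comm_ring_1 set"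
  assumes "subring A ring_of_type_algebra"
  shows "subring_set A"
proof -
  interpret ring "ring_of_type_algebra :: 'a ring"
    by (rule ring_from_type_algebra)
  have neg: "a_inv (ring_of_type_algebra :: 'a ring) x = - x" for x
    using minus_equality[of "- x" x] by (simp add: ring_of_type_algebra_def)
  show ?thesis
    using subringE(3,5-7)[OF assms]
    by unfold_locales (auto simp: neg, auto simp: ring_of_type_algebra_def)
qed

section \<open>Linear spans of functions, descent to fixed vectors, and bases over valuation
  rings\<close>

inductive_set lin_span :: "'a::comm_ring_1 set \<Rightarrow> ('i \<Rightarrow> 'a) set \<Rightarrow> ('i \<Rightarrow> 'a) set"
  for E :: "'a set" and S :: "('i \<Rightarrow> 'a) set" where
  zero: "(\<lambda>_. 0) \<in> lin_span E S"
| add: "c \<in> E \<Longrightarrow> v \<in> S \<Longrightarrow> u \<in> lin_span E S \<Longrightarrow> (\<lambda>i. c * v i + u i) \<in> lin_span E S"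

lemma lin_span_add:
  assumes "u \<in> lin_span E S" "v \<in> lin_span E S"
  shows "(\<lambda>i. u i + v i) \<in> lin_span E S"
  using assms(1)
proof induction
  case (add c w u)
  from lin_span.add[OF add.hyps(1,2) add.IH] show ?case
    by (simp add: add.assoc)
qed (use assms in simp)

lemma (in subring_set) lin_span_scale:
  assumes "u \<in> lin_span A S" "c \<in> A"
  shows "(\<lambda>i. c * u i) \<in> lin_span A S"
  using assms(1)
proof induction
  case (add d w u)
  from lin_span.add[OF mult_closed[OF assms(2) add.hyps(1)] add.hyps(2) add.IH] show ?case
    by (simp add: algebra_simps)
qed (use lin_span.zero in simp)

lemma (in subring_set) lin_span_base:
  assumes "v \<in> S"
  shows "v \<in> lin_span A S"
  using lin_span.add[OF one_closed assms lin_span.zero] by simp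

lemma (in subring_set) lin_span_closed:
  assumes "w \<in> lin_span A S" "\<And>v i. v \<in> S \<Longrightarrow> v i \<in> A"
  shows "w i \<in> A"
  using assms(1) by induction (auto simp: ring_closed assms(2))

text \<open>The subspace contains vectors of minimal support; normalized to have an entry 1, such a
  vector is fixed, since \<open>\<phi> v - v\<close> has smaller support.\<close>

lemma descent:
  assumes "subfield_set E" and "subring_hom E \<phi>"
    and add: "\<And>u v. u \<in> J \<Longrightarrow> v \<in> J \<Longrightarrow> (\<lambda>i. u i + v i) \<in> J"
    and scale: "\<And>c u. c \<in> E \<Longrightarrow> u \<in> J \<Longrightarrow> (\<lambda>i. c * u i) \<in> J"
    and entries: "\<And>u i. u \<in> J \<Longrightarrow> u i \<in> E"
    and stable: "\<And>u. u \<in> J \<Longrightarrow> (\<lambda>i. \<phi> (u i)) \<in> J"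
    and "w \<in> J" "finite {i. w i \<noteq> 0}"
  shows "w \<in> lin_span E {h \<in> J. \<forall>i. \<phi> (h i) = h i}"
  using \<open>w \<in> J\<close> \<open>finite {i. w i \<noteq> 0}\<close>
proof (induction "card {i. w i \<noteq> 0}" arbitrary: w rule: less_induct)
  case less
  interpret subfield_set E by fact
  interpret subring_hom E \<phi> by fact
  show ?case
  proof (cases "w = (\<lambda>_. 0)")
    case True
    then show ?thesis by (simp add: lin_span.zero)
  next
    case False
    let ?supp = "\<lambda>u. {i. u i \<noteq> 0}"
    let ?P = "\<lambda>u. u \<in> J \<and> u \<noteq> (\<lambda>_. 0) \<and> ?supp u \<subseteq> ?supp w"
    obtain v where v: "?P v" and least: "\<And>u. ?P u \<Longrightarrow> card (?supp v) \<le> card (?supp u)"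
      using ex_has_least_nat[of ?P w "\<lambda>u. card (?supp u)"] False less.prems by blast
    from v obtain m where m: "v m \<noteq> 0" by auto
    define v' where "v' = (\<lambda>i. inverse (v m) * v i)"
    have v'J: "v' \<in> J"
      unfolding v'_def using v by (auto intro!: scale[OF inverse_closed[OF entries]])
    have v'm: "v' m = 1"
      using m by (simp add: v'_def)
    have fin: "finite (?supp v)"
      using v less.prems finite_subset by blast
    have fixed: "\<phi> (v' i) = v' i" for i
    proof -
      define u where "u = (\<lambda>i. \<phi> (v' i) + (- 1) * v' i)"
      have "u \<in> J"
        unfolding u_def
        by (rule add[OF stable[OF v'J] scale[OF uminus_closed[OF one_closed] v'J]])
      moreover have "?supp u \<subseteq> ?supp v"
        by (auto simp: u_def v'_def hom_zero)
      moreover have "u m = 0"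
        using v'm by (simp add: u_def hom_one)
      ultimately have "card (?supp u) < card (?supp v)"
        using fin m by (intro psubset_card_mono) auto
      with least[of u] v \<open>u \<in> J\<close> \<open>?supp u \<subseteq> ?supp v\<close> have "u = (\<lambda>_. 0)"
        by fastforce
      from fun_cong[OF this, of i] show ?thesis by (simp add: u_def)
    qed
    \<comment> \<open>This subtraction kills coordinate \<open>m\<close> and creates no new one,
      since \<open>v\<close> was chosen with support inside that of \<open>w\<close>; the induction
      on the size of the support then applies to \<open>w'\<close>.\<close>
    define w' where "w' = (\<lambda>i. w i + (- w m) * v' i)"
    have w'J: "w' \<in> J"
      unfolding w'_def
      by (rule add[OF less.prems(1) scale[OF uminus_closed[OF entries[OF less.prems(1)]] v'J]])
    have "?supp w' \<subseteq> ?supp w - {m}"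
      using v v'm by (auto simp: w'_def v'_def)
    moreover have "m \<in> ?supp w"
      using v m by auto
    ultimately have "w' \<in> lin_span E {h \<in> J. \<forall>i. \<phi> (h i) = h i}"
      using less.prems by (intro less.hyps w'J psubset_card_mono) (auto intro: finite_subset)
    from lin_span.add[OF entries[OF less.prems(1)] _ this, of v' m] fixed v'J
    show ?thesis by (simp add: w'_def)
  qed
qed

text \<open>Reading \<open>x / y \<in> B\<close> as |x| \<le> |y|, the first assumption makes the
  comparison total on \<open>U\<close>, and closure under products makes it transitive; a finite set
  then has a largest element.\<close>

lemma ex_dominant:
  assumes "\<And>x y. x \<in> U \<Longrightarrow> y \<in> U \<Longrightarrow> x / y \<in> B \<or> y / x \<in> B"
    and "\<And>a b. a \<in> B \<Longrightarrow> b \<in> B \<Longrightarrow> a * b \<in> B"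
    and "finite U" "U \<noteq> {}" "(0::'a::field) \<notin> U"
  shows "\<exists>y\<in>U. \<forall>x\<in>U. x / y \<in> B"
  using assms(3,4,1,5)
proof (induction rule: finite_ne_induct)
  case (singleton x)
  then show ?case by auto
next
  case (insert x U)
  then obtain y where y: "y \<in> U" "\<forall>z\<in>U. z / y \<in> B" by auto
  show ?case
  proof (cases "x / y \<in> B")
    case True
    with y show ?thesis by auto
  next
    case False
    then have "y / x \<in> B"
      using insert.prems(1)[of x y] y(1) by auto
    then have "z / x \<in> B" if "z \<in> U" for z
      using assms(2)[of "z / y" "y / x"] that y insert.prems(2) by (auto split: if_splits)
    moreover have "x / x \<in> B"
      using insert.prems(1)[of x x] by auto
    ultimately show ?thesis by auto
  qed
qed

text \<open>Gaussian elimination with the pivot taken at an entry of largest value: dividing by it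
  keeps every entry in \<open>B\<close>, so the reduced echelon basis is integral. Because the pivot
  columns in \<open>J\<close> form an identity matrix, the coordinates of \<open>g\<close> are its
  own entries \<open>g j\<close>. The case \<open>B = F\<close> is ordinary elimination.\<close>

lemma pivot_basis:
  assumes "subfield_set F" "subring_set B"
    and val: "\<And>x. x \<in> F \<Longrightarrow> x \<in> B \<or> inverse x \<in> B"
    and add: "\<And>u v. u \<in> V \<Longrightarrow> v \<in> V \<Longrightarrow> (\<lambda>i. u i + v i) \<in> V"
    and scale: "\<And>c u. c \<in> F \<Longrightarrow> u \<in> V \<Longrightarrow> (\<lambda>i. c * u i) \<in> V"
    and entries: "\<And>u i. u \<in> V \<Longrightarrow> u i \<in> F"
    and "finite T"
  shows "\<exists>J f. J \<subseteq> T \<and>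
    (\<forall>j\<in>J. f j \<in> V \<and> (\<forall>i. i \<notin> T \<longrightarrow> f j i = 0) \<and> (\<forall>i. f j i \<in> B) \<and>
            (\<forall>i\<in>J. f j i = (if i = j then 1 else 0))) \<and>
    (\<forall>g\<in>V. (\<forall>i. i \<notin> T \<longrightarrow> g i = 0) \<longrightarrow> (\<forall>i. g i = (\<Sum>j\<in>J. g j * f j i)))"
  using \<open>finite T\<close>
proof (induction "card T" arbitrary: T rule: less_induct)
  case less
  interpret subfield_set F by fact
  interpret B: subring_set B by fact
  show ?case
  proof (cases "\<exists>g\<in>V. (\<forall>i. i \<notin> T \<longrightarrow> g i = 0) \<and> (\<exists>i. g i \<noteq> 0)")
    case False
    then have "\<forall>g\<in>V. (\<forall>i. i \<notin> T \<longrightarrow> g i = 0) \<longrightarrow> (\<forall>i. g i = 0)"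
      by blast
    then show ?thesis
      by (intro exI[of _ "{}"] exI[of _ "\<lambda>_ _. 0"]) simp
  next
    case True
    then obtain g where g: "g \<in> V" "\<And>i. i \<notin> T \<Longrightarrow> g i = 0" "\<exists>i. g i \<noteq> 0" by (elim bexE conjE) (rule that, auto)
    define U where "U = g ` T - {0}"
    have "x / y \<in> B \<or> y / x \<in> B" if "x \<in> U" "y \<in> U" for x y
      using that val[of "x / y"] entries[OF g(1)] divide_closed by (auto simp: U_def)
    moreover have "U \<noteq> {}"
      using g(2,3) by (auto simp: U_def)
    ultimately have "\<exists>y\<in>U. \<forall>x\<in>U. x / y \<in> B"
      using less.prems by (intro ex_dominant) (auto simp: U_def B.mult_closed)
    then obtain m where m: "m \<in> T" "g m \<noteq> 0" "\<And>i. i \<in> T \<Longrightarrow> g i \<noteq> 0 \<Longrightarrow> g i / g m \<in> B"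
      by (auto simp: U_def)
    define g' where "g' = (\<lambda>i. inverse (g m) * g i)"
    have g': "g' \<in> V" "\<And>i. i \<notin> T \<Longrightarrow> g' i = 0" "\<And>i. g' i \<in> B" "g' m = 1"
    proof -
      show "g' \<in> V" unfolding g'_def by (rule scale[OF inverse_closed[OF entries[OF g(1)]] g(1)])
      show "g' i \<in> B" for i
        using m(3)[of i] g(2)[of i] B.zero_closed
        by (cases "g i = 0") (auto simp: g'_def field_simps)
    qed (use g m in \<open>auto simp: g'_def\<close>)
    have "card (T - {m}) < card T"
      using m(1) less.prems by (intro psubset_card_mono) auto
    from less.hyps[OF this finite_Diff[OF less.prems]] obtain J f
      where J: "J \<subseteq> T - {m}"
        and f': "\<forall>j\<in>J. f j \<in> V \<and> (\<forall>i. i \<notin> T - {m} \<longrightarrow> f j i = 0) \<and> (\<forall>i. f j i \<in> B) \<and>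
          (\<forall>i\<in>J. f j i = (if i = j then 1 else 0))"
        and span: "\<forall>g\<in>V. (\<forall>i. i \<notin> T - {m} \<longrightarrow> g i = 0) \<longrightarrow> (\<forall>i. g i = (\<Sum>j\<in>J. g j * f j i))"
      by (elim exE conjE) (rule that)
    have f: "\<And>j. j \<in> J \<Longrightarrow> f j \<in> V" "\<And>j i. j \<in> J \<Longrightarrow> i \<notin> T - {m} \<Longrightarrow> f j i = 0"
        "\<And>j i. j \<in> J \<Longrightarrow> f j i \<in> B" "\<And>j i. j \<in> J \<Longrightarrow> i \<in> J \<Longrightarrow> f j i = (if i = j then 1 else 0)"
      using f' by simp_all
    have finJ: "finite J"
      using J less.prems finite_subset by blast
    have mJ: "m \<notin> J" using J by auto
    have comb: "(\<lambda>i. u i + (\<Sum>j\<in>J'. c j * f j i)) \<in> V"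
      if "u \<in> V" "J' \<subseteq> J" "\<And>j. j \<in> J' \<Longrightarrow> c j \<in> F" for u c J'
    proof -
      have "finite J'" using that(2) finJ finite_subset by blast
      then show ?thesis using that(2,3)
      proof (induction J' rule: finite_induct)
        case (insert x J')
        then have "(\<lambda>i. (u i + (\<Sum>j\<in>J'. c j * f j i)) + c x * f x i) \<in> V"
          by (intro add[OF insert.IH scale]) (auto simp: f)
        then show ?case using insert by (simp add: algebra_simps)
      qed (use that in simp)
    qed
    \<comment> \<open>Clears the coordinates of \<open>g'\<close> in \<open>J\<close>. Coordinate
      \<open>m\<close> stays 1 since every \<open>f j\<close> vanishes there, for which reason the
      old basis vectors can also be kept; integrality persists because all factors lie in
      \<open>B\<close>.\<close>
    define h where "h = (\<lambda>i. g' i + (\<Sum>j\<in>J. (- g' j) * f j i))"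
    have hV: "h \<in> V"
      unfolding h_def using uminus_closed[OF entries[OF g'(1)]]
      by (rule comb[OF g'(1) subset_refl])
    have h_out: "h i = 0" if "i \<notin> T" for i
      using that g'(2) f(2)[of _ i] by (auto simp: h_def intro!: sum.neutral)
    have hB: "h i \<in> B" for i
      unfolding h_def by (intro B.add_closed B.sum_closed B.mult_closed B.uminus_closed g' f)
    have hm: "h m = 1"
      using g'(4) f(2)[of _ m] by (auto simp: h_def intro!: sum.neutral)
    have hJ: "h i = 0" if "i \<in> J" for i
    proof -
      have "(\<Sum>j\<in>J. (- g' j) * f j i) = (\<Sum>j\<in>J. if i = j then - g' j else 0)"
        using that by (intro sum.cong) (auto simp: f(4))
      also have "\<dots> = - g' i"
        using finJ that by simp
      finally show ?thesis by (simp add: h_def)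
    qed
    define f' where "f' = f(m := h)"
    have f'm: "f' m = h" and f'J: "\<And>j. j \<in> J \<Longrightarrow> f' j = f j"
      using mJ by (auto simp: f'_def)
    show ?thesis
    proof (intro exI[of _ "insert m J"] exI[of _ f'] conjI ballI impI allI)
      show "insert m J \<subseteq> T" using J m by auto
    next
      fix u i assume u: "u \<in> V" "\<forall>i. i \<notin> T \<longrightarrow> u i = 0"
      \<comment> \<open>\<open>u'\<close> vanishes at \<open>m\<close>, so the induction hypothesis
        expands it; since \<open>h\<close> is 0 on \<open>J\<close>, its coordinates there are those
        of \<open>u\<close>.\<close>
      define u' where "u' = (\<lambda>i. u i + (- u m) * h i)"
      have "u' i = (\<Sum>j\<in>J. u' j * f j i)"
      proof (intro span[rule_format])
        show "u' \<in> V"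
          unfolding u'_def
          by (rule add[OF u(1) scale[OF uminus_closed[OF entries[OF u(1)]] hV]])
        show "u' i = 0" if "i \<notin> T - {m}" for i
          using that u h_out hm by (cases "i = m") (auto simp: u'_def)
      qed
      also have "\<dots> = (\<Sum>j\<in>J. u j * f' j i)"
        by (intro sum.cong) (auto simp: u'_def hJ f'J)
      finally show "u i = (\<Sum>j\<in>insert m J. u j * f' j i)"
        using finJ mJ by (simp add: u'_def f'm algebra_simps)
    next
      fix j assume "j \<in> insert m J"
      then consider "j = m" | "j \<in> J" "j \<noteq> m" using mJ by auto
      then have "f' j \<in> V \<and> (\<forall>i. i \<notin> T \<longrightarrow> f' j i = 0) \<and> (\<forall>i. f' j i \<in> B) \<and>
        (\<forall>i\<in>insert m J. f' j i = (if i = j then 1 else 0))"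
      proof cases
        case 1
        have "\<forall>i\<in>insert m J. h i = (if i = m then 1 else 0)"
          using hm hJ mJ by auto
        then show ?thesis
          using 1 hV h_out hB by (simp add: f'm)
      next
        case 2
        have "\<forall>i\<in>insert m J. f j i = (if i = j then 1 else 0)"
          using 2 f(2)[of j m] f(4)[of j] by auto
        moreover have "\<forall>i. i \<notin> T \<longrightarrow> f j i = 0"
          using 2 f(2)[of j] by auto
        ultimately show ?thesis
          using 2 f(1,3)[of j] by (simp add: f'J)
      qed
      then show "f' j \<in> V" "\<And>i. i \<notin> T \<Longrightarrow> f' j i = 0" "\<And>i. f' j i \<in> B"
        "\<And>i. i \<in> insert m J \<Longrightarrow> f' j i = (if i = j then 1 else 0)"
        by blast+
    qed
  qed
qed

section \<open>Frobenius systems and separability\<close>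

lemma lin_span_range:
  assumes "subring_set A" "w \<in> lin_span A (range M)"
  shows "\<exists>N (c :: nat \<Rightarrow> 'a::comm_ring_1). (\<forall>n. c n \<in> A) \<and> (\<forall>i. w i = (\<Sum>n<N. c n * M n i))"
proof -
  interpret subring_set A by fact
  from assms(2) show ?thesis
  proof induction
    case zero
    then show ?case by (intro exI[of _ 0] exI[of _ "\<lambda>_. 0"]) (simp add: zero_closed)
  next
    case (add a v u)
    then obtain N c where c: "\<And>n. c n \<in> A" "\<And>i. u i = (\<Sum>n<N. c n * M n i)" by auto
    from add obtain m where v: "v = M m" by auto
    define c' where "c' n = (if n < N then c n else 0) + (if n = m then a else 0)" for n
    have "a * v i + u i = (\<Sum>n<max N (Suc m). c' n * M n i)" for i
    proof -
      have "(\<Sum>n<max N (Suc m). c' n * M n i) =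
          (\<Sum>n<max N (Suc m). if n < N then c n * M n i else 0) +
          (\<Sum>n<max N (Suc m). if n = m then a * M n i else 0)"
        unfolding sum.distrib[symmetric] by (intro sum.cong) (auto simp: c'_def algebra_simps)
      also have "(\<Sum>n<max N (Suc m). if n < N then c n * M n i else 0) = u i"
        unfolding c(2) by (intro sum.mono_neutral_cong_right) auto
      also have "(\<Sum>n<max N (Suc m). if n = m then a * M n i else 0) = a * v i"
        by (subst sum.delta) (auto simp: v)
      finally show ?thesis by simp
    qed
    moreover have "c' n \<in> A" for n
      using add c by (auto simp: c'_def intro!: add_closed zero_closed)
    ultimately show ?case by blast
  qed
qed

lemma lin_span_range_uniform:
  assumes "subring_set A" "finite J" "\<And>j. j \<in> J \<Longrightarrow> w j \<in> lin_span A (range M)"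
  shows "\<exists>N (c :: 'j \<Rightarrow> nat \<Rightarrow> 'a::comm_ring_1).
    (\<forall>j n. c j n \<in> A) \<and> (\<forall>j\<in>J. \<forall>i. w j i = (\<Sum>n<N. c j n * M n i))"
proof -
  interpret subring_set A by fact
  have "\<forall>j\<in>J. \<exists>p. (\<forall>n. snd p n \<in> A) \<and> (\<forall>i. w j i = (\<Sum>n<fst p. snd p n * M n i))"
    using lin_span_range[OF assms(1,3)] by simp
  from bchoice[OF this] obtain p where p: "\<And>j n. j \<in> J \<Longrightarrow> snd (p j) n \<in> A"
    "\<And>j i. j \<in> J \<Longrightarrow> w j i = (\<Sum>n<fst (p j). snd (p j) n * M n i)"
    by blast
  define N where "N = (\<Sum>j\<in>J. fst (p j))"
  define c where "c j n = (if j \<in> J \<and> n < fst (p j) then snd (p j) n else 0)" for j n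
  have "w j i = (\<Sum>n<N. c j n * M n i)" if "j \<in> J" for i j
  proof -
    have "fst (p j) \<le> N"
      unfolding N_def using assms(2) that by (intro member_le_sum) auto
    then show ?thesis
      unfolding p(2)[OF that] using that by (intro sum.mono_neutral_cong_left) (auto simp: c_def)
  qed
  moreover have "c j n \<in> A" for j n
    using p(1) zero_closed by (auto simp: c_def)
  ultimately show ?thesis by blast
qed

text \<open>A double root of \<open>f\<close> would be a root of its derivative, the constant
  1.\<close>

lemma rsquarefree_if_pderiv_eq_1:
  fixes f :: "'a::idom poly"
  assumes "pderiv f = 1"
  shows "rsquarefree f"
  unfolding rsquarefree_def
proof (intro conjI allI)
  show "f \<noteq> 0" using assms by auto
  fix a
  have "\<not> 2 \<le> Polynomial.order a f"
  proof
    assume "2 \<le> Polynomial.order a f"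
    then have "[:- a, 1:] ^ 2 dvd f"
      by (metis dvd_trans le_imp_power_dvd order_1)
    then obtain g where f: "f = [:- a, 1:] * ([:- a, 1:] * g)"
      by (elim dvdE) (simp only: power2_eq_square mult.assoc)
    have "poly (pderiv f) a = 0"
      unfolding f pderiv_mult by simp
    with assms show False by simp
  qed
  then show "Polynomial.order a f = 0 \<or> Polynomial.order a f = 1" by linarith
qed

text \<open>\<open>f\<close> splits into linear factors, and squarefreeness makes every multiplicity
  in the multiset of roots equal to 1.\<close>

lemma card_roots_rsquarefree:
  fixes f :: "'a::alg_closed_field poly"
  assumes "rsquarefree f"
  shows "card {a. poly f a = 0} = Polynomial.degree f"
proof -
  have f0: "f \<noteq> 0" using assms by (simp add: rsquarefree_def)
  obtain A where A: "size A = Polynomial.degree f" "f = Polynomial.smult (Polynomial.lead_coeff f) (\<Prod>x\<in>#A. [:-x, 1:])"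
    using alg_closed_imp_factorization[OF f0] by blast
  have nz: "(\<Prod>x\<in>#A. [:-x, 1:]) \<noteq> 0" for A :: "'a multiset"
    by (induction A) (simp_all del: mult_pCons_left)
  have "proots (\<Prod>x\<in>#A. [:-x, 1:]) = A" for A :: "'a multiset"
  proof (induction A)
    case (add x A)
    have "proots ([:-x, 1:] * (\<Prod>x\<in>#A. [:-x, 1:])) = proots [:-x, 1:] + proots (\<Prod>x\<in>#A. [:-x, 1:])"
      by (rule proots_mult[OF _ nz]) simp
    with add show ?case by (simp del: mult_pCons_left)
  qed simp
  then have pf: "proots f = A"
    using f0 by (subst A(2)) (simp add: proots_smult)
  have "size (proots f) = card (set_mset (proots f))"
    unfolding size_multiset_overloaded_eq
    using assms f0 by (simp add: rsquarefree_root_order)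
  then show ?thesis
    by (metis A(1) f0 pf set_count_proots)
qed

text \<open>The argument \<open>ty\<close> only fixes the type of K. By \<open>of_nat_q\<close> the
  derivative of X^(q^n) vanishes for positive n, which is the source of the separable polynomials
  below.\<close>

locale frobenius_power =
  fixes q :: nat and ty :: "'a::alg_closed_field itself"
  assumes q_gt_1: "q > 1"
    and add_power_q: "(x + y) ^ q = x ^ q + (y::'a) ^ q"
    and of_nat_q: "of_nat q = (0::'a)"
begin

lemma zero_power_q: "0 ^ q = (0::'a)"
  using q_gt_1 by (simp add: power_0_left)

lemma sum_power_q: "sum f I ^ q = (\<Sum>i\<in>I. (f i :: 'a) ^ q)"
  by (induction I rule: infinite_finite_induct) (auto simp: zero_power_q add_power_q)

lemma ex_root_q: "\<exists>y. y ^ q = (x::'a)"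
  using q_gt_1 by (intro nth_root_exists) simp

lemma uminus_power_q: "(- x) ^ q = - ((x::'a) ^ q)"
  using add_power_q[of x "- x"] by (simp add: zero_power_q add_eq_0_iff)

end

text \<open>The condition \<open>inj\<close> says that \<open>P\<close> is invertible.\<close>

locale frobenius_system = frobenius_power q ty + k: subfield_set k
  for q :: nat and ty :: "'a::alg_closed_field itself" and k :: "'a set" +
  fixes I :: "'i set" and P :: "'i \<Rightarrow> 'i \<Rightarrow> 'a" and x :: "'i \<Rightarrow> 'a"
  assumes finite_I: "finite I"
    and P_closed: "i \<in> I \<Longrightarrow> j \<in> I \<Longrightarrow> P i j \<in> k"
    and system: "i \<in> I \<Longrightarrow> x i ^ q = (\<Sum>j\<in>I. P i j * x j)"
    and inj: "(\<And>j. j \<in> I \<Longrightarrow> (\<Sum>i\<in>I. w i * P i j) = 0) \<Longrightarrow> i \<in> I \<Longrightarrow> w i = 0"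
begin

text \<open>The row \<open>u\<close> is sent to its entrywise q-th power times the matrix
  \<open>P\<close>: if y = u x, then y^q = \<open>step u\<close> x. The value 0 outside
  \<open>I\<close> lets equality of rows be equality of functions.\<close>

definition step :: "('i \<Rightarrow> 'a) \<Rightarrow> 'i \<Rightarrow> 'a" where
  "step u j = (if j \<in> I then \<Sum>i\<in>I. u i ^ q * P i j else 0)"

lemma step_sum: "step (\<lambda>i. \<Sum>n\<in>N. c n * v n i) j = (\<Sum>n\<in>N. c n ^ q * step (v n) j)"
proof (cases "j \<in> I")
  case True
  have "step (\<lambda>i. \<Sum>n\<in>N. c n * v n i) j = (\<Sum>i\<in>I. \<Sum>n\<in>N. c n ^ q * (v n i ^ q * P i j))"
    using True by (simp add: step_def sum_power_q sum_distrib_right power_mult_distrib mult.assoc)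
  also have "\<dots> = (\<Sum>n\<in>N. c n ^ q * step (v n) j)"
    using True by (subst sum.swap) (simp add: step_def sum_distrib_left)
  finally show ?thesis .
qed (simp add: step_def)

lemma step_eq_0_imp:
  assumes "\<And>j. step u j = 0" "i \<in> I"
  shows "u i = 0"
proof -
  have "(\<Sum>i\<in>I. u i ^ q * P i j) = 0" if "j \<in> I" for j
    using assms(1)[of j] that by (simp add: step_def)
  then have "u i ^ q = 0"
    using inj[of "\<lambda>i. u i ^ q"] assms(2) by blast
  then show ?thesis by simp
qed

lemma sum_step: "(\<Sum>i\<in>I. u i * x i) ^ q = (\<Sum>j\<in>I. step u j * x j)"
proof -
  have "(\<Sum>i\<in>I. u i * x i) ^ q = (\<Sum>i\<in>I. \<Sum>j\<in>I. u i ^ q * P i j * x j)"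
    by (simp add: sum_power_q power_mult_distrib system sum_distrib_left mult.assoc)
  also have "\<dots> = (\<Sum>j\<in>I. step u j * x j)"
    by (subst sum.swap) (simp add: step_def sum_distrib_right)
  finally show ?thesis .
qed

text \<open>The rows \<open>M n\<close> expressing \<open>y ^ q ^ n\<close> satisfy a linear relation over \<open>k\<close>; extracting
  \<open>q\<close>-th roots of its coefficients shifts it to one that involves \<open>M 0\<close>, so that \<open>y\<close> is a root
  of a polynomial \<open>X - (\<Sum>n. d n * X ^ q ^ Suc n)\<close>.\<close>

lemma combination_separable:
  assumes c: "\<And>i. i \<in> I \<Longrightarrow> c i \<in> k"
  shows "(\<Sum>i\<in>I. c i * x i) \<in> separable_closure_of k"
proof -
  define y where "y = (\<Sum>i\<in>I. c i * x i)"
  define M where "M n = (step ^^ n) (\<lambda>i. if i \<in> I then c i else 0)" for n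
  have M_Suc: "M (Suc n) = step (M n)" for n
    by (simp add: M_def)
  have M_out: "M n i = 0" if "i \<notin> I" for n i
    using that by (cases n) (simp_all add: M_def step_def)
  have M_closed: "M n i \<in> k" for n i
  proof (induction n arbitrary: i)
    case 0
    then show ?case using c k.zero_closed by (simp add: M_def)
  next
    case (Suc n)
    then show ?case
      by (auto simp: M_Suc step_def intro!: k.sum_closed k.mult_closed k.power_closed P_closed
          k.zero_closed)
  qed
  have y_pow: "y ^ (q ^ n) = (\<Sum>j\<in>I. M n j * x j)" for n
  proof (induction n)
    case 0
    then show ?case by (simp add: y_def M_def)
  next
    case (Suc n)
    have "y ^ (q ^ Suc n) = (y ^ (q ^ n)) ^ q"
      by (simp add: mult.commute flip: power_mult)
    then show ?case
      by (simp add: Suc sum_step M_Suc)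
  qed
  \<comment> \<open>Every vector in the k-span of the rows is written through finitely many rows,
    with coefficients that depend linearly on its entries; this linearity later carries the formula
    over to combinations with coefficients in K.\<close>
  have pivots: "\<exists>J N a. finite J \<and> (\<forall>j n. a j n \<in> k) \<and>
      (\<forall>u\<in>lin_span k (range M'). \<forall>i. u i = (\<Sum>j\<in>J. u j * (\<Sum>n<N. a j n * M' n i)))"
    if M': "\<And>n i. M' n i \<in> k" "\<And>n i. i \<notin> I \<Longrightarrow> M' n i = 0" for M' :: "nat \<Rightarrow> 'i \<Rightarrow> 'a"
  proof -
    let ?V = "lin_span k (range M')"
    have out: "u i = 0" if "u \<in> ?V" "i \<notin> I" for u i
      using that by induction (auto simp: M')
    have "\<exists>J f. J \<subseteq> I \<and>
      (\<forall>j\<in>J. f j \<in> ?V \<and> (\<forall>i. i \<notin> I \<longrightarrow> f j i = 0) \<and> (\<forall>i. f j i \<in> k) \<and>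
        (\<forall>i\<in>J. f j i = (if i = j then 1 else 0))) \<and>
      (\<forall>g\<in>?V. (\<forall>i. i \<notin> I \<longrightarrow> g i = 0) \<longrightarrow> (\<forall>i. g i = (\<Sum>j\<in>J. g j * f j i)))"
    proof (rule pivot_basis[OF k.subfield_set_axioms k.subring_set_axioms _ _ _ _ finite_I])
      show "(\<lambda>i. u i + v i) \<in> ?V" if "u \<in> ?V" "v \<in> ?V" for u v
        using that by (rule lin_span_add)
      show "(\<lambda>i. c * u i) \<in> ?V" if "c \<in> k" "u \<in> ?V" for c u
        using that(2,1) by (rule k.lin_span_scale)
      show "u i \<in> k" if "u \<in> ?V" for u i
        by (rule k.lin_span_closed[OF that]) (use M' in auto)
    qed auto
    then obtain J f where J: "J \<subseteq> I" and f: "\<forall>j\<in>J. f j \<in> ?V"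
      and span: "\<forall>g\<in>?V. (\<forall>i. i \<notin> I \<longrightarrow> g i = 0) \<longrightarrow> (\<forall>i. g i = (\<Sum>j\<in>J. g j * f j i))"
      by (elim exE conjE) (rule that, auto)
    from finite_subset[OF J finite_I] have "finite J" .
    with f obtain N a where a: "\<forall>j n. a j n \<in> k" "\<forall>j\<in>J. \<forall>i. f j i = (\<Sum>n<N. a j n * M' n i)"
      using lin_span_range_uniform[OF k.subring_set_axioms \<open>finite J\<close>, of f M'] by auto
    have "u i = (\<Sum>j\<in>J. u j * (\<Sum>n<N. a j n * M' n i))" if u: "u \<in> ?V" for u i
    proof -
      have "u i = (\<Sum>j\<in>J. u j * f j i)"
        using span u out by blast
      then show ?thesis using a(2) by simp
    qed
    with \<open>finite J\<close> a(1) show ?thesis by blast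
  qed
  have M_span: "M n \<in> lin_span k (range M)" for n
    by (rule k.lin_span_base) simp
  obtain J N a where a: "\<forall>j n. a j n \<in> k"
    and MN: "\<forall>u\<in>lin_span k (range M). \<forall>i. u i = (\<Sum>j\<in>J. u j * (\<Sum>n<N. a j n * M n i))"
    using pivots[of M] M_closed M_out by blast
  \<comment> \<open>A nontrivial relation: row \<open>N\<close> is a combination of the earlier rows
    by \<open>pivots\<close>, and its own coefficient is -1.\<close>
  define b0 where "b0 n = (if n < N then \<Sum>j\<in>J. M N j * a j n else - 1)" for n
  have "\<exists>N b. b 0 \<noteq> 0 \<and> (\<forall>i. (\<Sum>n\<le>N. b n * M n i) = 0)"
    if "\<exists>n\<le>N. b n \<noteq> 0" "\<forall>i. (\<Sum>n\<le>N. b n * M n i) = 0" for N and b :: "nat \<Rightarrow> 'a"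
    using that
  proof (induction N arbitrary: b)
    case 0
    then show ?case by (intro exI[of _ 0] exI[of _ b]) auto
  next
    case (Suc N)
    show ?case
    proof (cases "b 0 = 0")
      case True
      have "\<forall>n. \<exists>r. r ^ q = b (Suc n)"
        using ex_root_q by blast
      from choice[OF this] obtain r where r: "\<And>n. r n ^ q = b (Suc n)" by blast
      \<comment> \<open>With b 0 = 0 the relation becomes \<open>step u\<close> = 0, and
        invertibility of \<open>P\<close> gives \<open>u\<close> = 0: a relation shorter by
        one.\<close>
      define u where "u i = (\<Sum>n\<le>N. r n * M n i)" for i
      have "step u j = 0" for j
      proof -
        have "step u j = (\<Sum>n\<le>N. b (Suc n) * M (Suc n) j)"
          unfolding u_def step_sum by (simp add: r M_Suc)
        also have "\<dots> = (\<Sum>n\<le>Suc N. b n * M n j)"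
          unfolding sum.atMost_Suc_shift by (simp add: True)
        finally show ?thesis using Suc.prems(2) by simp
      qed
      then have "u i = 0" if "i \<in> I" for i
        using step_eq_0_imp that by blast
      then have "\<forall>i. (\<Sum>n\<le>N. r n * M n i) = 0"
        by (metis (no_types, lifting) M_out mult_zero_right sum.neutral u_def)
      moreover have "\<exists>n\<le>N. r n \<noteq> 0"
      proof -
        obtain n where "n \<le> Suc N" "b n \<noteq> 0" using Suc.prems by blast
        with True obtain n' where n': "n = Suc n'" "n' \<le> N" by (cases n) auto
        then have "r n' \<noteq> 0"
          using r[of n'] \<open>b n \<noteq> 0\<close> by (auto simp: zero_power_q)
        with n' show ?thesis by blast
      qed
      ultimately show ?thesis by (rule Suc.IH[rotated])
    next
      case False
      with Suc.prems show ?thesis by blast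
    qed
  qed
  moreover have "\<exists>n\<le>N. b0 n \<noteq> 0"
    by (intro exI[of _ N]) (simp add: b0_def)
  moreover have "(\<Sum>n\<le>N. b0 n * M n i) = 0" for i
  proof -
    have "M N i = (\<Sum>j\<in>J. \<Sum>n<N. M N j * a j n * M n i)"
      using MN M_span[of N] by (subst MN[rule_format, OF M_span]) (simp add: sum_distrib_left mult.assoc)
    also have "\<dots> = (\<Sum>n<N. b0 n * M n i)"
      by (subst sum.swap) (simp add: b0_def sum_distrib_right)
    finally show ?thesis
      by (simp add: b0_def flip: lessThan_Suc_atMost)
  qed
  ultimately obtain N' b where b: "b 0 \<noteq> 0" "\<And>i. (\<Sum>n\<le>N'. b n * M n i) = 0"
    by blast
  define \<beta> where "\<beta> n = - (b (Suc n) / b 0)" for n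
  have M0: "M 0 i = (\<Sum>n<N'. \<beta> n * M (Suc n) i)" for i
  proof -
    have "b 0 * M 0 i + (\<Sum>n<N'. b (Suc n) * M (Suc n) i) = 0"
      using b(2)[of i] by (simp add: sum.atMost_shift)
    then have "b 0 * M 0 i = - (\<Sum>n<N'. b (Suc n) * M (Suc n) i)"
      by (simp add: add_eq_0_iff2)
    then have "M 0 i = - (\<Sum>n<N'. b (Suc n) * M (Suc n) i) / b 0"
      using b(1) by (simp add: field_simps)
    then show ?thesis
      by (simp add: \<beta>_def sum_divide_distrib sum_negf)
  qed
  obtain J1 N1 a1 where a1: "\<forall>j n. a1 j n \<in> k"
    and span1: "\<forall>u\<in>lin_span k (range (\<lambda>n. M (Suc n))).
      \<forall>i. u i = (\<Sum>j\<in>J1. u j * (\<Sum>n<N1. a1 j n * M (Suc n) i))"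
    using pivots[of "\<lambda>n. M (Suc n)"] M_closed M_out by blast
  \<comment> \<open>Because of the extracted roots, the \<beta> are only known to lie in K. The
    expansion \<open>span1\<close> is linear in \<open>u\<close>, so it also holds for
    \<open>M 0\<close>, a K-combination of the later rows, and its coefficients \<open>d\<close> are
    in k.\<close>
  define d where "d n = (\<Sum>j\<in>J1. M 0 j * a1 j n)" for n
  have d: "d n \<in> k" for n
    unfolding d_def using a1 M_closed by (intro k.sum_closed k.mult_closed) auto
  have M0_d: "M 0 i = (\<Sum>n<N1. d n * M (Suc n) i)" for i
  proof -
    define S where "S j = (\<Sum>n<N1. a1 j n * M (Suc n) i)" for j
    have "M 0 i = (\<Sum>m<N'. \<beta> m * (\<Sum>j\<in>J1. M (Suc m) j * S j))"
      unfolding M0[of i] S_def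
      by (intro sum.cong refl arg_cong2[where f = "(*)"] span1[rule_format] k.lin_span_base) auto
    also have "\<dots> = (\<Sum>j\<in>J1. M 0 j * S j)"
      unfolding M0 sum_distrib_left sum_distrib_right
      by (subst sum.swap) (simp add: mult.assoc)
    also have "\<dots> = (\<Sum>n<N1. d n * M (Suc n) i)"
      unfolding d_def S_def sum_distrib_left sum_distrib_right
      by (subst sum.swap) (simp add: mult.assoc)
    finally show ?thesis .
  qed
  have y: "y = (\<Sum>n<N1. d n * y ^ (q ^ Suc n))"
  proof -
    have "y = (\<Sum>j\<in>I. \<Sum>n<N1. d n * M (Suc n) j * x j)"
      using y_pow[of 0] by (simp add: M0_d sum_distrib_right)
    also have "\<dots> = (\<Sum>n<N1. d n * y ^ (q ^ Suc n))"
      unfolding y_pow by (subst sum.swap) (simp add: sum_distrib_left mult.assoc)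
    finally show ?thesis .
  qed
  define f where "f = Polynomial.monom 1 1 - (\<Sum>n<N1. Polynomial.monom (d n) (q ^ Suc n))"
  have "pderiv (\<Sum>n\<in>A. Polynomial.monom (d n) (q ^ Suc n)) = 0" for A
    by (induction A rule: infinite_finite_induct) (auto simp: pderiv_add pderiv_monom of_nat_q)
  then have "pderiv f = 1"
    by (simp add: f_def pderiv_diff pderiv_monom)
  then have "rsquarefree f" by (rule rsquarefree_if_pderiv_eq_1)
  moreover have "set (coeffs f) \<subseteq> k"
  proof
    fix z assume "z \<in> set (coeffs f)"
    then obtain m where "z = Polynomial.coeff f m"
      by (auto simp: coeffs_def split: if_splits)
    then show "z \<in> k"
      by (auto simp: f_def coeff_sum intro!: k.diff_closed k.sum_closed k.zero_closed k.one_closed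
          k.uminus_closed d)
  qed
  moreover have "poly f y = 0"
    using y by (simp add: f_def poly_sum poly_monom)
  ultimately show ?thesis
    unfolding separable_closure_of_def separable_over_def y_def by blast
qed

end

text \<open>Repeated reduction of X^N modulo \<open>f\<close>. The coefficients \<open>r\<close>
  serve all roots at once, so that one and the same matrix can later be evaluated at every
  root.\<close>

lemma power_at_roots:
  fixes f :: "'a::field poly"
  assumes "subfield_set k" "set (coeffs f) \<subseteq> k" "Polynomial.degree f = n" "n > 0"
  shows "\<exists>r. (\<forall>j. r j \<in> k) \<and> (\<forall>a. poly f a = 0 \<longrightarrow> a ^ N = (\<Sum>j<n. r j * a ^ j))"
proof (induction N)
  interpret subfield_set k by fact
  case 0
  have "(\<Sum>j<n. (if j = 0 then 1 else 0) * a ^ j) = 1" for a :: 'a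
    using assms(4) by (subst sum.mono_neutral_right[of _ "{0}"]) auto
  then show ?case
    by (intro exI[of _ "\<lambda>j. if j = 0 then 1 else 0"]) (auto simp: zero_closed one_closed)
next
  interpret subfield_set k by fact
  case (Suc N)
  then obtain r where r: "\<And>j. r j \<in> k" "\<And>a. poly f a = 0 \<Longrightarrow> a ^ N = (\<Sum>j<n. r j * a ^ j)"
    by blast
  define fc where "fc = Polynomial.coeff f"
  have fc: "fc j \<in> k" for j
    using assms(2) coeff_in_coeffs[of f j] zero_closed
    by (cases "f \<noteq> 0 \<and> j \<le> Polynomial.degree f") (auto simp: fc_def coeff_eq_0)
  have fcn: "fc n \<noteq> 0"
    using assms(3,4) by (auto simp: fc_def)
  obtain m where m: "n = Suc m"
    using assms(4) gr0_implies_Suc by blast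
  \<comment> \<open>Multiplication by a shifts the coefficients; the overflow
    \<open>r m * a ^ n\<close> is rewritten by means of the monic form of \<open>f\<close>.\<close>
  define r' where "r' j = (if j = 0 then 0 else r (j - 1)) - r m * (fc j / fc n)" for j
  have "a ^ Suc N = (\<Sum>j<n. r' j * a ^ j)" if a: "poly f a = 0" for a
  proof -
    have "0 = (\<Sum>j<n. fc j * a ^ j) + fc n * a ^ n"
      using a assms(3) by (simp add: poly_altdef fc_def flip: lessThan_Suc_atMost)
    then have "a ^ n = - (\<Sum>j<n. fc j * a ^ j) / fc n"
      using fcn by (simp add: field_simps add_eq_0_iff)
    also have "\<dots> = - (\<Sum>j<n. fc j / fc n * a ^ j)"
      by (simp add: sum_divide_distrib)
    finally have an: "a ^ n = - (\<Sum>j<n. fc j / fc n * a ^ j)" .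
    have "a ^ Suc N = (\<Sum>j<n. r j * a ^ Suc j)"
      using r(2)[OF a] by (simp add: sum_distrib_left mult_ac)
    also have "\<dots> = (\<Sum>j<m. r j * a ^ Suc j) + r m * a ^ n"
      unfolding m by simp
    also have "(\<Sum>j<m. r j * a ^ Suc j) = (\<Sum>j<n. (if j = 0 then 0 else r (j - 1)) * a ^ j)"
      unfolding m by (simp add: sum.lessThan_Suc_shift del: sum.lessThan_Suc)
    finally show ?thesis
      unfolding an by (simp add: r'_def sum_distrib_left left_diff_distrib sum_subtractf mult.assoc)
  qed
  moreover have "r' j \<in> k" for j
    using r(1) fc by (auto simp: r'_def intro!: ring_closed divide_closed)
  ultimately show ?case by blast
qed

text \<open>Factors X are split off while the constant term is 0; afterwards a + z g(z) = 0 displays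
  1/z as - g(z) / a.\<close>

lemma inverse_root:
  fixes f :: "'a::field poly"
  assumes "subfield_set k" "f \<noteq> 0" "set (coeffs f) \<subseteq> k" "poly f z = 0" "z \<noteq> 0"
  shows "\<exists>c. (\<forall>j. c j \<in> k) \<and> inverse z = (\<Sum>j<Polynomial.degree f. c j * z ^ j)"
  using assms(2-4)
proof (induction f)
  case 0
  then show ?case by simp
next
  interpret subfield_set k by fact
  case (pCons a g)
  have g0: "g \<noteq> 0"
    using pCons.prems assms(5) by auto
  have coeffs: "a \<in> k" "set (coeffs g) \<subseteq> k"
    using pCons.prems g0 zero_closed by (auto simp: cCons_def split: if_splits)
  show ?case
  proof (cases "a = 0")
    case True
    then have "poly g z = 0" using pCons.prems assms(5) by simp
    then obtain c where c: "\<And>j. c j \<in> k" "inverse z = (\<Sum>j<Polynomial.degree g. c j * z ^ j)"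
      using pCons.IH g0 coeffs by blast
    define c' where "c' j = (if j < Polynomial.degree g then c j else 0)" for j
    have "inverse z = (\<Sum>j<Polynomial.degree (pCons a g). c' j * z ^ j)"
      unfolding c(2) using g0 by (simp add: c'_def)
    moreover have "c' j \<in> k" for j using c(1) zero_closed by (simp add: c'_def)
    ultimately show ?thesis by blast
  next
    case False
    define c where "c j = - Polynomial.coeff g j / a" for j
    have "c j \<in> k" for j
      using coeffs coeff_in_coeffs[of g j] zero_closed
      by (cases "j \<le> Polynomial.degree g")
        (auto simp: c_def coeff_eq_0 g0 intro!: divide_closed uminus_closed)
    moreover have "a + z * poly g z = 0" using pCons.prems by simp
    then have "z * (- poly g z / a) = 1"
      using False by (simp add: field_simps add_eq_0_iff)
    then have "inverse z = - poly g z / a"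
      by (rule inverse_unique)
    then have "inverse z = (\<Sum>j<Polynomial.degree (pCons a g). c j * z ^ j)"
      using g0 by (simp add: c_def poly_altdef lessThan_Suc_atMost sum_divide_distrib sum_negf)
    ultimately show ?thesis by blast
  qed
qed

text \<open>Row i of \<open>P\<close> reduces X^(q i) modulo a separable polynomial of degree n, so
  the powers of z below n form a system. Separability enters in the invertibility of
  \<open>P\<close>: a nonzero vector in its left kernel would give a nonzero polynomial of degree
  below n with n roots.\<close>

lemma (in frobenius_power) separable_imp_system:
  fixes z :: 'a
  assumes k: "subfield_set k" and z: "z \<in> separable_closure_of k" "z \<noteq> 0"
  obtains n P c where "frobenius_system q k {..<n::nat} P (\<lambda>i. z ^ i)"
    "\<And>j. c j \<in> k" "inverse z = (\<Sum>j<n. c j * z ^ j)"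
proof -
  obtain f where f: "rsquarefree f" "set (coeffs f) \<subseteq> k" "poly f z = 0"
    using z by (auto simp: separable_closure_of_def separable_over_def)
  have f0: "f \<noteq> 0" using f by (simp add: rsquarefree_def)
  define n where "n = Polynomial.degree f"
  have "n > 0"
  proof (rule ccontr)
    assume "\<not> n > 0"
    then obtain a where "f = [:a:]" by (metis n_def degree_eq_zeroE gr_zeroI)
    with f f0 show False by simp
  qed
  have "\<forall>i. \<exists>r. (\<forall>j. r j \<in> k) \<and> (\<forall>a. poly f a = 0 \<longrightarrow> a ^ (q * i) = (\<Sum>j<n. r j * a ^ j))"
    using power_at_roots[OF k f(2) n_def[symmetric] \<open>n > 0\<close>] by blast
  from choice[OF this] obtain P where P: "\<And>i j. P i j \<in> k"
    "\<And>i a. poly f a = 0 \<Longrightarrow> a ^ (q * i) = (\<Sum>j<n. P i j * a ^ j)"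
    by blast
  obtain c where c: "\<And>j. c j \<in> k" "inverse z = (\<Sum>j<n. c j * z ^ j)"
    using inverse_root[OF k f0 f(2,3) z(2)] unfolding n_def by blast
  have inj: "w i = 0" if w: "\<And>j. j < n \<Longrightarrow> (\<Sum>i<n. w i * P i j) = 0" and "i < n" for w i
  proof -
    from ex_root_q have "\<forall>i. \<exists>r. r ^ q = w i" by blast
    from choice[OF this] obtain u where u: "\<And>i. u i ^ q = w i" by blast
    \<comment> \<open>With q-th roots of the \<open>w i\<close> as coefficients, g(a)^q is the sum
      of the w i a^(q i), which the kernel condition makes 0 at every root a of
      \<open>f\<close>.\<close>
    define g where "g = (\<Sum>i<n. Polynomial.monom (u i) i)"
    have coeff_g: "Polynomial.coeff g j = (if j < n then u j else 0)" for j
      by (simp add: g_def coeff_sum)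
    have "poly g a = 0" if "poly f a = 0" for a
    proof -
      have "poly g a ^ q = (\<Sum>i<n. w i * a ^ (q * i))"
        by (simp add: g_def poly_sum poly_monom sum_power_q power_mult_distrib u mult.commute
            flip: power_mult)
      also have "\<dots> = (\<Sum>i<n. \<Sum>j<n. w i * P i j * a ^ j)"
        by (simp add: P(2)[OF that] sum_distrib_left mult.assoc)
      also have "\<dots> = (\<Sum>j<n. (\<Sum>i<n. w i * P i j) * a ^ j)"
        by (subst sum.swap) (simp add: sum_distrib_right)
      also have "\<dots> = 0" by (simp add: w)
      finally show ?thesis by simp
    qed
    then have sub: "{a. poly f a = 0} \<subseteq> {a. poly g a = 0}" by blast
    have "g = 0"
    proof (rule ccontr)
      assume g0: "g \<noteq> 0"
      then have "finite {a. poly g a = 0}" by (rule poly_roots_finite)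
      from card_mono[OF this sub] have "n \<le> Polynomial.degree g"
        using card_roots_rsquarefree[OF f(1)] card_poly_roots_bound[OF g0] by (simp add: n_def)
      moreover have "Polynomial.coeff g (Polynomial.degree g) \<noteq> 0" using g0 by simp
      ultimately show False by (simp add: coeff_g)
    qed
    then have "u i = 0" using coeff_g[of i] \<open>i < n\<close> by simp
    then show ?thesis using u[of i] by (simp add: zero_power_q)
  qed
  interpret k: subfield_set k by fact
  have "frobenius_system q k {..<n} P (\<lambda>i. z ^ i)"
  proof
    show "(z ^ i) ^ q = (\<Sum>j\<in>{..<n}. P i j * z ^ j)" for i
      using P(2)[OF f(3), of i] by (simp add: mult.commute flip: power_mult)
  qed (use P(1) inj in auto)
  then show thesis using c by (rule that)
qed

text \<open>The products \<open>x i * z ^ j\<close> satisfy the system given by the Kronecker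
  product of both matrices, and 1/z is a combination of powers of z. So the quotient is a
  combination of solutions of a single system, and as such separable; this takes the place of the
  field structure of the separable closure.\<close>

lemma (in frobenius_system) divide_separable:
  assumes "i0 \<in> I" "z \<in> separable_closure_of k"
  shows "x i0 / z \<in> separable_closure_of k"
proof (cases "z = 0")
  case True
  have "(\<Sum>i\<in>I. 0 * x i) \<in> separable_closure_of k"
    by (rule combination_separable) (rule k.zero_closed)
  then show ?thesis using True by simp
next
  case False
  obtain n Q c where Q: "frobenius_system q k {..<n::nat} Q (\<lambda>i. z ^ i)"
    and c: "\<And>j. c j \<in> k" "inverse z = (\<Sum>j<n. c j * z ^ j)"
    using separable_imp_system[OF k.subfield_set_axioms assms(2) False] by blast
  interpret Q: frobenius_system q ty k "{..<n}" Q "\<lambda>i. z ^ i" by fact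
  define P' where "P' a b = P (fst a) (fst b) * Q (snd a) (snd b)" for a b
  define x' where "x' a = x (fst a) * z ^ snd a" for a
  interpret T: frobenius_system q ty k "I \<times> {..<n}" P' x'
  proof
    show "finite (I \<times> {..<n})" using finite_I by simp
    show "P' i j \<in> k" if "i \<in> I \<times> {..<n}" "j \<in> I \<times> {..<n}" for i j
      using that P_closed Q.P_closed by (auto simp: P'_def intro!: k.mult_closed)
    show "x' a ^ q = (\<Sum>b\<in>I \<times> {..<n}. P' a b * x' b)" if a: "a \<in> I \<times> {..<n}" for a
    proof -
      have "x' a ^ q = x (fst a) ^ q * (z ^ snd a) ^ q"
        by (simp add: x'_def power_mult_distrib)
      also have "\<dots> = (\<Sum>i\<in>I. \<Sum>j<n. (P (fst a) i * x i) * (Q (snd a) j * z ^ j))"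
        using a system[of "fst a"] Q.system[of "snd a"] by (auto simp: sum_product)
      finally show ?thesis
        by (simp add: sum.cartesian_product P'_def x'_def case_prod_beta mult_ac)
    qed
    show "w a = 0"
      if w: "\<And>b. b \<in> I \<times> {..<n} \<Longrightarrow> (\<Sum>a\<in>I \<times> {..<n}. w a * P' a b) = 0"
        and a: "a \<in> I \<times> {..<n}" for w a
    proof -
      \<comment> \<open>Invertibility of the Kronecker product, one factor at a time: for fixed j'
        the contraction with \<open>Q\<close> lies in the left kernel of \<open>P\<close>.\<close>
      have *: "(\<Sum>j<n. w (i, j) * Q j j') = 0" if "j' < n" "i \<in> I" for i j'
      proof (rule inj[OF _ that(2)])
        fix i' assume "i' \<in> I"
        have "(\<Sum>i\<in>I. (\<Sum>j<n. w (i, j) * Q j j') * P i i') = (\<Sum>a\<in>I \<times> {..<n}. w a * P' a (i', j'))"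
          unfolding sum_distrib_right sum.cartesian_product
          by (intro sum.cong) (auto simp: P'_def)
        with w[of "(i', j')"] that \<open>i' \<in> I\<close>
        show "(\<Sum>i\<in>I. (\<Sum>j<n. w (i, j) * Q j j') * P i i') = 0"
          by simp
      qed
      have "w (fst a, snd a) = 0"
        using a * by (intro Q.inj[of "\<lambda>j. w (fst a, j)"]) auto
      then show ?thesis by simp
    qed
  qed
  have "(\<Sum>a\<in>I \<times> {..<n}. (if fst a = i0 then c (snd a) else 0) * x' a) \<in> separable_closure_of k"
    using c(1) by (intro T.combination_separable) (auto simp: k.zero_closed)
  also have "(\<Sum>a\<in>I \<times> {..<n}. (if fst a = i0 then c (snd a) else 0) * x' a) =
      (\<Sum>i\<in>I. if i = i0 then \<Sum>j<n. c j * (x i0 * z ^ j) else 0)"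
    unfolding sum.Sigma[symmetric, OF finite_I, of "\<lambda>_. {..<n}", simplified, symmetric]
    by (simp add: sum.cartesian_product' x'_def if_distrib[of "\<lambda>t. t * _"] cong: if_cong)
      (intro sum.cong, auto)
  also have "\<dots> = x i0 / z"
    using assms(1) finite_I c(2) by (simp add: divide_inverse sum_distrib_left mult_ac)
  finally show ?thesis .
qed

text \<open>If a coordinate \<open>x m\<close> of largest value were not integral, its equation
  would bound |x m|^q by |x m|, as \<open>P\<close> is integral. Two coordinates are comparable only
  if \<O> contains their quotient or its inverse, whence the need for separable quotients.\<close>

lemma (in frobenius_system) system_integral:
  assumes "valuation_ring_of (separable_closure_of k) \<O>"
    and P: "\<And>i j. i \<in> I \<Longrightarrow> j \<in> I \<Longrightarrow> P i j \<in> \<O>" and "i \<in> I"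
  shows "x i \<in> \<O>"
proof -
  interpret \<O>: subring_set \<O>
    using assms(1) subring_imp_subring_set by (auto simp: valuation_ring_of_def)
  have val: "y \<in> \<O> \<or> inverse y \<in> \<O>" if "y \<in> separable_closure_of k" for y
    using assms(1) that by (auto simp: valuation_ring_of_def)
  have sep: "x i \<in> separable_closure_of k" if "i \<in> I" for i
  proof -
    have "(\<Sum>j\<in>I. (if j = i then 1 else 0) * x j) \<in> separable_closure_of k"
      by (rule combination_separable) (auto simp: k.ring_closed)
    also have "(\<Sum>j\<in>I. (if j = i then 1 else 0) * x j) = x i"
      using that finite_I by (simp add: if_distrib[of "\<lambda>t. t * _"] cong: if_cong)
    finally show ?thesis .
  qed
  define U where "U = x ` I - {0}"
  show ?thesis
  proof (cases "U = {}")
    case True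
    then show ?thesis using assms(3) \<O>.zero_closed by (auto simp: U_def)
  next
    case False
    have "\<exists>y\<in>U. \<forall>z\<in>U. z / y \<in> \<O>"
    proof (rule ex_dominant[OF _ \<O>.mult_closed _ False])
      fix y z assume "y \<in> U" "z \<in> U"
      then have "y / z \<in> separable_closure_of k"
        using sep divide_separable by (auto simp: U_def)
      from val[OF this] show "y / z \<in> \<O> \<or> z / y \<in> \<O>" by simp
    qed (use finite_I in \<open>auto simp: U_def\<close>)
    then obtain m where m: "m \<in> I" "x m \<noteq> 0"
      and dom0: "\<And>j. j \<in> I \<Longrightarrow> x j \<noteq> 0 \<Longrightarrow> x j / x m \<in> \<O>"
      by (auto simp: U_def)
    have dom: "x j / x m \<in> \<O>" if "j \<in> I" for j
      using dom0[OF that] \<O>.zero_closed by (cases "x j = 0") auto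
    have "x m \<in> \<O>"
    proof (rule ccontr)
      assume "x m \<notin> \<O>"
      then have inv: "inverse (x m) \<in> \<O>" using val[OF sep[OF m(1)]] by blast
      have "(\<Sum>j\<in>I. P m j * (x j / x m)) \<in> \<O>"
        using m P dom by (intro \<O>.sum_closed \<O>.mult_closed) auto
      moreover have "(\<Sum>j\<in>I. P m j * (x j / x m)) = x m ^ q / x m"
        by (simp add: system[OF m(1)] sum_divide_distrib)
      \<comment> \<open>The first factor is the power of \<open>x m\<close> with exponent q - 1, so
        the product is \<open>x m\<close> itself; q > 1 makes the exponent q - 2 meaningful.\<close>
      ultimately have "x m ^ q / x m * inverse (x m) ^ (q - 2) \<in> \<O>"
        using inv by (metis \<O>.mult_closed \<O>.power_closed)
      moreover have "x m ^ q = x m ^ (q - 2) * (x m * x m)"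
      proof -
        have "q = q - 2 + 2" using q_gt_1 by simp
        then show ?thesis by (metis power2_eq_square power_add)
      qed
      moreover have "x m ^ (q - 2) * (x m * x m) / x m * inverse (x m) ^ (q - 2) = x m"
        using m(2) by (simp add: field_simps)
      ultimately show False
        using \<open>x m \<notin> \<O>\<close> by simp
    qed
    from \<O>.mult_closed[OF dom[OF assms(3)] this] m(2) show ?thesis by simp
  qed
qed

section \<open>Coefficientwise homomorphisms of Laurent series\<close>

text \<open>The bounds are arbitrary because a coefficientwise map may raise the subdegree: one
  summation range then serves both a product and its image.\<close>

lemma fls_times_nth_bounds:
  fixes f g :: "'a::semiring_0 fls"
  assumes "\<And>i. i < a \<Longrightarrow> fls_nth f i = 0" "\<And>i. i < b \<Longrightarrow> fls_nth g i = 0"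
  shows "fls_nth (f * g) n = (\<Sum>i=a..n - b. fls_nth f i * fls_nth g (n - i))"
proof (cases "f = 0 \<or> g = 0")
  case True
  then show ?thesis by auto
next
  case False
  then have ab: "a \<le> fls_subdegree f" "b \<le> fls_subdegree g"
    using assms by (auto intro!: fls_subdegree_geI)
  have "fls_nth (f * g) n = (\<Sum>i=fls_subdegree f..n - fls_subdegree g. fls_nth f i * fls_nth g (n - i))"
    by (rule fls_times_nth(2))
  also have "\<dots> = (\<Sum>i=a..n - b. fls_nth f i * fls_nth g (n - i))"
    using ab by (intro sum.mono_neutral_left) (auto simp: not_le)
  finally show ?thesis .
qed

lemma ex_fls_bound: "\<exists>a. \<forall>i<a. fls_nth f i = 0"
  by (meson fls_nth_vanishes_belowE)

lemma subring_laurent_series_over: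
  assumes "subring_set A"
  shows "subring_set (laurent_series_over A)"
proof -
  interpret subring_set A by fact
  show ?thesis
  proof
    fix f g :: "'a fls" assume fg: "f \<in> laurent_series_over A" "g \<in> laurent_series_over A"
    obtain a b where "\<forall>i<a. fls_nth f i = 0" "\<forall>i<b. fls_nth g i = 0"
      using ex_fls_bound by metis
    then have "fls_nth (f * g) n = (\<Sum>i=a..n - b. fls_nth f i * fls_nth g (n - i))" for n
      by (intro fls_times_nth_bounds) auto
    then show "f * g \<in> laurent_series_over A"
      using fg by (auto simp: laurent_series_over_def intro!: sum_closed mult_closed)
  qed (auto simp: laurent_series_over_def ring_closed)
qed

lemma subring_power_series_over:
  assumes "subring_set A"
  shows "subring_set (power_series_over A)"
proof -
  interpret subring_set "laurent_series_over A"
    using assms by (rule subring_laurent_series_over)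
  have eq: "power_series_over A = {f \<in> laurent_series_over A. \<forall>n<0. fls_nth f n = 0}"
    by (auto simp: power_series_over_def laurent_series_over_def)
  show ?thesis
  proof
    fix f g assume fg: "f \<in> power_series_over A" "g \<in> power_series_over A"
    have "fls_nth (f * g) n = 0" if "n < 0" for n
      using fg that by (subst fls_times_nth_bounds[of 0 _ 0]) (auto simp: eq)
    then show "f * g \<in> power_series_over A"
      using fg by (auto simp: eq mult_closed)
  qed (auto simp: eq ring_closed)
qed

lemma subring_hom_fls_map:
  assumes "subring_hom A h"
  shows "subring_hom (laurent_series_over A) (fls_map h)"
proof -
  interpret subring_hom A h by fact
  interpret L: subring_set "laurent_series_over A"
    by (intro subring_laurent_series_over subring_set_axioms)
  have nth: "fls_nth (fls_map h f) n = h (fls_nth f n)" for f n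
    by (rule fls_nth_fls_map) (rule hom_zero)
  show ?thesis
  proof
    show "fls_map h 1 = 1"
      by (rule fls_eqI) (simp add: nth hom_one hom_zero)
    fix f g assume fg: "f \<in> laurent_series_over A" "g \<in> laurent_series_over A"
    then show "fls_map h (f + g) = fls_map h f + fls_map h g"
      by (intro fls_eqI) (simp add: nth hom_add laurent_series_over_def)
    show "fls_map h (f * g) = fls_map h f * fls_map h g"
    proof (rule fls_eqI)
      fix n
      obtain a b where ab: "\<forall>i<a. fls_nth f i = 0" "\<forall>i<b. fls_nth g i = 0"
        using ex_fls_bound by metis
      have "fls_nth (fls_map h (f * g)) n = h (\<Sum>i=a..n - b. fls_nth f i * fls_nth g (n - i))"
        unfolding nth using ab by (subst fls_times_nth_bounds) auto
      also have "\<dots> = (\<Sum>i=a..n - b. h (fls_nth f i) * h (fls_nth g (n - i)))"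
        using fg by (subst hom_sum) (auto simp: hom_mult laurent_series_over_def mult_closed)
      also have "\<dots> = fls_nth (fls_map h f * fls_map h g) n"
        using ab by (subst fls_times_nth_bounds[of a _ b]) (auto simp: nth hom_zero)
      finally show "fls_nth (fls_map h (f * g)) n = fls_nth (fls_map h f * fls_map h g) n" .
    qed
  qed
qed

lemma subring_hom_mono:
  assumes "subring_hom A h" "subring_set B" "B \<subseteq> A"
  shows "subring_hom B h"
proof -
  interpret subring_hom A h by fact
  interpret B: subring_set B by fact
  show ?thesis
    using assms(3) hom_add hom_mult by unfold_locales (auto simp: hom_one subset_iff)
qed

lemma power_series_over_subset: "power_series_over A \<subseteq> laurent_series_over A"
  by (auto simp: power_series_over_def laurent_series_over_def)

lemma subfield_quotient_field:
  assumes "subring_set A"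
  shows "subfield_set (quotient_field A)"
proof -
  interpret subring_set A by fact
  have I: "a / b \<in> quotient_field A" if "a \<in> A" "b \<in> A" "b \<noteq> 0" for a b
    using that by (auto simp: quotient_field_def)
  show ?thesis
  proof
    show "1 \<in> quotient_field A"
      using I[OF one_closed one_closed] by simp
    fix x assume "x \<in> quotient_field A"
    then obtain a b where x: "x = a / b" "a \<in> A" "b \<in> A" "b \<noteq> 0"
      by (auto simp: quotient_field_def)
    show "- x \<in> quotient_field A"
      using I[of "- a" b] x by (simp add: uminus_closed)
    show "inverse x \<in> quotient_field A"
      using I[of b a] I[OF zero_closed one_closed] x by (cases "a = 0") simp_all
    fix y assume "y \<in> quotient_field A"
    then obtain c d where y: "y = c / d" "c \<in> A" "d \<in> A" "d \<noteq> 0"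
      by (auto simp: quotient_field_def)
    have "x + y = (a * d + c * b) / (b * d)"
      using x y by (simp add: field_simps)
    then show "x + y \<in> quotient_field A"
      using x y by (auto intro!: I add_closed mult_closed)
    show "x * y \<in> quotient_field A"
      using I[of "a * c" "b * d"] x y by (simp add: mult_closed)
  qed
qed

lemma subset_quotient_field:
  assumes "subring_set A"
  shows "A \<subseteq> quotient_field A"
  using subring_set.one_closed[OF assms] by (force simp: quotient_field_def)

locale field_endo =
  fixes \<phi> :: "'a::field \<Rightarrow> 'a"
  assumes one: "\<phi> 1 = 1" and add: "\<phi> (x + y) = \<phi> x + \<phi> y" and mult: "\<phi> (x * y) = \<phi> x * \<phi> y"
begin

sublocale subring_hom UNIV \<phi>
  by unfold_locales (simp_all add: one add mult)

lemma eq_0_iff [simp]: "\<phi> x = 0 \<longleftrightarrow> x = 0"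
proof
  assume "\<phi> x = 0"
  then have "\<phi> (x * inverse x) = 0" by (simp add: mult)
  then show "x = 0" using one by (cases "x = 0") auto
qed (simp add: hom_zero)

lemma inverse: "\<phi> (inverse x) = inverse (\<phi> x)"
proof (cases "x = 0")
  case False
  then have "\<phi> x * \<phi> (inverse x) = 1" by (simp add: one flip: mult)
  then show ?thesis by (simp add: inverse_unique)
qed (simp add: hom_zero)

lemma divide: "\<phi> (x / y) = \<phi> x / \<phi> y"
  by (simp add: divide_inverse mult inverse)

lemma quotient_field_closed:
  assumes "\<And>x. x \<in> A \<Longrightarrow> \<phi> x \<in> A" "x \<in> quotient_field A"
  shows "\<phi> x \<in> quotient_field A"
  using assms unfolding quotient_field_def by (force simp: divide)

end

section \<open>Polynomials and rational functions inside the Laurent series\<close>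

definition poly_series :: "'a::field set \<Rightarrow> 'a fls set" where
  "poly_series A = {fps_to_fls (fps_of_poly a) | a. \<forall>i. Polynomial.coeff a i \<in> A}"

lemma set_coeffs_subset_iff:
  assumes "0 \<in> A"
  shows "set (coeffs a) \<subseteq> A \<longleftrightarrow> (\<forall>i. Polynomial.coeff a i \<in> A)"
proof
  assume *: "set (coeffs a) \<subseteq> A"
  show "\<forall>i. Polynomial.coeff a i \<in> A"
  proof
    fix i
    show "Polynomial.coeff a i \<in> A"
      using * assms coeff_in_coeffs[of a i]
      by (cases "a \<noteq> 0 \<and> i \<le> Polynomial.degree a") (auto simp: coeff_eq_0)
  qed
qed (auto simp: coeffs_def split: if_splits)

lemma subring_poly_series:
  assumes "subring_set A"
  shows "subring_set (poly_series A)"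
proof -
  interpret subring_set A by fact
  have I: "fps_to_fls (fps_of_poly a) \<in> poly_series A" if "\<And>i. Polynomial.coeff a i \<in> A" for a
    using that by (auto simp: poly_series_def)
  show ?thesis
  proof
    show "1 \<in> poly_series A"
      using I[of 1] by (simp add: Polynomial.coeff_1 zero_closed one_closed)
    fix x assume "x \<in> poly_series A"
    then obtain a where a: "x = fps_to_fls (fps_of_poly a)" "\<And>i. Polynomial.coeff a i \<in> A"
      by (auto simp: poly_series_def)
    show "- x \<in> poly_series A"
      using I[of "- a"] a by (simp add: fps_of_poly_uminus fps_to_fls_uminus uminus_closed)
    fix y assume "y \<in> poly_series A"
    then obtain b where b: "y = fps_to_fls (fps_of_poly b)" "\<And>i. Polynomial.coeff b i \<in> A"
      by (auto simp: poly_series_def)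
    show "x + y \<in> poly_series A"
      using I[of "a + b"] a b by (simp add: fps_of_poly_add add_closed)
    show "x * y \<in> poly_series A"
      using I[of "a * b"] a b
      by (simp add: fps_of_poly_mult fls_times_fps_to_fls coeff_mult sum_closed mult_closed)
  qed
qed

lemma rational_functions_over_eq:
  assumes "0 \<in> A"
  shows "rational_functions_over A = quotient_field (poly_series A)"
  unfolding rational_functions_over_def quotient_field_def poly_series_def
    set_coeffs_subset_iff[OF assms]
  by (auto; metis fps_of_poly_eq_iff fps_of_poly_0 fps_to_fls_eq_0_iff)

lemma poly_series_subset: "0 \<in> A \<Longrightarrow> poly_series A \<subseteq> power_series_over A"
  by (auto simp: poly_series_def power_series_over_def)

context frobenius_power
begin

abbreviation \<phi> :: "'a fls \<Rightarrow> 'a fls" where "\<phi> \<equiv> frobenius q"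

lemma nth_frobenius [simp]: "fls_nth (\<phi> f) n = fls_nth f n ^ q"
  unfolding frobenius_def using q_gt_1 by (subst fls_nth_fls_map) auto

lemma nth_frobenius_iter: "fls_nth ((\<phi> ^^ m) f) n = fls_nth f n ^ (q ^ m)"
  by (induction m arbitrary: f) (simp_all add: mult.commute flip: power_mult)

sublocale frobenius: field_endo \<phi>
proof -
  have "subring_hom UNIV (\<lambda>x::'a. x ^ q)"
    by unfold_locales (auto simp: add_power_q power_mult_distrib)
  from subring_hom_fls_map[OF this]
  interpret subring_hom "laurent_series_over UNIV" \<phi>
    by (simp add: frobenius_def)
  show "field_endo \<phi>"
    using hom_one hom_add hom_mult by unfold_locales (auto simp: laurent_series_over_def)
qed

lemma fixed_iff: "\<phi> x = x \<longleftrightarrow> x \<in> laurent_series_over (GF q)"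
  by (auto simp: fls_eq_iff laurent_series_over_def GF_def)

lemma subring_GF: "subring_set (GF q :: 'a set)"
  by unfold_locales (auto simp: GF_def add_power_q uminus_power_q power_mult_distrib)

lemma rational_functions_over_GF_fixed:
  assumes "x \<in> rational_functions_over (GF q)"
  shows "\<phi> x = x"
proof -
  have "\<phi> y = y" if "y \<in> poly_series (GF q)" for y
    using poly_series_subset[of "GF q"] that power_series_over_subset zero_power_q
    unfolding fixed_iff by (auto simp: GF_def)
  then show ?thesis
    using assms zero_power_q
    by (subst (asm) rational_functions_over_eq) (auto simp: GF_def quotient_field_def frobenius.divide)
qed

lemma frobenius_poly_series:
  assumes "subring_set A" "x \<in> poly_series A"
  shows "\<phi> x \<in> poly_series A"
proof -
  interpret subring_set A by fact
  obtain a where a: "x = fps_to_fls (fps_of_poly a)" "\<And>i. Polynomial.coeff a i \<in> A"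
    using assms by (auto simp: poly_series_def)
  have "\<phi> x = fps_to_fls (fps_of_poly (map_poly (\<lambda>x. x ^ q) a))"
    by (rule fls_eqI) (auto simp: a coeff_map_poly zero_power_q)
  moreover have "Polynomial.coeff (map_poly (\<lambda>x. x ^ q) a) i \<in> A" for i
    using a(2) by (simp add: coeff_map_poly zero_power_q power_closed)
  ultimately show ?thesis by (auto simp: poly_series_def)
qed

end

section \<open>Specialization of power series and the Gauss valuation ring of k(t)\<close>

locale specialization = frobenius_power q ty + k: subfield_set k + \<oo>: subring_set \<oo> +
    \<O>: subring_set \<O> + \<kappa>: subring_hom \<O> \<kappa>
  for q :: nat and ty :: "'a::alg_closed_field itself" and k \<oo> \<O> :: "'a set" and \<kappa> :: "'a \<Rightarrow> 'a" +
  fixes d :: nat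
  assumes \<oo>_k: "\<oo> \<subseteq> k" and \<oo>_\<O>: "\<oo> \<subseteq> \<O>" and GF_\<oo>: "GF q \<subseteq> \<oo>"
    and val: "x \<in> k \<Longrightarrow> x \<in> \<oo> \<or> inverse x \<in> \<oo>"
    and \<kappa>_GF: "x \<in> GF q \<Longrightarrow> \<kappa> x = x"
    and \<kappa>_\<oo>: "x \<in> \<oo> \<Longrightarrow> \<kappa> x ^ (q ^ d) = \<kappa> x"
begin

abbreviation F :: "'a fls set" where "F \<equiv> rational_functions_over k"

definition s0 :: "'a fls \<Rightarrow> 'a fls" where "s0 = fls_map \<kappa>"

text \<open>\<open>s0\<close> and \<open>s1\<close> are both homomorphisms on \<O>[[t]], and they
  coincide on \<oo>[[t]] because residues of elements of \<oo> are fixed by the q^d-th power. On Y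
  they give \<kappa>(Y) and its image under \<open>\<phi> ^^ d\<close>, two fundamental matrices for
  the specialized D.\<close>

definition s1 :: "'a fls \<Rightarrow> 'a fls" where "s1 f = (\<phi> ^^ d) (s0 f)"

lemma nth_s0: "fls_nth (s0 f) n = \<kappa> (fls_nth f n)"
  unfolding s0_def by (rule fls_nth_fls_map) (rule \<kappa>.hom_zero)

lemma nth_s1: "fls_nth (s1 f) n = \<kappa> (fls_nth f n) ^ (q ^ d)"
  by (simp add: s1_def nth_frobenius_iter nth_s0)

lemma F_eq: "F = quotient_field (poly_series k)"
  by (rule rational_functions_over_eq) (rule k.zero_closed)

sublocale F: subfield_set F
  unfolding F_eq by (intro subfield_quotient_field subring_poly_series k.subring_set_axioms)

lemma frobenius_F: "x \<in> F \<Longrightarrow> \<phi> x \<in> F"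
  unfolding F_eq
  by (rule frobenius.quotient_field_closed[OF frobenius_poly_series[OF k.subring_set_axioms]])

sublocale s0: subring_hom "power_series_over \<O>" s0
  unfolding s0_def
  by (rule subring_hom_mono[OF subring_hom_fls_map[OF \<kappa>.subring_hom_axioms] _ power_series_over_subset])
    (rule subring_power_series_over[OF \<O>.subring_set_axioms])

lemma frobenius_iter_add: "(\<phi> ^^ m) (x + y) = (\<phi> ^^ m) x + (\<phi> ^^ m) y"
  by (induction m arbitrary: x y) (simp_all add: frobenius.add)

lemma frobenius_iter_mult: "(\<phi> ^^ m) (x * y) = (\<phi> ^^ m) x * (\<phi> ^^ m) y"
  by (induction m arbitrary: x y) (simp_all add: frobenius.mult)

lemma frobenius_iter_one: "(\<phi> ^^ m) 1 = 1"
  by (induction m) (simp_all add: frobenius.one)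

sublocale s1: subring_hom "power_series_over \<O>" s1
  by unfold_locales
    (auto simp: s1_def s0.hom_one s0.hom_add s0.hom_mult frobenius_iter_add frobenius_iter_mult
      frobenius_iter_one)

lemma s1_eq_s0: "x \<in> power_series_over \<oo> \<Longrightarrow> s1 x = s0 x"
  by (rule fls_eqI) (auto simp: nth_s1 nth_s0 power_series_over_def \<kappa>_\<oo>)

lemma GF_power: "x \<in> GF q \<Longrightarrow> x ^ (q ^ m) = (x::'a)"
  by (induction m) (auto simp: GF_def power_mult)

lemma s0_GF: "x \<in> power_series_over (GF q) \<Longrightarrow> s0 x = x"
  by (rule fls_eqI) (auto simp: nth_s0 power_series_over_def \<kappa>_GF)

lemma s1_GF: "x \<in> power_series_over (GF q) \<Longrightarrow> s1 x = x"
  by (rule fls_eqI) (auto simp: nth_s1 power_series_over_def \<kappa>_GF GF_power)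

lemma s1_eq_0_iff: "s1 x = 0 \<longleftrightarrow> s0 x = 0"
proof -
  have "(\<phi> ^^ m) y = 0 \<longleftrightarrow> y = 0" for m and y :: "'a fls"
    by (induction m arbitrary: y) auto
  then show ?thesis by (simp add: s1_def)
qed

sublocale P\<oo>: subring_set "poly_series \<oo>"
  by (rule subring_poly_series[OF \<oo>.subring_set_axioms])

lemma poly_series_\<oo>_subset: "poly_series \<oo> \<subseteq> power_series_over \<oo>"
  by (rule poly_series_subset) (rule \<oo>.zero_closed)

lemma power_series_\<oo>_\<O>: "power_series_over \<oo> \<subseteq> power_series_over \<O>"
  using \<oo>_\<O> by (auto simp: power_series_over_def)

lemma poly_series_\<oo>_\<O>: "poly_series \<oo> \<subseteq> power_series_over \<O>"
  using poly_series_\<oo>_subset power_series_\<oo>_\<O> by blast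

text \<open>The valuation ring of the Gauss extension to \<open>k(t)\<close> of the valuation of \<open>k\<close>.\<close>

definition gauss_ring :: "'a fls set" where
  "gauss_ring = {x / y | x y. x \<in> poly_series \<oo> \<and> y \<in> poly_series \<oo> \<and> s0 y \<noteq> 0}"

lemma s0_mult_nonzero:
  assumes "x \<in> poly_series \<oo>" "y \<in> poly_series \<oo>" "s0 x \<noteq> 0" "s0 y \<noteq> 0"
  shows "s0 (x * y) \<noteq> 0"
  using assms poly_series_\<oo>_\<O> by (subst s0.hom_mult) auto

sublocale gauss_ring: subring_set gauss_ring
proof
  have I: "x / y \<in> gauss_ring" if "x \<in> poly_series \<oo>" "y \<in> poly_series \<oo>" "s0 y \<noteq> 0" for x y
    using that by (auto simp: gauss_ring_def)
  show "1 \<in> gauss_ring"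
    using I[OF P\<oo>.one_closed P\<oo>.one_closed] by (simp add: s0.hom_one)
  fix x assume "x \<in> gauss_ring"
  then obtain a b where x: "x = a / b" "a \<in> poly_series \<oo>" "b \<in> poly_series \<oo>" "s0 b \<noteq> 0"
    by (auto simp: gauss_ring_def)
  show "- x \<in> gauss_ring"
    using I[of "- a" b] x by (simp add: P\<oo>.uminus_closed)
  fix y assume "y \<in> gauss_ring"
  then obtain a' b' where y: "y = a' / b'" "a' \<in> poly_series \<oo>" "b' \<in> poly_series \<oo>" "s0 b' \<noteq> 0"
    by (auto simp: gauss_ring_def)
  have "b \<noteq> 0" "b' \<noteq> 0" using x y s0.hom_zero by auto
  then have "x + y = (a * b' + a' * b) / (b * b')"
    using x y by (simp add: field_simps)
  then show "x + y \<in> gauss_ring"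
    using x y s0_mult_nonzero[of b b'] by (auto intro!: I P\<oo>.add_closed P\<oo>.mult_closed)
  show "x * y \<in> gauss_ring"
    using I[of "a * a'" "b * b'"] x y by (simp add: P\<oo>.mult_closed s0_mult_nonzero)
qed

text \<open>The constant c is a coefficient of largest value, the content. Division by it leaves
  integral coefficients, one of them 1, so that the reduction does not vanish.\<close>

lemma primitive_part:
  assumes "x \<in> poly_series k" "x \<noteq> 0"
  obtains c x' where "c \<in> k" "c \<noteq> 0" "x' \<in> poly_series \<oo>" "s0 x' \<noteq> 0" "x = fls_const c * x'"
proof -
  obtain a where a: "x = fps_to_fls (fps_of_poly a)" "\<And>i. Polynomial.coeff a i \<in> k"
    using assms by (auto simp: poly_series_def)
  define U where "U = set (coeffs a) - {0}"
  have "a \<noteq> 0" using a(1) assms(2) by auto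
  then have "U \<noteq> {}"
    unfolding U_def by (metis Diff_eq_empty_iff coeff_in_coeffs le_refl leading_coeff_0_iff
        singletonD subsetD)
  have "\<exists>y\<in>U. \<forall>z\<in>U. z / y \<in> \<oo>"
  proof (rule ex_dominant[OF _ \<oo>.mult_closed _ \<open>U \<noteq> {}\<close>])
    fix y z assume "y \<in> U" "z \<in> U"
    then have "y / z \<in> k"
      using a(2) by (auto simp: U_def coeffs_def intro!: k.divide_closed split: if_splits)
    from val[OF this] show "y / z \<in> \<oo> \<or> z / y \<in> \<oo>" by simp
  qed (auto simp: U_def)
  then obtain c where c: "c \<in> U" "\<And>z. z \<in> U \<Longrightarrow> z / c \<in> \<oo>" by blast
  define a' where "a' = Polynomial.smult (inverse c) a"
  have "c \<noteq> 0" "c \<in> k"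
    using c a(2) by (auto simp: U_def coeffs_def split: if_splits)
  have "Polynomial.coeff a' i \<in> \<oo>" for i
  proof (cases "Polynomial.coeff a i = 0")
    case False
    then have "Polynomial.coeff a i \<in> U"
      using \<open>a \<noteq> 0\<close> le_degree[of a i] by (auto simp: U_def intro!: coeff_in_coeffs)
    from c(2)[OF this] show ?thesis
      by (simp add: a'_def divide_inverse mult.commute)
  qed (simp add: a'_def \<oo>.zero_closed)
  then have 1: "fps_to_fls (fps_of_poly a') \<in> poly_series \<oo>"
    by (auto simp: poly_series_def)
  obtain i where "Polynomial.coeff a i = c"
    using c(1) by (auto simp: U_def coeffs_def split: if_splits)
  then have "fls_nth (s0 (fps_to_fls (fps_of_poly a'))) (int i) = 1"
    using \<open>c \<noteq> 0\<close> by (simp add: nth_s0 a'_def \<kappa>.hom_one)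
  then have 2: "s0 (fps_to_fls (fps_of_poly a')) \<noteq> 0" by auto
  have 3: "x = fls_const c * fps_to_fls (fps_of_poly a')"
    using \<open>c \<noteq> 0\<close> by (intro fls_eqI) (simp add: a a'_def)
  show thesis
    by (rule that[OF \<open>c \<in> k\<close> \<open>c \<noteq> 0\<close> 1 2 3])
qed

text \<open>Numerator and denominator are split into contents and primitive parts. The quotient of
  the primitive parts is a unit of the Gauss ring, so the decision falls on the quotient of the
  contents, by the valuation ring \<oo>.\<close>

lemma gauss_valuation:
  assumes "x \<in> F"
  shows "x \<in> gauss_ring \<or> inverse x \<in> gauss_ring"
proof (cases "x = 0")
  case True
  then show ?thesis by (simp add: gauss_ring.zero_closed)
next
  case False
  obtain a b where ab: "x = a / b" "a \<in> poly_series k" "b \<in> poly_series k" "a \<noteq> 0" "b \<noteq> 0"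
    using assms False unfolding F_eq by (auto simp: quotient_field_def)
  obtain c a' where a: "c \<in> k" "c \<noteq> 0" "a' \<in> poly_series \<oo>" "s0 a' \<noteq> 0" "a = fls_const c * a'"
    by (rule primitive_part[OF ab(2,4)])
  obtain e b' where b: "e \<in> k" "e \<noteq> 0" "b' \<in> poly_series \<oo>" "s0 b' \<noteq> 0" "b = fls_const e * b'"
    by (rule primitive_part[OF ab(3,5)])
  have const: "fls_const u \<in> gauss_ring" if "u \<in> \<oo>" for u
  proof -
    have "fls_const u = fps_to_fls (fps_of_poly [:u:])"
      by (simp add: fps_of_poly_const)
    then have "fls_const u \<in> poly_series \<oo>"
      using that \<oo>.zero_closed by (auto simp: poly_series_def coeff_pCons split: nat.splits)
    then have "fls_const u / 1 \<in> gauss_ring"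
      unfolding gauss_ring_def using P\<oo>.one_closed by (force simp: s0.hom_one)
    then show ?thesis by simp
  qed
  have quot: "a' / b' \<in> gauss_ring" "b' / a' \<in> gauss_ring"
    using a b by (auto simp: gauss_ring_def)
  have "fls_const (c / e) = fls_const c / fls_const e"
    using b(2) by (simp add: fls_const_divide_const)
  then have x: "x = fls_const (c / e) * (a' / b')"
    unfolding ab(1) a(5) b(5) by (simp add: times_divide_times_eq)
  have "c / e \<in> \<oo> \<or> inverse (c / e) \<in> \<oo>"
    using a b by (intro val k.divide_closed)
  then show ?thesis
  proof
    assume "c / e \<in> \<oo>"
    then show ?thesis using x const quot gauss_ring.mult_closed by metis
  next
    assume "inverse (c / e) \<in> \<oo>"
    moreover have "inverse x = fls_const (inverse (c / e)) * (b' / a')"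
      unfolding x inverse_mult_distrib fls_inverse_const by simp
    ultimately show ?thesis using const quot gauss_ring.mult_closed by metis
  qed
qed

text \<open>Elements of the Gauss ring need not be power series, as 1/t shows, so a specialization
  can be applied only after clearing denominators. The condition
  \<open>s0 \<beta> \<noteq> 0\<close> allows \<beta> to be cancelled afterwards.\<close>

lemma common_denominator:
  assumes "finite U" "U \<subseteq> gauss_ring"
  shows "\<exists>\<beta>\<in>poly_series \<oo>. s0 \<beta> \<noteq> 0 \<and> (\<forall>x\<in>U. \<beta> * x \<in> poly_series \<oo>)"
  using assms
proof (induction U rule: finite_induct)
  case empty
  show ?case by (intro bexI[of _ 1]) (auto simp: s0.hom_one P\<oo>.one_closed)
next
  case (insert x U)
  then obtain \<beta> where \<beta>: "\<beta> \<in> poly_series \<oo>" "s0 \<beta> \<noteq> 0" "\<And>x. x \<in> U \<Longrightarrow> \<beta> * x \<in> poly_series \<oo>"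
    by auto
  obtain a b where x: "x = a / b" "a \<in> poly_series \<oo>" "b \<in> poly_series \<oo>" "s0 b \<noteq> 0"
    using insert.prems by (auto simp: gauss_ring_def)
  then have "b \<noteq> 0" using s0.hom_zero by auto
  show ?case
  proof (intro bexI[of _ "b * \<beta>"] conjI ballI)
    fix z assume "z \<in> insert x U"
    then show "b * \<beta> * z \<in> poly_series \<oo>"
      using x \<beta> \<open>b \<noteq> 0\<close> P\<oo>.mult_closed[of \<beta> a] P\<oo>.mult_closed[of b "\<beta> * z"]
      by (auto simp: mult_ac) (metis mult.commute mult.left_commute)
  qed (use x \<beta> in \<open>auto simp: P\<oo>.mult_closed s0_mult_nonzero\<close>)
qed

end

section \<open>Multivariate polynomials\<close>

type_synonym ('v, 'a) mpoly = "('v \<Rightarrow>\<^sub>0 nat) \<Rightarrow>\<^sub>0 'a"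

definition Cst :: "'a::zero \<Rightarrow> ('v, 'a) mpoly" where
  "Cst c = Poly_Mapping.single 0 c"

definition Var :: "'v \<Rightarrow> ('v, 'a::zero_neq_one) mpoly" where
  "Var v = Poly_Mapping.single (Poly_Mapping.single v 1) 1"

definition monom_at :: "('v::finite \<Rightarrow> 'b::comm_ring_1) \<Rightarrow> ('v \<Rightarrow>\<^sub>0 nat) \<Rightarrow> 'b" where
  "monom_at G m = (\<Prod>v\<in>UNIV. G v ^ Poly_Mapping.lookup m v)"

definition insertion ::
  "('a::zero \<Rightarrow> 'b) \<Rightarrow> ('v::finite \<Rightarrow> 'b::comm_ring_1) \<Rightarrow> ('v, 'a) mpoly \<Rightarrow> 'b" where
  "insertion h G f =
     (\<Sum>m\<in>Poly_Mapping.keys f. h (Poly_Mapping.lookup f m) * monom_at G m)"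

lemma monom_at_0: "monom_at G 0 = 1"
  by (simp add: monom_at_def)

lemma monom_at_add: "monom_at G (m + m') = monom_at G m * monom_at G m'"
  by (simp add: monom_at_def lookup_add power_add prod.distrib)

lemma monom_at_single: "monom_at G (Poly_Mapping.single v 1) = G v"
proof -
  have "monom_at G (Poly_Mapping.single v 1) = (\<Prod>u\<in>UNIV. if u = v then G v else 1)"
    unfolding monom_at_def by (intro prod.cong) (auto simp: lookup_single)
  then show ?thesis by simp
qed

lemma poly_mapping_expand:
  fixes f :: "'i \<Rightarrow>\<^sub>0 'a::comm_monoid_add"
  shows "(\<Sum>m\<in>Poly_Mapping.keys f. Poly_Mapping.single m (Poly_Mapping.lookup f m)) = f"
  by (rule poly_mapping_eqI)
    (auto simp: lookup_sum lookup_single when_def not_in_keys_iff_lookup_eq_zero)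

lemma monom_at_Var:
  "monom_at Var m = (Poly_Mapping.single m 1 :: ('v::finite, 'a::comm_ring_1) mpoly)"
proof -
  have pow: "Var v ^ n = (Poly_Mapping.single (Poly_Mapping.single v n) 1 :: ('v, 'a) mpoly)" for v n
    by (induction n) (simp_all add: Var_def mult_single flip: single_add)
  have "monom_at Var m =
      (\<Prod>v\<in>UNIV. Poly_Mapping.single (Poly_Mapping.single v (Poly_Mapping.lookup m v)) (1::'a))"
    by (simp add: monom_at_def pow)
  also have "(\<Prod>v\<in>V. Poly_Mapping.single (Poly_Mapping.single v (Poly_Mapping.lookup m v)) (1::'a)) =
      Poly_Mapping.single (\<Sum>v\<in>V. Poly_Mapping.single v (Poly_Mapping.lookup m v)) 1" for V
    by (induction V rule: infinite_finite_induct) (simp_all add: mult_single)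
  also have "(\<Sum>v\<in>UNIV. Poly_Mapping.single v (Poly_Mapping.lookup m v)) = m"
    by (rule poly_mapping_eqI) (simp add: lookup_sum lookup_single when_def)
  finally show ?thesis .
qed

lemma single_eq_Cst_mult:
  "Poly_Mapping.single m c = (Cst c * monom_at Var m :: ('v::finite, 'a::comm_ring_1) mpoly)"
  by (simp add: monom_at_Var Cst_def mult_single)

lemma mult_expand:
  fixes f g :: "('v, 'a::comm_ring_1) mpoly"
  shows "f * g = (\<Sum>m\<in>Poly_Mapping.keys f. \<Sum>m'\<in>Poly_Mapping.keys g.
    Poly_Mapping.single (m + m') (Poly_Mapping.lookup f m * Poly_Mapping.lookup g m'))"
  by (subst (1) poly_mapping_expand[of f, symmetric], subst (1) poly_mapping_expand[of g, symmetric])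
    (simp add: sum_product mult_single)

lemma insertion_superset:
  assumes "finite T" "Poly_Mapping.keys f \<subseteq> T" "h 0 = 0"
  shows "insertion h G f = (\<Sum>m\<in>T. h (Poly_Mapping.lookup f m) * monom_at G m)"
  unfolding insertion_def using assms
  by (intro sum.mono_neutral_left) (auto simp: in_keys_iff)

lemma insertion_single: "h 0 = 0 \<Longrightarrow> insertion h G (Poly_Mapping.single m c) = h c * monom_at G m"
  by (subst insertion_superset[of "{m}"]) auto

lemma insertion_hom:
  fixes h :: "'a::comm_ring_1 \<Rightarrow> 'b::comm_ring_1"
  assumes "subring_hom UNIV h"
  shows "subring_hom UNIV (insertion h G)"
proof -
  interpret subring_hom UNIV h by fact
  have add: "insertion h G (f + g) = insertion h G f + insertion h G g" for f g
  proof -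
    let ?T = "Poly_Mapping.keys f \<union> Poly_Mapping.keys g"
    have "insertion h G (f + g) = (\<Sum>m\<in>?T. h (Poly_Mapping.lookup (f + g) m) * monom_at G m)"
      by (intro insertion_superset keys_add) (auto simp: hom_zero)
    also have "\<dots> = (\<Sum>m\<in>?T. h (Poly_Mapping.lookup f m) * monom_at G m) +
        (\<Sum>m\<in>?T. h (Poly_Mapping.lookup g m) * monom_at G m)"
      by (simp add: lookup_add hom_add distrib_right sum.distrib)
    also have "\<dots> = insertion h G f + insertion h G g"
      by (intro arg_cong2[where f = "(+)"] insertion_superset[symmetric]) (auto simp: hom_zero)
    finally show ?thesis .
  qed
  have zero: "insertion h G 0 = 0" by (simp add: insertion_def)
  have sum: "insertion h G (sum f I) = (\<Sum>i\<in>I. insertion h G (f i))" for f :: "'i \<Rightarrow> _" and I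
    by (induction I rule: infinite_finite_induct) (simp_all add: zero add)
  show ?thesis
  proof
    show "insertion h G 1 = 1"
      by (subst single_one[symmetric]) (simp add: insertion_single hom_zero hom_one monom_at_0
          del: single_one)
    show "insertion h G (f * g) = insertion h G f * insertion h G g" for f g
    proof -
      have "insertion h G (f * g) = (\<Sum>m\<in>Poly_Mapping.keys f. \<Sum>m'\<in>Poly_Mapping.keys g.
          h (Poly_Mapping.lookup f m * Poly_Mapping.lookup g m') * monom_at G (m + m'))"
        unfolding mult_expand[of f g] sum by (simp add: insertion_single hom_zero)
      then show ?thesis
        by (simp add: hom_mult monom_at_add insertion_def sum_product mult_ac)
    qed
  qed (auto simp: add)
qed

lemma (in subring_hom) hom_monom_at:
  assumes "\<And>v. G v \<in> A"
  shows "monom_at G m \<in> A" "h (monom_at G m) = monom_at (\<lambda>v. h (G v)) m"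
  unfolding monom_at_def using assms
  by (simp_all add: hom_prod hom_power prod_closed power_closed)

section \<open>Polynomials over subrings and coefficientwise homomorphisms\<close>

definition mpolys :: "'a::zero set \<Rightarrow> ('v, 'a) mpoly set" where
  "mpolys A = {f. \<forall>m. Poly_Mapping.lookup f m \<in> A}"

definition mp_map :: "('a::zero \<Rightarrow> 'b::comm_monoid_add) \<Rightarrow> ('v, 'a) mpoly \<Rightarrow> ('v, 'b) mpoly" where
  "mp_map h f = (\<Sum>m\<in>Poly_Mapping.keys f. Poly_Mapping.single m (h (Poly_Mapping.lookup f m)))"

lemma lookup_mp_map:
  assumes "h 0 = 0"
  shows "Poly_Mapping.lookup (mp_map h f) m = h (Poly_Mapping.lookup f m)"
  unfolding mp_map_def using assms
  by (auto simp: lookup_sum lookup_single when_def not_in_keys_iff_lookup_eq_zero)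

lemma mpolys_UNIV [simp]: "mpolys UNIV = UNIV"
  by (auto simp: mpolys_def)

lemma mpolys_mono: "A \<subseteq> B \<Longrightarrow> mpolys A \<subseteq> mpolys B"
  by (auto simp: mpolys_def)

context subring_set
begin

lemma single_mpolys: "c \<in> A \<Longrightarrow> Poly_Mapping.single m c \<in> mpolys A"
  by (simp add: mpolys_def lookup_single when_def zero_closed)

lemma Cst_mpolys: "c \<in> A \<Longrightarrow> Cst c \<in> mpolys A"
  unfolding Cst_def by (rule single_mpolys)

lemma mpolys_add: "f \<in> mpolys A \<Longrightarrow> g \<in> mpolys A \<Longrightarrow> f + g \<in> mpolys A"
  by (simp add: mpolys_def lookup_add add_closed)

lemma mpolys_sum: "(\<And>i. i \<in> I \<Longrightarrow> f i \<in> mpolys A) \<Longrightarrow> sum f I \<in> mpolys A"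
  by (simp add: mpolys_def lookup_sum sum_closed)

lemma subring_mpolys: "subring_set (mpolys A :: ('v, 'a) mpoly set)"
proof
  fix f g :: "('v, 'a) mpoly" assume fg: "f \<in> mpolys A" "g \<in> mpolys A"
  then have "Poly_Mapping.lookup f m \<in> A" "Poly_Mapping.lookup g m \<in> A" for m
    by (simp_all add: mpolys_def)
  then show "f * g \<in> mpolys A"
    unfolding mult_expand[of f g] by (intro mpolys_sum single_mpolys mult_closed)
next
  show "1 \<in> mpolys A"
    using Cst_mpolys[OF one_closed] by (simp add: Cst_def)
qed (rule mpolys_add, assumption+, simp add: mpolys_def uminus_closed)

lemma Var_mpolys: "Var v \<in> mpolys A"
  using single_mpolys[OF one_closed] by (simp add: Var_def)

end

text \<open>Constants and variables generate, so the compatibilities of evaluation, substitution and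
  coefficient maps need checking only there.\<close>

lemma mpoly_hom_eqI:
  fixes \<alpha> \<beta> :: "('v::finite, 'a::comm_ring_1) mpoly \<Rightarrow> 'b::comm_ring_1"
  assumes "subring_set A" "subring_hom (mpolys A) \<alpha>" "subring_hom (mpolys A) \<beta>"
    and Cst: "\<And>c. c \<in> A \<Longrightarrow> \<alpha> (Cst c) = \<beta> (Cst c)" and Var: "\<And>v. \<alpha> (Var v) = \<beta> (Var v)"
    and f: "f \<in> mpolys A"
  shows "\<alpha> f = \<beta> f"
proof -
  interpret subring_set A by fact
  interpret \<alpha>: subring_hom "mpolys A" \<alpha> by fact
  interpret \<beta>: subring_hom "mpolys A" \<beta> by fact
  have c: "Poly_Mapping.lookup f m \<in> A" for m
    using f by (simp add: mpolys_def)
  have "\<alpha> (Poly_Mapping.single m (Poly_Mapping.lookup f m)) =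
      \<beta> (Poly_Mapping.single m (Poly_Mapping.lookup f m))" for m
    unfolding single_eq_Cst_mult using c
    by (simp add: \<alpha>.hom_mult \<beta>.hom_mult Cst_mpolys \<alpha>.hom_monom_at \<beta>.hom_monom_at Var_mpolys Cst Var)
  then have "\<alpha> (\<Sum>m\<in>Poly_Mapping.keys f. Poly_Mapping.single m (Poly_Mapping.lookup f m)) =
      \<beta> (\<Sum>m\<in>Poly_Mapping.keys f. Poly_Mapping.single m (Poly_Mapping.lookup f m))"
    using c by (simp add: \<alpha>.hom_sum \<beta>.hom_sum single_mpolys)
  then show ?thesis by (simp add: poly_mapping_expand)
qed

lemma subring_hom_comp:
  assumes "subring_hom A g" "subring_hom B h" "\<And>x. x \<in> A \<Longrightarrow> g x \<in> B"
  shows "subring_hom A (\<lambda>x. h (g x))"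
proof -
  interpret g: subring_hom A g by fact
  interpret h: subring_hom B h by fact
  show ?thesis
    by unfold_locales (simp_all add: assms(3) g.hom_one h.hom_one g.hom_add h.hom_add
        g.hom_mult h.hom_mult)
qed

context subring_hom
begin

lemma mp_map_hom: "subring_hom (mpolys A :: ('v, 'a) mpoly set) (mp_map h)"
proof -
  note lookup = lookup_mp_map[of h, OF hom_zero]
  interpret M: subring_set "mpolys A :: ('v, 'a) mpoly set"
    by (rule subring_mpolys)
  have single: "mp_map h (Poly_Mapping.single m c) = Poly_Mapping.single m (h c)"
    for m :: "'v \<Rightarrow>\<^sub>0 nat" and c
    by (rule poly_mapping_eqI) (simp add: lookup lookup_single when_def hom_zero)
  have add: "mp_map h (f + g) = mp_map h f + mp_map h g"
    if "f \<in> mpolys A" "g \<in> mpolys A" for f g :: "('v, 'a) mpoly"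
    using that by (intro poly_mapping_eqI) (simp add: lookup lookup_add hom_add mpolys_def)
  have sum: "mp_map h (sum f I) = (\<Sum>i\<in>I. mp_map h (f i))"
    if "\<And>i. i \<in> I \<Longrightarrow> f i \<in> mpolys A" for f :: "'i \<Rightarrow> ('v, 'a) mpoly" and I
    using that by (induction I rule: infinite_finite_induct)
      (simp_all add: mp_map_def[of _ 0] add mpolys_sum)
  show ?thesis
  proof
    show "mp_map h (1 :: ('v, 'a) mpoly) = 1"
      using single[of 0 1] by (simp add: hom_one)
    fix f g :: "('v, 'a) mpoly" assume fg: "f \<in> mpolys A" "g \<in> mpolys A"
    then show "mp_map h (f + g) = mp_map h f + mp_map h g" by (rule add)
    from fg have c: "Poly_Mapping.lookup f m \<in> A" "Poly_Mapping.lookup g m \<in> A" for m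
      by (simp_all add: mpolys_def)
    then have mem: "Poly_Mapping.single (m + m') (Poly_Mapping.lookup f m * Poly_Mapping.lookup g m')
        \<in> mpolys A" for m m'
      by (intro single_mpolys mult_closed)
    have "mp_map h (f * g) = (\<Sum>m\<in>Poly_Mapping.keys f. \<Sum>m'\<in>Poly_Mapping.keys g.
        Poly_Mapping.single (m + m') (h (Poly_Mapping.lookup f m) * h (Poly_Mapping.lookup g m')))"
      unfolding mult_expand[of f g]
      by (simp add: sum mpolys_sum mem) (simp add: single hom_mult c)
    also have "\<dots> = mp_map h f * mp_map h g"
      by (simp add: mp_map_def sum_product mult_single)
    finally show "mp_map h (f * g) = mp_map h f * mp_map h g" .
  qed
qed

lemma mp_map_Cst: "mp_map h (Cst c) = Cst (h c)"
  by (rule poly_mapping_eqI) (simp add: lookup_mp_map hom_zero Cst_def lookup_single when_def)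

lemma mp_map_Var: "mp_map h (Var v) = Var v"
  by (rule poly_mapping_eqI)
    (simp add: lookup_mp_map hom_zero hom_one Var_def lookup_single when_def)

end

lemma Cst_hom: "subring_hom UNIV (Cst :: 'a::comm_ring_1 \<Rightarrow> ('v, 'a) mpoly)"
  by unfold_locales (simp_all add: Cst_def single_add mult_single)

lemma id_hom: "subring_hom UNIV (\<lambda>x :: 'a::comm_ring_1. x)"
  by unfold_locales simp_all

section \<open>Evaluation at matrices and left multiplication of the matrix of variables\<close>

definition ev :: "'a::comm_ring_1^'n::finite^'n \<Rightarrow> ('n \<times> 'n, 'a) mpoly \<Rightarrow> 'a" where
  "ev Z = insertion (\<lambda>x. x) (\<lambda>(i, j). Z $ i $ j)"

text \<open>The polynomial \<open>f(Z X)\<close>, for the matrix \<open>X\<close> of variables.\<close>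

definition left_sub ::
  "'a::comm_ring_1^'n::finite^'n \<Rightarrow> ('n \<times> 'n, 'a) mpoly \<Rightarrow> ('n \<times> 'n, 'a) mpoly" where
  "left_sub Z = insertion Cst (\<lambda>(i, j). \<Sum>l\<in>UNIV. Cst (Z $ i $ l) * Var (l, j))"

lemma ev_hom: "subring_hom UNIV (ev Z)"
  unfolding ev_def by (rule insertion_hom[OF id_hom])

lemma left_sub_hom: "subring_hom UNIV (left_sub Z)"
  unfolding left_sub_def by (rule insertion_hom[OF Cst_hom])

lemma ev_Cst [simp]: "ev Z (Cst c) = c"
  by (simp add: ev_def Cst_def insertion_single monom_at_0)

lemma ev_Var [simp]: "ev Z (Var (i, j)) = Z $ i $ j"
  using insertion_single[of "\<lambda>x. x" "\<lambda>(i, j). Z $ i $ j" "Poly_Mapping.single (i, j) 1" 1]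
  by (simp only: ev_def Var_def monom_at_single) simp

lemma left_sub_Cst:
  fixes Z :: "'a::comm_ring_1^'n::finite^'n"
  shows "left_sub Z (Cst c) = Cst c"
proof -
  have "Cst (0::'a) = (0 :: ('n \<times> 'n, 'a) mpoly)" by (simp add: Cst_def)
  then show ?thesis
    unfolding left_sub_def by (subst (2) Cst_def) (simp add: insertion_single monom_at_0)
qed

lemma left_sub_Var:
  fixes Z :: "'a::comm_ring_1^'n::finite^'n"
  shows "left_sub Z (Var (i, j)) = (\<Sum>l\<in>UNIV. Cst (Z $ i $ l) * Var (l, j))"
proof -
  have C0: "Cst (0::'a) = (0 :: ('n \<times> 'n, 'a) mpoly)" by (simp add: Cst_def)
  have C1: "Cst (1::'a) = (1 :: ('n \<times> 'n, 'a) mpoly)" by (simp add: Cst_def)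
  show ?thesis
    unfolding left_sub_def
    by (subst Var_def) (simp only: insertion_single[of Cst, OF C0] monom_at_single, simp add: C1)
qed

lemma ev_left_sub: "ev W (left_sub Z f) = ev (Z ** W) f"
proof -
  interpret ev: subring_hom UNIV "ev W" by (rule ev_hom)
  show ?thesis
  proof (rule mpoly_hom_eqI[OF subring_set_UNIV, unfolded mpolys_UNIV,
        of "\<lambda>f. ev W (left_sub Z f)" "ev (Z ** W)"])
    show "subring_hom UNIV (\<lambda>f. ev W (left_sub Z f))"
      by (rule subring_hom_comp[OF left_sub_hom ev_hom]) simp
  qed (auto simp: ev_hom left_sub_Cst left_sub_Var ev.hom_sum ev.hom_mult matrix_matrix_mult_def)
qed

text \<open>The order is reversed because Z X is inserted for X in f(W X).\<close>

lemma left_sub_left_sub: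
  fixes Z W :: "'a::comm_ring_1^'n::finite^'n"
  shows "left_sub Z (left_sub W f) = left_sub (W ** Z) f"
proof -
  interpret Z: subring_hom UNIV "left_sub Z" by (rule left_sub_hom)
  interpret C: subring_hom UNIV "Cst :: 'a \<Rightarrow> ('n \<times> 'n, 'a) mpoly" by (rule Cst_hom)
  have Var: "left_sub Z (left_sub W (Var v)) = left_sub (W ** Z) (Var v)" for v
  proof (cases v)
    case (Pair i j)
    have "left_sub Z (left_sub W (Var v)) =
        (\<Sum>l\<in>UNIV. \<Sum>m\<in>UNIV. Cst (W $ i $ l) * (Cst (Z $ l $ m) * Var (m, j)))"
      by (simp add: Pair left_sub_Var Z.hom_sum Z.hom_mult left_sub_Cst sum_distrib_left)
    also have "\<dots> = left_sub (W ** Z) (Var v)"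
      by (subst sum.swap)
        (simp add: Pair left_sub_Var matrix_matrix_mult_def C.hom_sum C.hom_mult sum_distrib_right
          mult.assoc)
    finally show ?thesis .
  qed
  show ?thesis
  proof (rule mpoly_hom_eqI[OF subring_set_UNIV, unfolded mpolys_UNIV,
        of "\<lambda>f. left_sub Z (left_sub W f)" "left_sub (W ** Z)"])
    show "subring_hom UNIV (\<lambda>f. left_sub Z (left_sub W f))"
      by (rule subring_hom_comp[OF left_sub_hom left_sub_hom]) simp
  qed (auto simp: left_sub_hom left_sub_Cst Var)
qed

lemma left_sub_one:
  fixes f :: "('n::finite \<times> 'n, 'a::comm_ring_1) mpoly"
  shows "left_sub (mat 1) f = f"
proof (rule mpoly_hom_eqI[OF subring_set_UNIV, unfolded mpolys_UNIV,
      of "left_sub (mat 1)" "\<lambda>f. f"])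
  have "Cst (if P then c else 0) * g = (if P then Cst c * g else 0)"
    for P and c :: 'a and g :: "('n \<times> 'n, 'a) mpoly"
    by (simp add: Cst_def)
  moreover have "Cst 1 = (1 :: ('n \<times> 'n, 'a) mpoly)"
    by (simp add: Cst_def)
  ultimately show "left_sub (mat 1) (Var v :: ('n \<times> 'n, 'a) mpoly) = Var v" for v
    by (cases v) (simp add: left_sub_Var mat_def)
qed (auto simp: left_sub_hom left_sub_Cst id_hom)

context subring_set
begin

lemma left_sub_closed:
  fixes Z :: "'a^'n::finite^'n"
  assumes "\<And>i j. Z $ i $ j \<in> A" "f \<in> mpolys A"
  shows "left_sub Z f \<in> mpolys A"
proof -
  interpret M: subring_set "mpolys A :: ('n \<times> 'n, 'a) mpoly set" by (rule subring_mpolys)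
  have "(case v of (i, j) \<Rightarrow> \<Sum>l\<in>UNIV. Cst (Z $ i $ l) * Var (l, j)) \<in> mpolys A"
    for v :: "'n \<times> 'n"
    using assms(1)
    by (auto split: prod.split intro!: M.sum_closed M.mult_closed Cst_mpolys Var_mpolys)
  then show ?thesis
    using assms(2) unfolding left_sub_def insertion_def monom_at_def
    by (intro M.sum_closed M.mult_closed M.prod_closed M.power_closed Cst_mpolys)
      (auto simp: mpolys_def)
qed

lemma ev_closed:
  fixes Z :: "'a^'n::finite^'n"
  assumes "\<And>i j. Z $ i $ j \<in> A" "f \<in> mpolys A"
  shows "ev Z f \<in> A"
  using assms unfolding ev_def insertion_def monom_at_def
  by (intro sum_closed mult_closed prod_closed power_closed) (auto simp: mpolys_def split: prod.splits)

end

context subring_hom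
begin

lemma mp_map_left_sub:
  fixes Z :: "'a^'n::finite^'n"
  assumes "\<And>i j. Z $ i $ j \<in> A" "f \<in> mpolys A"
  shows "mp_map h (left_sub Z f) = left_sub (map_matrix h Z) (mp_map h f)"
proof (rule mpoly_hom_eqI[OF subring_set_axioms _ _ _ _ assms(2),
      of "\<lambda>f. mp_map h (left_sub Z f)" "\<lambda>f. left_sub (map_matrix h Z) (mp_map h f)"])
  show "subring_hom (mpolys A) (\<lambda>f. mp_map h (left_sub Z f))"
    by (rule subring_hom_comp[OF subring_hom_mono[OF left_sub_hom subring_mpolys] mp_map_hom])
      (auto intro: left_sub_closed assms(1))
  show "subring_hom (mpolys A) (\<lambda>f. left_sub (map_matrix h Z) (mp_map h f))"
    by (rule subring_hom_comp[OF mp_map_hom left_sub_hom]) simp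
  interpret M: subring_hom "mpolys A :: ('n \<times> 'n, 'a) mpoly set" "mp_map h"
    by (rule mp_map_hom)
  show "mp_map h (left_sub Z (Var v)) = left_sub (map_matrix h Z) (mp_map h (Var v))" for v
    using assms(1)
    by (cases v) (simp add: left_sub_Var mp_map_Var M.hom_sum M.hom_mult M.mult_closed Cst_mpolys
        Var_mpolys mp_map_Cst map_matrix_def)
qed (auto simp: left_sub_Cst mp_map_Cst)

lemma hom_ev:
  fixes Z :: "'a^'n::finite^'n"
  assumes "\<And>i j. Z $ i $ j \<in> A" "f \<in> mpolys A"
  shows "h (ev Z f) = ev (map_matrix h Z) (mp_map h f)"
proof (rule mpoly_hom_eqI[OF subring_set_axioms _ _ _ _ assms(2),
      of "\<lambda>f. h (ev Z f)" "\<lambda>f. ev (map_matrix h Z) (mp_map h f)"])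
  show "subring_hom (mpolys A) (\<lambda>f. h (ev Z f))"
    by (rule subring_hom_comp[OF subring_hom_mono[OF ev_hom subring_mpolys] subring_hom_axioms])
      (auto intro: ev_closed assms(1))
  show "subring_hom (mpolys A) (\<lambda>f. ev (map_matrix h Z) (mp_map h f))"
    by (rule subring_hom_comp[OF mp_map_hom ev_hom]) simp
  show "h (ev Z (Var v)) = ev (map_matrix h Z) (mp_map h (Var v))" for v
    by (cases v) (simp add: mp_map_Var map_matrix_def)
qed (simp add: mp_map_Cst)

lemma hom_det:
  fixes Z :: "'a^'n::finite^'n"
  assumes "\<And>i j. Z $ i $ j \<in> A"
  shows "det Z \<in> A" "h (det Z) = det (map_matrix h Z)"
proof -
  have prod: "(\<Prod>i\<in>UNIV. Z $ i $ p i) \<in> A" for p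
    using assms by (intro prod_closed)
  then show "det Z \<in> A"
    unfolding det_def by (intro sum_closed mult_closed of_int_closed)
  show "h (det Z) = det (map_matrix h Z)"
    unfolding det_def using prod assms
    by (simp add: hom_sum hom_mult of_int_closed mult_closed hom_of_int hom_prod map_matrix_def)
qed

end

lemma eval_matrix_poly_eq_ev: "eval_matrix_poly f g = ev g f"
proof -
  have "(\<Prod>(i, j)\<in>Poly_Mapping.keys m. (g $ i $ j) ^ Poly_Mapping.lookup m (i, j)) =
      monom_at (\<lambda>(i, j). g $ i $ j) m" for m
    unfolding monom_at_def
    by (intro prod.mono_neutral_cong_left) (auto simp: in_keys_iff)
  then show ?thesis by (simp add: eval_matrix_poly_def ev_def insertion_def)
qed

section \<open>Specialization of the relations of the fundamental matrix\<close>

lemma lookup_Cst_mult: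
  fixes g :: "('v, 'a::comm_ring_1) mpoly"
  shows "Poly_Mapping.lookup (Cst c * g) m = c * Poly_Mapping.lookup g m"
  unfolding Cst_def mult_map_scale_conv_mult[symmetric]
  by (simp add: Poly_Mapping.map.rep_eq when_def)

text \<open>The scalars are all of the coefficient ring, here K((t)), while the relations themselves
  are over k(t). Stating the span through coefficient functions makes \<open>descent\<close> and
  \<open>pivot_basis\<close>, which speak of functions, applicable to polynomials.\<close>

abbreviation mp_span :: "('v, 'a::comm_ring_1) mpoly set \<Rightarrow> ('v, 'a) mpoly set" where
  "mp_span S \<equiv> {w. Poly_Mapping.lookup w \<in> lin_span UNIV (Poly_Mapping.lookup ` S)}"

lemma mp_span_induct [consumes 1, case_names zero add]:
  fixes w :: "('v, 'a::comm_ring_1) mpoly"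
  assumes "w \<in> mp_span S" "P 0"
    and "\<And>c v u. v \<in> S \<Longrightarrow> u \<in> mp_span S \<Longrightarrow> P u \<Longrightarrow> P (Cst c * v + u)"
  shows "P w"
proof -
  have "\<exists>w. Poly_Mapping.lookup w = l \<and> P w" if "l \<in> lin_span UNIV (Poly_Mapping.lookup ` S)" for l
    using that
  proof induction
    case zero
    then show ?case using assms(2) by (intro exI[of _ 0]) auto
  next
    case (add c l u)
    then obtain v w where vw: "v \<in> S" "l = Poly_Mapping.lookup v" "Poly_Mapping.lookup w = u" "P w"
      by auto
    show ?case
    proof (intro exI[of _ "Cst c * v + w"] conjI ext)
      show "P (Cst c * v + w)" using vw add.hyps assms(3) by auto
      show "Poly_Mapping.lookup (Cst c * v + w) i = c * l i + u i" for i
        using vw by (simp add: lookup_add lookup_Cst_mult)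
    qed
  qed
  with assms(1) obtain w' where "Poly_Mapping.lookup w' = Poly_Mapping.lookup w" "P w'"
    by blast
  then show ?thesis by (simp flip: poly_mapping_eq_iff)
qed

lemma mp_span_base: "w \<in> S \<Longrightarrow> w \<in> mp_span S"
  by (rule CollectI) (rule subring_set.lin_span_base[OF subring_set_UNIV imageI])

lemma mp_span_zero: "(0 :: ('v, 'a::comm_ring_1) mpoly) \<in> mp_span S"
proof -
  have "Poly_Mapping.lookup (0 :: ('v, 'a) mpoly) = (\<lambda>_. 0)" by auto
  then show ?thesis by (simp add: lin_span.zero)
qed

lemma mp_span_add:
  assumes "u \<in> mp_span S" "w \<in> mp_span S"
  shows "u + w \<in> mp_span S"
proof -
  have "Poly_Mapping.lookup (u + w) = (\<lambda>i. Poly_Mapping.lookup u i + Poly_Mapping.lookup w i)"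
    by (auto simp: lookup_add)
  then show ?thesis using assms by (simp add: lin_span_add)
qed

lemma mp_span_scale:
  assumes "w \<in> mp_span S"
  shows "Cst c * w \<in> mp_span S"
proof -
  have "Poly_Mapping.lookup (Cst c * w) = (\<lambda>i. c * Poly_Mapping.lookup w i)"
    by (auto simp: lookup_Cst_mult)
  then show ?thesis using assms by (simp add: subring_set.lin_span_scale[OF subring_set_UNIV])
qed

text \<open>A combination involves finitely many vectors. The union of their supports supplies the
  finite index set required by \<open>pivot_basis\<close>, although there are infinitely many
  monomials.\<close>

lemma lin_span_finite_support:
  assumes "w \<in> lin_span E V" "\<And>v. v \<in> V \<Longrightarrow> finite {i. v i \<noteq> 0}"
  shows "\<exists>T. finite T \<and> w \<in> lin_span E {v \<in> V. \<forall>i. i \<notin> T \<longrightarrow> v i = 0}"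
  using assms(1)
proof induction
  case zero
  show ?case by (intro exI[of _ "{}"]) (auto intro: lin_span.zero)
next
  case (add c v u)
  then obtain T where T: "finite T" "u \<in> lin_span E {v \<in> V. \<forall>i. i \<notin> T \<longrightarrow> v i = 0}" by blast
  let ?T = "T \<union> {i. v i \<noteq> 0}"
  have mono: "lin_span E A \<subseteq> lin_span E B" if "A \<subseteq> B" for A B :: "('a \<Rightarrow> 'b) set"
  proof
    fix x assume "x \<in> lin_span E A"
    then show "x \<in> lin_span E B"
      by induction (use that in \<open>auto intro: lin_span.intros\<close>)
  qed
  have "u \<in> lin_span E {v \<in> V. \<forall>i. i \<notin> ?T \<longrightarrow> v i = 0}"
    by (rule subsetD[OF mono T(2)]) auto
  moreover have "v \<in> {v \<in> V. \<forall>i. i \<notin> ?T \<longrightarrow> v i = 0}"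
    using add.hyps by auto
  ultimately have "(\<lambda>i. c * v i + u i) \<in> lin_span E {v \<in> V. \<forall>i. i \<notin> ?T \<longrightarrow> v i = 0}"
    using add.hyps by (intro lin_span.add) auto
  moreover have "finite ?T" using T(1) assms(2)[OF add.hyps(2)] by simp
  ultimately show ?case by blast
qed

text \<open>Only finitely many coefficients are nonzero, so the sum of bounds for their pole orders
  is a common exponent. A factor t^N does not affect where a polynomial vanishes.\<close>

lemma clear_denominators:
  fixes h :: "('v, 'a::field fls) mpoly"
  assumes "h \<in> mpolys (laurent_series_over A)"
  obtains N where "Cst (fls_X ^ N) * h \<in> mpolys (power_series_over A)"
proof -
  have "\<forall>m. \<exists>N. \<forall>n. n < - int N \<longrightarrow> fls_nth (Poly_Mapping.lookup h m) n = 0"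
  proof
    fix m
    obtain a where "\<forall>n<a. fls_nth (Poly_Mapping.lookup h m) n = 0"
      using ex_fls_bound by blast
    then show "\<exists>N. \<forall>n. n < - int N \<longrightarrow> fls_nth (Poly_Mapping.lookup h m) n = 0"
      by (intro exI[of _ "nat (- a)"]) auto
  qed
  from choice[OF this] obtain N where
    N: "\<And>m n. n < - int (N m) \<Longrightarrow> fls_nth (Poly_Mapping.lookup h m) n = 0" by blast
  define M where "M = (\<Sum>m\<in>Poly_Mapping.keys h. N m)"
  have M: "fls_nth (Poly_Mapping.lookup h m) n = 0" if "n < - int M" for m n
  proof (cases "m \<in> Poly_Mapping.keys h")
    case True
    then have "N m \<le> M"
      unfolding M_def by (intro member_le_sum) auto
    with that show ?thesis by (intro N) linarith
  qed (simp add: in_keys_iff)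
  have "fls_nth (fls_X ^ M * Poly_Mapping.lookup h m) n = fls_nth (Poly_Mapping.lookup h m) (n - int M)"
    for m n by (simp add: fls_X_power_times_conv_shift)
  then have "Cst (fls_X ^ M) * h \<in> mpolys (power_series_over A)"
    using assms M by (auto simp: mpolys_def lookup_Cst_mult power_series_over_def laurent_series_over_def)
  then show thesis by (rule that)
qed

context specialization
begin

definition relations :: "'a fls^'n::finite^'n \<Rightarrow> ('n \<times> 'n, 'a fls) mpoly set" where
  "relations Y = {f \<in> mpolys F. ev Y f = 0}"

text \<open>The relations have a basis over the Gauss valuation ring with pivots equal to 1, so that
  the coordinates of a combination \<open>g\<close> with integral coefficients are coefficients of \<open>g\<close>, hence
  integral as well; the whole identity can then be specialized.\<close>

lemma specialize_combination:
  fixes Y :: "'a fls^'n::finite^'n"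
  assumes \<alpha>\<beta>: "\<alpha> \<in> {s0, s1}" "\<beta> \<in> {s0, s1}"
    and Y: "\<And>i j. Y $ i $ j \<in> power_series_over \<O>"
    and g: "g \<in> mpolys (power_series_over \<O>)" "g \<in> mp_span (relations Y)"
  shows "ev (map_matrix \<beta> Y) (mp_map \<alpha> g) = 0"
proof -
  interpret \<alpha>: subring_hom "power_series_over \<O>" \<alpha>
    using \<alpha>\<beta>(1) s0.subring_hom_axioms s1.subring_hom_axioms by blast
  interpret \<beta>: subring_hom "power_series_over \<O>" \<beta>
    using \<alpha>\<beta>(2) s0.subring_hom_axioms s1.subring_hom_axioms by blast
  have \<alpha>_eq_\<beta>: "\<alpha> x = \<beta> x" if "x \<in> poly_series \<oo>" for x
    using \<alpha>\<beta> s1_eq_s0 poly_series_\<oo>_subset that by auto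
  define V where "V = Poly_Mapping.lookup ` relations Y"
  have "\<exists>T. finite T \<and> Poly_Mapping.lookup g \<in> lin_span UNIV {v \<in> V. \<forall>i. i \<notin> T \<longrightarrow> v i = 0}"
    by (rule lin_span_finite_support) (use g(2) in \<open>auto simp: V_def\<close>)
  then obtain T where T: "finite T"
    and gT: "Poly_Mapping.lookup g \<in> lin_span UNIV {v \<in> V. \<forall>i. i \<notin> T \<longrightarrow> v i = 0}"
    by blast
  interpret M: subring_set "mpolys F :: ('n \<times> 'n, 'a fls) mpoly set"
    by (rule F.subring_mpolys)
  interpret ev: subring_hom UNIV "ev Y" by (rule ev_hom)
  have "\<exists>J f. J \<subseteq> T \<and>
    (\<forall>j\<in>J. f j \<in> V \<and> (\<forall>i. i \<notin> T \<longrightarrow> f j i = 0) \<and> (\<forall>i. f j i \<in> gauss_ring) \<and>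
            (\<forall>i\<in>J. f j i = (if i = j then 1 else 0))) \<and>
    (\<forall>g\<in>V. (\<forall>i. i \<notin> T \<longrightarrow> g i = 0) \<longrightarrow> (\<forall>i. g i = (\<Sum>j\<in>J. g j * f j i)))"
  proof (rule pivot_basis[OF F.subfield_set_axioms gauss_ring.subring_set_axioms gauss_valuation
        _ _ _ T])
    fix u v assume "u \<in> V" "v \<in> V"
    then obtain a b where ab: "a \<in> relations Y" "b \<in> relations Y"
      "u = Poly_Mapping.lookup a" "v = Poly_Mapping.lookup b" by (auto simp: V_def)
    then have "a + b \<in> relations Y"
      by (auto simp: relations_def F.mpolys_add ev.hom_add)
    moreover have "(\<lambda>i. u i + v i) = Poly_Mapping.lookup (a + b)"
      using ab by (auto simp: lookup_add)
    ultimately show "(\<lambda>i. u i + v i) \<in> V" by (simp add: V_def)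
  next
    fix c u assume c: "c \<in> F" "u \<in> V"
    then obtain a where a: "a \<in> relations Y" "u = Poly_Mapping.lookup a" by (auto simp: V_def)
    then have "Cst c * a \<in> relations Y"
      using c by (auto simp: relations_def M.mult_closed F.Cst_mpolys ev.hom_mult)
    moreover have "(\<lambda>i. c * u i) = Poly_Mapping.lookup (Cst c * a)"
      using a by (auto simp: lookup_Cst_mult)
    ultimately show "(\<lambda>i. c * u i) \<in> V" by (simp add: V_def)
  qed (auto simp: V_def relations_def mpolys_def)
  then obtain J f where J: "J \<subseteq> T"
    and f: "\<forall>j\<in>J. f j \<in> V \<and> (\<forall>i. i \<notin> T \<longrightarrow> f j i = 0) \<and> (\<forall>i. f j i \<in> gauss_ring) \<and>
      (\<forall>i\<in>J. f j i = (if i = j then 1 else 0))"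
    and span: "\<forall>g\<in>V. (\<forall>i. i \<notin> T \<longrightarrow> g i = 0) \<longrightarrow> (\<forall>i. g i = (\<Sum>j\<in>J. g j * f j i))"
    by (elim exE conjE) (rule that)
  have finJ: "finite J" using J T finite_subset by blast
  \<comment> \<open>The coordinate formula is linear in \<open>w\<close>, so it passes from the
    relations to their combinations over K((t)).\<close>
  have span': "\<forall>i. w i = (\<Sum>j\<in>J. w j * f j i)"
    if "w \<in> lin_span UNIV {v \<in> V. \<forall>i. i \<notin> T \<longrightarrow> v i = 0}" for w
    using that
  proof induction
    case (add c v u)
    from add.hyps span have v: "\<forall>i. v i = (\<Sum>j\<in>J. v j * f j i)" by blast
    show ?case
    proof
      fix i
      have "c * v i + u i = c * (\<Sum>j\<in>J. v j * f j i) + (\<Sum>j\<in>J. u j * f j i)"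
        using v add.IH by metis
      then show "c * v i + u i = (\<Sum>j\<in>J. (c * v j + u j) * f j i)"
        by (simp add: sum_distrib_left distrib_right sum.distrib mult.assoc)
    qed
  qed simp
  have "w i = 0" if "w \<in> lin_span UNIV {v \<in> V. \<forall>i. i \<notin> T \<longrightarrow> v i = 0}" "i \<notin> T" for w i
    using that by induction auto
  from this[OF gT] have g_out: "Poly_Mapping.lookup g i = 0" if "i \<notin> T" for i
    using that .
  have "finite ((\<lambda>(j, i). f j i) ` (J \<times> T))" "(\<lambda>(j, i). f j i) ` (J \<times> T) \<subseteq> gauss_ring"
    using f finJ T by auto
  from common_denominator[OF this] obtain b where b: "b \<in> poly_series \<oo>" "s0 b \<noteq> 0"
    and bf': "\<And>j i. j \<in> J \<Longrightarrow> i \<in> T \<Longrightarrow> b * f j i \<in> poly_series \<oo>"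
    by auto
  have bf: "b * f j i \<in> poly_series \<oo>" if "j \<in> J" for i j
    using that bf' f P\<oo>.zero_closed by (cases "i \<in> T") auto
  have bfO: "b * f j i \<in> power_series_over \<O>" if "j \<in> J" for i j
    using bf[OF that] poly_series_\<oo>_\<O> by blast
  have bO: "b \<in> power_series_over \<O>" using b poly_series_\<oo>_\<O> by blast
  have gO: "Poly_Mapping.lookup g m \<in> power_series_over \<O>" for m
    using g(1) by (simp add: mpolys_def)
  \<comment> \<open>Multiplied by \<open>b\<close>, the coordinate formula has all its terms in
    \<O>[[t]] and can be specialized by \<alpha>. As \<open>b * f j m\<close> lies in \<oo>[t],
    \<alpha> may be replaced by \<beta> on it.\<close>
  have \<alpha>g: "\<alpha> b * \<alpha> (Poly_Mapping.lookup g m) =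
      (\<Sum>j\<in>J. \<alpha> (Poly_Mapping.lookup g j) * \<beta> (b * f j m))" for m
  proof -
    have "Poly_Mapping.lookup g m = (\<Sum>j\<in>J. Poly_Mapping.lookup g j * f j m)"
      using span'[OF gT] by blast
    then have "b * Poly_Mapping.lookup g m = b * (\<Sum>j\<in>J. Poly_Mapping.lookup g j * f j m)"
      by (rule arg_cong)
    also have "\<dots> = (\<Sum>j\<in>J. Poly_Mapping.lookup g j * (b * f j m))"
      by (simp add: sum_distrib_left mult_ac)
    finally have "b * Poly_Mapping.lookup g m = (\<Sum>j\<in>J. Poly_Mapping.lookup g j * (b * f j m))" .
    then have "\<alpha> (b * Poly_Mapping.lookup g m) = (\<Sum>j\<in>J. \<alpha> (Poly_Mapping.lookup g j) * \<alpha> (b * f j m))"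
      using gO bfO by (simp add: \<alpha>.hom_sum \<alpha>.hom_mult s0.mult_closed)
    then show ?thesis
      using bO gO bf \<alpha>_eq_\<beta> by (simp add: \<alpha>.hom_mult)
  qed
  let ?m = "\<lambda>Z. monom_at (\<lambda>(i, j). Z $ i $ j)"
  have mY: "?m Y m \<in> power_series_over \<O>" "\<beta> (?m Y m) = ?m (map_matrix \<beta> Y) m" for m
  proof -
    have "(\<lambda>v. \<beta> (case v of (i, j) \<Rightarrow> Y $ i $ j)) = (\<lambda>(i, j). map_matrix \<beta> Y $ i $ j)"
      by (auto simp: map_matrix_def)
    then show "?m Y m \<in> power_series_over \<O>" "\<beta> (?m Y m) = ?m (map_matrix \<beta> Y) m"
      using \<beta>.hom_monom_at[of "\<lambda>(i, j). Y $ i $ j" m] Y by (auto split: prod.splits)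
  qed
  have ev_T: "ev Z w = (\<Sum>m\<in>T. Poly_Mapping.lookup w m * ?m Z m)"
    if "\<And>i. i \<notin> T \<Longrightarrow> Poly_Mapping.lookup w i = 0" for Z and w :: "('n \<times> 'n, 'a fls) mpoly"
    unfolding ev_def using that T by (intro insertion_superset) (auto simp: in_keys_iff)
  have lookup_\<alpha>: "Poly_Mapping.lookup (mp_map \<alpha> g) m = \<alpha> (Poly_Mapping.lookup g m)" for m
    by (rule lookup_mp_map) (rule \<alpha>.hom_zero)
  \<comment> \<open>Each basis relation, multiplied by \<open>b\<close>, is specialized by \<beta>,
    its coefficients and \<open>Y\<close> alike.\<close>
  have vanish: "(\<Sum>m\<in>T. \<beta> (b * f j m) * ?m (map_matrix \<beta> Y) m) = 0" if j: "j \<in> J" for j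
  proof -
    obtain a where a: "a \<in> relations Y" "f j = Poly_Mapping.lookup a"
      using f j by (auto simp: V_def)
    have "ev Y a = (\<Sum>m\<in>T. f j m * ?m Y m)"
      unfolding a(2) using f j a(2) by (intro ev_T) auto
    then have "0 = b * (\<Sum>m\<in>T. f j m * ?m Y m)"
      using a(1) by (simp add: relations_def)
    also have "\<dots> = (\<Sum>m\<in>T. b * f j m * ?m Y m)"
      by (simp add: sum_distrib_left mult.assoc)
    finally have sum_0: "(\<Sum>m\<in>T. b * f j m * ?m Y m) = 0" by (rule sym)
    have "(\<Sum>m\<in>T. \<beta> (b * f j m) * \<beta> (?m Y m)) = \<beta> (\<Sum>m\<in>T. b * f j m * ?m Y m)"
      by (subst \<beta>.hom_sum)
        (simp_all only: bfO[OF j] mY(1) \<beta>.hom_mult s0.mult_closed)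
    then show ?thesis
      by (simp only: sum_0 \<beta>.hom_zero mY(2))
  qed
  have "\<alpha> b * ev (map_matrix \<beta> Y) (mp_map \<alpha> g) =
      (\<Sum>m\<in>T. (\<alpha> b * \<alpha> (Poly_Mapping.lookup g m)) * ?m (map_matrix \<beta> Y) m)"
    using g_out by (subst ev_T) (auto simp: lookup_\<alpha> \<alpha>.hom_zero sum_distrib_left mult.assoc)
  also have "\<dots> = (\<Sum>j\<in>J. \<alpha> (Poly_Mapping.lookup g j) *
      (\<Sum>m\<in>T. \<beta> (b * f j m) * ?m (map_matrix \<beta> Y) m))"
    unfolding \<alpha>g sum_distrib_left sum_distrib_right
    by (subst sum.swap) (simp add: mult.assoc)
  also have "\<dots> = 0" by (intro sum.neutral ballI) (simp only: vanish mult_zero_right)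
  \<comment> \<open>\<open>\<alpha> b\<close> can be cancelled: it is nonzero since
    \<open>s0\<close> and \<open>s1\<close> have the same zeros.\<close>
  finally show ?thesis
    using b(2) \<alpha>\<beta>(1) s1_eq_0_iff by auto
qed

text \<open>The polynomials \<open>f(Y X)\<close>, for \<open>f\<close> in the span of the relations, form a \<open>\<phi>\<close>-stable space
  and are therefore combinations of such polynomials with constant coefficients.\<close>

lemma relation_specializes:
  fixes D Di Y Yi :: "'a fls^'n::finite^'n"
  assumes \<alpha>\<beta>: "\<alpha> \<in> {s0, s1}" "\<beta> \<in> {s0, s1}"
    and Y: "\<And>i j. Y $ i $ j \<in> power_series_over \<O>" "\<And>i j. Yi $ i $ j \<in> power_series_over \<O>"
      "Y ** Yi = mat 1"
    and D: "\<And>i j. Di $ i $ j \<in> F" "D ** Di = mat 1"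
    and fund: "map_matrix \<phi> Y = Di ** Y" "map_matrix \<phi> Yi = Yi ** D"
    and f: "f \<in> relations Y"
  shows "ev (Y ** (map_matrix \<alpha> Yi ** map_matrix \<beta> Y)) f = 0"
proof -
  interpret \<alpha>: subring_hom "power_series_over \<O>" \<alpha>
    using \<alpha>\<beta>(1) s0.subring_hom_axioms s1.subring_hom_axioms by blast
  let ?A = "map_matrix \<alpha> Yi ** map_matrix \<beta> Y"
  let ?I = "relations Y"
  interpret mphi: subring_hom UNIV "mp_map \<phi> :: ('n \<times> 'n, 'a fls) mpoly \<Rightarrow> _"
    using frobenius.mp_map_hom by simp
  interpret subYi: subring_hom UNIV "left_sub Yi" by (rule left_sub_hom)
  interpret subDi: subring_hom UNIV "left_sub Di" by (rule left_sub_hom)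
  interpret evA: subring_hom UNIV "ev ?A" by (rule ev_hom)
  define J where "J = {g. left_sub Yi g \<in> mp_span ?I}"
  have lookup_\<phi>: "Poly_Mapping.lookup (mp_map \<phi> g) m = \<phi> (Poly_Mapping.lookup g m)"
    for g :: "('n \<times> 'n, 'a fls) mpoly" and m
    by (rule lookup_mp_map) (rule frobenius.hom_zero)
  \<comment> \<open>Applying \<phi> to v(Y) = 0 gives a relation at \<phi>(Y) = D^-1 Y, so inserting
    D^-1 X for X turns it into a relation at \<open>Y\<close> again; its coefficients stay in k(t)
    as the entries of D^-1 do.\<close>
  have I_stable: "left_sub Di (mp_map \<phi> v) \<in> ?I" if "v \<in> ?I" for v
  proof -
    have "mp_map \<phi> v \<in> mpolys F"
      using that frobenius_F by (auto simp: relations_def mpolys_def lookup_\<phi>)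
    moreover have "ev Y (left_sub Di (mp_map \<phi> v)) = \<phi> (ev Y v)"
      by (subst frobenius.hom_ev) (simp_all add: ev_left_sub fund)
    ultimately show ?thesis
      using that D(1) by (auto simp: relations_def frobenius.hom_zero intro!: F.left_sub_closed)
  qed
  have span_stable: "left_sub Di (mp_map \<phi> w) \<in> mp_span ?I" if "w \<in> mp_span ?I" for w
    using that
  proof (induction rule: mp_span_induct)
    case zero
    then show ?case using mp_span_zero by (simp add: mphi.hom_zero subDi.hom_zero)
  next
    case (add c v u)
    have "left_sub Di (mp_map \<phi> (Cst c * v + u)) =
        Cst (\<phi> c) * left_sub Di (mp_map \<phi> v) + left_sub Di (mp_map \<phi> u)"
      by (simp add: mphi.hom_add mphi.hom_mult subDi.hom_add subDi.hom_mult frobenius.mp_map_Cst left_sub_Cst)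
    then show ?case
      using mp_span_add[OF mp_span_scale[OF mp_span_base[OF I_stable[OF add.hyps(1)]]] add.IH] by simp
  qed
  \<comment> \<open>Under g \<mapsto> g(Y^-1 X) the twisted action on relations corresponds to the
    coefficientwise action of \<phi> on g: the D in \<phi>(Y^-1) = Y^-1 D cancels the D^-1 of the
    substitution.\<close>
  have J_stable: "mp_map \<phi> g \<in> J" if "g \<in> J" for g
  proof -
    have "left_sub Di (mp_map \<phi> (left_sub Yi g)) = left_sub Di (left_sub (Yi ** D) (mp_map \<phi> g))"
      by (subst frobenius.mp_map_left_sub) (simp_all add: fund)
    also have "\<dots> = left_sub Yi (mp_map \<phi> g)"
      by (simp add: left_sub_left_sub matrix_mul_assoc[symmetric] D(2) matrix_mul_rid)
    finally have eq: "left_sub Di (mp_map \<phi> (left_sub Yi g)) = left_sub Yi (mp_map \<phi> g)" .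
    show ?thesis
      using span_stable[of "left_sub Yi g"] that by (simp add: J_def eq)
  qed
  \<comment> \<open>This is f(Y X): inserting Y^-1 X returns \<open>f\<close>, and evaluation at
    \<open>?A\<close> gives f(Y A).\<close>
  define g0 where "g0 = left_sub Y f"
  have g0J: "g0 \<in> J"
    using mp_span_base[OF f] by (simp add: J_def g0_def left_sub_left_sub Y(3) left_sub_one)
  have "Poly_Mapping.lookup g0 \<in>
      lin_span UNIV {h \<in> Poly_Mapping.lookup ` J. \<forall>i. \<phi> (h i) = h i}"
  proof (rule descent)
    show "subfield_set (UNIV :: 'a fls set)" by unfold_locales auto
    fix u v assume "u \<in> Poly_Mapping.lookup ` J" "v \<in> Poly_Mapping.lookup ` J"
    then obtain a b where ab: "a \<in> J" "b \<in> J" "u = Poly_Mapping.lookup a" "v = Poly_Mapping.lookup b"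
      by auto
    then have "a + b \<in> J" using mp_span_add by (auto simp: J_def subYi.hom_add)
    moreover have "(\<lambda>i. u i + v i) = Poly_Mapping.lookup (a + b)"
      using ab by (auto simp: lookup_add)
    ultimately show "(\<lambda>i. u i + v i) \<in> Poly_Mapping.lookup ` J" by simp
  next
    fix c u assume "u \<in> Poly_Mapping.lookup ` J"
    then obtain a where a: "a \<in> J" "u = Poly_Mapping.lookup a" by auto
    then have "Cst c * a \<in> J"
      using mp_span_scale by (auto simp: J_def subYi.hom_mult left_sub_Cst)
    moreover have "(\<lambda>i. c * u i) = Poly_Mapping.lookup (Cst c * a)"
      using a by (auto simp: lookup_Cst_mult)
    ultimately show "(\<lambda>i. c * u i) \<in> Poly_Mapping.lookup ` J" by simp
  next
    fix u assume "u \<in> Poly_Mapping.lookup ` J"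
    then obtain a where a: "a \<in> J" "u = Poly_Mapping.lookup a" by auto
    moreover have "(\<lambda>i. \<phi> (u i)) = Poly_Mapping.lookup (mp_map \<phi> a)"
      using a by (auto simp: lookup_\<phi>)
    ultimately show "(\<lambda>i. \<phi> (u i)) \<in> Poly_Mapping.lookup ` J" using J_stable by simp
  qed (use g0J frobenius.subring_hom_axioms in auto)
  also have "{h \<in> Poly_Mapping.lookup ` J. \<forall>i. \<phi> (h i) = h i} =
      Poly_Mapping.lookup ` {h \<in> J. \<forall>i. \<phi> (Poly_Mapping.lookup h i) = Poly_Mapping.lookup h i}"
    by auto
  finally have "g0 \<in> mp_span {h \<in> J. \<forall>i. \<phi> (Poly_Mapping.lookup h i) = Poly_Mapping.lookup h i}"
    by simp
  then have "ev ?A g0 = 0"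
  proof (induction rule: mp_span_induct)
    case (add c h u)
    then have h: "h \<in> J" "\<And>i. Poly_Mapping.lookup h i \<in> laurent_series_over (GF q)"
      by (auto simp: fixed_iff)
    obtain N where N: "Cst (fls_X ^ N) * h \<in> mpolys (power_series_over (GF q))"
      using clear_denominators[of h "GF q"] h(2) by (auto simp: mpolys_def)
    define h' where "h' = Cst (fls_X ^ N) * h"
    from N have h'GF: "h' \<in> mpolys (power_series_over (GF q))"
      by (simp add: h'_def)
    have h'O: "h' \<in> mpolys (power_series_over \<O>)"
    proof -
      have "power_series_over (GF q) \<subseteq> power_series_over \<O>"
        using GF_\<oo> \<oo>_\<O> unfolding power_series_over_def by blast
      then show ?thesis using h'GF mpolys_mono by blast
    qed
    have "left_sub Yi h' \<in> mp_span ?I"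
      using h(1) mp_span_scale by (auto simp: h'_def J_def subYi.hom_mult left_sub_Cst)
    moreover have "left_sub Yi h' \<in> mpolys (power_series_over \<O>)"
      using Y(2) h'O by (intro s0.left_sub_closed)
    ultimately have "ev (map_matrix \<beta> Y) (mp_map \<alpha> (left_sub Yi h')) = 0"
      by (intro specialize_combination[OF \<alpha>\<beta> Y(1)])
    also have "mp_map \<alpha> (left_sub Yi h') = left_sub (map_matrix \<alpha> Yi) (mp_map \<alpha> h')"
      using Y(2) h'O by (rule \<alpha>.mp_map_left_sub)
    \<comment> \<open>Both specializations fix F_q[[t]], so \<open>h'\<close> itself is evaluated at
      the product of the two specialized matrices.\<close>
    also have "mp_map \<alpha> h' = h'"
    proof (rule poly_mapping_eqI)
      fix m
      have "Poly_Mapping.lookup h' m \<in> power_series_over (GF q)"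
        using h'GF by (simp add: mpolys_def)
      then show "Poly_Mapping.lookup (mp_map \<alpha> h') m = Poly_Mapping.lookup h' m"
        using \<alpha>\<beta>(1) s0_GF s1_GF by (auto simp: lookup_mp_map \<alpha>.hom_zero)
    qed
    finally have "ev ?A h' = 0" by (simp add: ev_left_sub)
    then have "ev ?A h = 0"
      by (simp add: h'_def evA.hom_mult)
    then show ?case
      using add.IH by (simp add: evA.hom_add evA.hom_mult)
  qed (simp add: evA.hom_zero)
  then show ?thesis by (simp add: g0_def ev_left_sub)
qed

end

section \<open>Tensor products of linearly disjoint subrings\<close>

text \<open>The additive extension of \<open>w\<close> to formal integer combinations; with w(r, s)
  = r s it is the multiplication map whose kernel is studied below.\<close>

definition frag_sum :: "('z \<Rightarrow> 'a::comm_ring_1) \<Rightarrow> ('z \<Rightarrow>\<^sub>0 int) \<Rightarrow> 'a" where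
  "frag_sum w x = (\<Sum>z\<in>Poly_Mapping.keys x. of_int (Poly_Mapping.lookup x z) * w z)"

lemma frag_sum_superset:
  assumes "finite T" "Poly_Mapping.keys x \<subseteq> T"
  shows "frag_sum w x = (\<Sum>z\<in>T. of_int (Poly_Mapping.lookup x z) * w z)"
  unfolding frag_sum_def using assms by (intro sum.mono_neutral_left) (auto simp: in_keys_iff)

lemma frag_sum_0 [simp]: "frag_sum w 0 = 0"
  by (simp add: frag_sum_def)

lemma frag_sum_of [simp]: "frag_sum w (frag_of z) = w z"
  by (simp add: frag_sum_def)

lemma frag_sum_diff: "frag_sum w (x - y) = frag_sum w x - frag_sum w y"
proof -
  let ?T = "Poly_Mapping.keys x \<union> Poly_Mapping.keys y"
  have "frag_sum w (x - y) = (\<Sum>z\<in>?T. of_int (Poly_Mapping.lookup (x - y) z) * w z)"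
    by (intro frag_sum_superset keys_diff) auto
  also have "\<dots> = (\<Sum>z\<in>?T. of_int (Poly_Mapping.lookup x z) * w z) -
      (\<Sum>z\<in>?T. of_int (Poly_Mapping.lookup y z) * w z)"
    by (simp add: lookup_minus left_diff_distrib sum_subtractf)
  also have "\<dots> = frag_sum w x - frag_sum w y"
    by (intro arg_cong2[where f = "(-)"] frag_sum_superset[symmetric]) auto
  finally show ?thesis .
qed

lemma frag_sum_add: "frag_sum w (x + y) = frag_sum w x + frag_sum w y"
  using frag_sum_diff[of w x "0 - y"] frag_sum_diff[of w 0 y] by simp

lemma frag_extend_fun_diff: "frag_extend (\<lambda>z. f z - g z) x = frag_extend f x - frag_extend g x"
  unfolding frag_extend_def
  by (rule poly_mapping_eqI)
    (simp add: lookup_sum lookup_minus right_diff_distrib sum_subtractf)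

lemma frag_times_of [simp]:
  "frag_times (frag_of p) (frag_of r) = frag_of (fst p * fst r, snd p * snd r)"
  by (simp add: frag_times_def split_def)

lemma frag_times_altdef:
  "frag_times x y = frag_extend (\<lambda>z. frag_extend (\<lambda>w. frag_of (fst z * fst w, snd z * snd w)) y) x"
  by (simp add: frag_times_def split_def)

lemma frag_times_diff_left: "frag_times (x - y) z = frag_times x z - frag_times y z"
  by (simp add: frag_times_def frag_extend_diff)

lemma frag_times_diff_right: "frag_times x (y - z) = frag_times x y - frag_times x z"
  by (simp add: frag_times_altdef frag_extend_diff frag_extend_fun_diff)

lemma frag_times_0 [simp]: "frag_times x 0 = 0" "frag_times 0 x = 0"
  using frag_times_diff_right[of x 0 0] frag_times_diff_left[of 0 0 x] by simp_all

lemma frag_times_add_left: "frag_times (x + y) z = frag_times x z + frag_times y z"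
  using frag_times_diff_left[of x "0 - y" z] frag_times_diff_left[of 0 y z] by simp

lemma frag_times_commute: "frag_times x y = frag_times y x"
proof (induction x rule: frag_induction[OF subset_UNIV, case_names zero one diff])
  case (one p)
  show ?case
    by (induction y rule: frag_induction[OF subset_UNIV, case_names zero one diff])
      (simp_all add: frag_times_diff_left frag_times_diff_right mult.commute)
qed (simp_all add: frag_times_diff_left frag_times_diff_right)

lemma frag_times_assoc: "frag_times (frag_times x y) z = frag_times x (frag_times y z)"
proof (induction x rule: frag_induction[OF subset_UNIV, case_names zero one diff])
  case (one p)
  show ?case
  proof (induction y rule: frag_induction[OF subset_UNIV, case_names zero one diff])
    case (one r)
    show ?case
      by (induction z rule: frag_induction[OF subset_UNIV, case_names zero one diff])
        (simp_all add: frag_times_diff_left frag_times_diff_right mult.assoc)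
  qed (simp_all add: frag_times_diff_left frag_times_diff_right)
qed (simp_all add: frag_times_diff_left frag_times_diff_right)

lemma frag_times_one: "frag_times (frag_of (1, 1)) x = x"
  by (induction x rule: frag_induction[OF subset_UNIV, case_names zero one diff]) (auto simp: frag_times_diff_right)

lemma keys_frag_times:
  fixes R S :: "'a::comm_ring_1 set"
  assumes "Poly_Mapping.keys x \<subseteq> R \<times> S" "Poly_Mapping.keys y \<subseteq> R \<times> S"
    and "subring_set R" "subring_set S"
  shows "Poly_Mapping.keys (frag_times x y) \<subseteq> R \<times> S"
proof -
  interpret R: subring_set R by fact
  interpret S: subring_set S by fact
  have diff: "Poly_Mapping.keys (a - b) \<subseteq> U"
    if "Poly_Mapping.keys a \<subseteq> U" "Poly_Mapping.keys b \<subseteq> U" for a b :: "('a \<times> 'a) \<Rightarrow>\<^sub>0 int" and U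
    using keys_diff[of a b] that by blast
  show ?thesis
    using assms(1)
  proof (induction x rule: frag_induction)
    case (one p)
    show ?case
      using assms(2)
    proof (induction y rule: frag_induction)
      case (one r)
      with \<open>p \<in> R \<times> S\<close> show ?case
        by (cases p, cases r) (auto simp: R.mult_closed S.mult_closed)
    qed (simp_all add: frag_times_diff_right diff)
  qed (simp_all add: frag_times_diff_left diff)
qed

text \<open>The last assumption is linear disjointness of \<open>R\<close> and \<open>S\<close> over
  the constants. Its index type of pairs fits the formal sums of pairs (r, s), whose terms serve as
  their own indices. Since \<phi> fixes \<open>S\<close>, the map \<phi> \<otimes> id becomes \<phi>
  itself once tensors are multiplied out.\<close>

locale difference_tensor = field_endo \<phi> + F: subfield_set F + R: subring_set R + S: subring_set S
  for \<phi> :: "'a::field \<Rightarrow> 'a" and F R S :: "'a set" +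
  assumes F_R: "F \<subseteq> R" and \<phi>_F: "x \<in> F \<Longrightarrow> \<phi> x \<in> F" and \<phi>_R: "x \<in> R \<Longrightarrow> \<phi> x \<in> R" and \<phi>_S: "s \<in> S \<Longrightarrow> \<phi> s = s"
    and constants_S: "constants \<phi> F \<subseteq> S"
    and linearly_disjoint: "\<And>(I :: ('a \<times> 'a) set) r s. finite I \<Longrightarrow>
      (\<And>i. i \<in> I \<Longrightarrow> r i \<in> R) \<Longrightarrow> (\<And>i. i \<in> I \<Longrightarrow> s i \<in> S) \<Longrightarrow> (\<Sum>i\<in>I. r i * s i) = 0 \<Longrightarrow>
      (\<exists>i\<in>I. r i \<noteq> 0) \<Longrightarrow>
      \<exists>c. (\<forall>i\<in>I. c i \<in> constants \<phi> F) \<and> (\<exists>i\<in>I. c i \<noteq> 0) \<and> (\<Sum>i\<in>I. c i * s i) = 0"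
begin

abbreviation C where "C \<equiv> constants \<phi> F"
abbreviation P where "P \<equiv> pair_ring R S"
abbreviation I where "I \<equiv> tensor_ideal C R S"
abbreviation T where "T \<equiv> tensor_ring C R S"
abbreviation \<tau> where "\<tau> \<equiv> pure_tensor C R S"

lemma carrier_P: "carrier P = {x. Poly_Mapping.keys x \<subseteq> R \<times> S}"
  by (auto simp: pair_ring_def)

lemma P_simps [simp]:
  "x \<otimes>\<^bsub>P\<^esub> y = frag_times x y" "\<one>\<^bsub>P\<^esub> = frag_of (1, 1)" "\<zero>\<^bsub>P\<^esub> = 0" "x \<oplus>\<^bsub>P\<^esub> y = x + y"
  by (simp_all add: pair_ring_def)

lemma P_diff: "x \<in> carrier P \<Longrightarrow> y \<in> carrier P \<Longrightarrow> x - y \<in> carrier P"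
  using keys_diff[of x y] by (auto simp: carrier_P)

lemma P_0: "0 \<in> carrier P"
  by (simp add: carrier_P)

lemma P_add: "x \<in> carrier P \<Longrightarrow> y \<in> carrier P \<Longrightarrow> x + y \<in> carrier P"
  using keys_add[of x y] by (auto simp: carrier_P)

lemma P_of: "r \<in> R \<Longrightarrow> s \<in> S \<Longrightarrow> frag_of (r, s) \<in> carrier P"
  by (simp add: carrier_P)

lemma P_mult: "x \<in> carrier P \<Longrightarrow> y \<in> carrier P \<Longrightarrow> frag_times x y \<in> carrier P"
  using keys_frag_times[OF _ _ R.subring_set_axioms S.subring_set_axioms] by (auto simp: carrier_P)

lemma cring_P: "cring P"
proof (rule cringI)
  show "abelian_group P"
  proof (rule abelian_groupI)
    show "\<exists>y\<in>carrier P. y \<oplus>\<^bsub>P\<^esub> x = \<zero>\<^bsub>P\<^esub>" if "x \<in> carrier P" for x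
      using P_diff[OF P_0 that] by (intro bexI[of _ "- x"]) auto
  qed (auto simp: P_add P_0 add_ac)
  show "Group.comm_monoid P"
    by (rule comm_monoidI)
      (auto simp: P_mult P_of R.one_closed S.one_closed frag_times_assoc frag_times_one
        intro: frag_times_commute)
qed (simp add: frag_times_add_left)

sublocale P: cring P by (rule cring_P)

lemma C_mult_R: "c \<in> C \<Longrightarrow> r \<in> R \<Longrightarrow> c * r \<in> R"
  using F_R by (auto simp: constants_def intro!: R.mult_closed)

lemma C_mult_S: "c \<in> C \<Longrightarrow> s \<in> S \<Longrightarrow> c * s \<in> S"
  using constants_S by (auto intro!: S.mult_closed)

lemma relations_subset: "tensor_relations C R S \<subseteq> carrier P"
  unfolding tensor_relations_def
  by (auto intro!: P_diff P_of R.add_closed S.add_closed C_mult_R C_mult_S)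

lemma ideal_I: "ideal I P"
  unfolding tensor_ideal_def by (rule P.genideal_ideal[OF relations_subset])

lemma relations_I: "tensor_relations C R S \<subseteq> I"
  unfolding tensor_ideal_def by (rule P.genideal_self[OF relations_subset])

sublocale I: ideal I P by (rule ideal_I)

lemma I_add: "x \<in> I \<Longrightarrow> y \<in> I \<Longrightarrow> x + y \<in> I"
  using I.a_closed by simp

lemma I_0: "0 \<in> I"
  using I.zero_closed by simp

lemma I_carrier: "x \<in> I \<Longrightarrow> x \<in> carrier P"
  using I.a_subset by blast

lemma I_minus: "x \<in> I \<Longrightarrow> - x \<in> I"
proof -
  assume x: "x \<in> I"
  have "\<ominus>\<^bsub>P\<^esub> x = - x"
    using I_carrier[OF x] P_diff[OF P_0 I_carrier[OF x]]
    by (intro P.minus_equality) auto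
  then show ?thesis using I.a_inv_closed[OF x] by simp
qed

lemma I_diff: "x \<in> I \<Longrightarrow> y \<in> I \<Longrightarrow> x - y \<in> I"
  using I_add[OF _ I_minus] by fastforce

lemma I_sum: "(\<And>i. i \<in> J \<Longrightarrow> f i \<in> I) \<Longrightarrow> sum f J \<in> I"
  by (induction J rule: infinite_finite_induct) (auto intro: I_add I_0)

lemma I_trans: "x - y \<in> I \<Longrightarrow> y - z \<in> I \<Longrightarrow> x - z \<in> I"
  using I_add[of "x - y" "y - z"] by simp

lemma I_tensor_add_left:
  "r \<in> R \<Longrightarrow> r' \<in> R \<Longrightarrow> s \<in> S \<Longrightarrow> frag_of (r + r', s) - (frag_of (r, s) + frag_of (r', s)) \<in> I"
  using relations_I unfolding tensor_relations_def diff_diff_add[symmetric] by blast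

lemma I_tensor_add_right:
  "r \<in> R \<Longrightarrow> s \<in> S \<Longrightarrow> s' \<in> S \<Longrightarrow> frag_of (r, s + s') - (frag_of (r, s) + frag_of (r, s')) \<in> I"
  using relations_I unfolding tensor_relations_def diff_diff_add[symmetric] by blast

lemma I_tensor_scale:
  "c \<in> C \<Longrightarrow> r \<in> R \<Longrightarrow> s \<in> S \<Longrightarrow> frag_of (c * r, s) - frag_of (r, c * s) \<in> I"
  using relations_I unfolding tensor_relations_def by blast

lemma I_tensor_zero_left: "s \<in> S \<Longrightarrow> frag_of (0, s) \<in> I"
  using I_minus[OF I_tensor_add_left[OF R.zero_closed R.zero_closed, of s]] by simp

lemma I_tensor_zero_right: "r \<in> R \<Longrightarrow> frag_of (r, 0) \<in> I"
  using I_minus[OF I_tensor_add_right[OF _ S.zero_closed S.zero_closed, of r]] by simp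

text \<open>The free abelian group brings integer coefficients; modulo the relations they can be
  absorbed into the left factor.\<close>

lemma I_tensor_of_int:
  assumes "r \<in> R" "s \<in> S"
  shows "frag_of (of_int n * r, s) - frag_cmul n (frag_of (r, s)) \<in> I"
proof (induction n rule: int_induct[of _ 0])
  case base
  then show ?case using I_tensor_zero_left[OF assms(2)] by simp
next
  case (step1 n)
  have "frag_of (of_int (n + 1) * r, s) - (frag_of (of_int n * r, s) + frag_of (r, s)) \<in> I"
    using I_tensor_add_left[of "of_int n * r" r s] assms
    by (simp add: distrib_right R.mult_closed R.of_int_closed)
  moreover have "(frag_of (of_int n * r, s) + frag_of (r, s)) - frag_cmul (n + 1) (frag_of (r, s)) \<in> I"
    using step1.IH by (simp add: frag_cmul_distrib)
  ultimately show ?case by (rule I_trans)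
next
  case (step2 n)
  have "frag_of (of_int n * r, s) - (frag_of (of_int (n - 1) * r, s) + frag_of (r, s)) \<in> I"
    using I_tensor_add_left[of "of_int (n - 1) * r" r s] assms
    by (simp add: left_diff_distrib R.diff_closed R.mult_closed R.of_int_closed)
  moreover have "(A - frag_cmul n x) - (A - (a + x)) = a - frag_cmul (n - 1) x"
    for A a x :: "('a \<times> 'a) \<Rightarrow>\<^sub>0 int"
    by (simp add: frag_cmul_diff_distrib)
  ultimately show ?case using I_diff[OF step2.IH] by metis
qed

lemma I_tensor_sum_right:
  assumes "r \<in> R" "\<And>i. i \<in> J \<Longrightarrow> s i \<in> S"
  shows "frag_of (r, \<Sum>i\<in>J. s i) - (\<Sum>i\<in>J. frag_of (r, s i)) \<in> I"
  using assms(2)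
proof (induction J rule: infinite_finite_induct)
  case (insert i J)
  have "frag_of (r, s i + sum s J) - (frag_of (r, s i) + frag_of (r, sum s J)) \<in> I"
    using insert by (intro I_tensor_add_right assms(1) S.sum_closed) auto
  moreover have "(frag_of (r, s i) + frag_of (r, sum s J)) -
      (frag_of (r, s i) + (\<Sum>i\<in>J. frag_of (r, s i))) \<in> I"
    using insert by simp
  ultimately have "frag_of (r, s i + sum s J) - (frag_of (r, s i) + (\<Sum>i\<in>J. frag_of (r, s i))) \<in> I"
    by (rule I_trans)
  then show ?case using insert by simp
qed (use I_tensor_zero_right[OF assms(1)] in auto)

abbreviation mulmap :: "('a \<Rightarrow> 'a) \<Rightarrow> (('a \<times> 'a) \<Rightarrow>\<^sub>0 int) \<Rightarrow> 'a" where
  "mulmap \<alpha> \<equiv> frag_sum (\<lambda>z. \<alpha> (fst z) * snd z)"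

lemma mulmap_mult:
  assumes "subring_hom R \<alpha>" "x \<in> carrier P" "y \<in> carrier P"
  shows "mulmap \<alpha> (frag_times x y) = mulmap \<alpha> x * mulmap \<alpha> y"
proof -
  interpret \<alpha>: subring_hom R \<alpha> by fact
  from assms(2) have "Poly_Mapping.keys x \<subseteq> R \<times> S" by (simp add: carrier_P)
  then show ?thesis
  proof (induction x rule: frag_induction)
    case (one p)
    from assms(3) have "Poly_Mapping.keys y \<subseteq> R \<times> S" by (simp add: carrier_P)
    then show ?case
    proof (induction y rule: frag_induction)
      case (one r)
      with \<open>p \<in> R \<times> S\<close> show ?case
        by (cases p, cases r) (auto simp: \<alpha>.hom_mult mult_ac)
    qed (simp_all add: frag_times_diff_right frag_sum_diff right_diff_distrib)
  qed (simp_all add: frag_times_diff_left frag_sum_diff left_diff_distrib)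
qed

text \<open>The kernel of (r, s) \<mapsto> \<alpha>(r) s is an ideal containing the bilinearity
  relations; the relation that moves a constant across the tensor sign needs \<alpha> to fix
  it.\<close>

lemma mulmap_I:
  assumes "subring_hom R \<alpha>" "\<And>c. c \<in> C \<Longrightarrow> \<alpha> c = c" "x \<in> I"
  shows "mulmap \<alpha> x = 0"
proof -
  interpret \<alpha>: subring_hom R \<alpha> by fact
  let ?K = "{x \<in> carrier P. mulmap \<alpha> x = 0}"
  have C_R: "c \<in> R" if "c \<in> C" for c
    using that F_R by (auto simp: constants_def)
  have "ideal ?K P"
  proof (rule idealI)
    show "Ring.ring P" by (rule P.ring_axioms)
    show "subgroup ?K (add_monoid P)"
    proof (rule group.subgroupI)
      show "Group.group (add_monoid P)" using P.a_group .
      show "?K \<noteq> {}" using P_0 by force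
      fix a assume a: "a \<in> ?K"
      have "inv\<^bsub>add_monoid P\<^esub> a = - a"
      proof -
        have "\<ominus>\<^bsub>P\<^esub> a = - a"
          using a P_diff[OF P_0, of a] by (intro P.minus_equality) auto
        then show ?thesis by (simp add: a_inv_def)
      qed
      then show "inv\<^bsub>add_monoid P\<^esub> a \<in> ?K"
        using a P_diff[OF P_0, of a] frag_sum_diff[of "\<lambda>z. \<alpha> (fst z) * snd z" 0 a] by auto
    qed (auto simp: P_add frag_sum_add)
  qed (auto simp: P_mult mulmap_mult[OF assms(1)])
  moreover have "tensor_relations C R S \<subseteq> ?K"
  proof
    fix x assume x: "x \<in> tensor_relations C R S"
    then have "mulmap \<alpha> x = 0"
      using assms(2) C_R unfolding tensor_relations_def
      by (elim UnE CollectE exE conjE)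
        (simp_all add: frag_sum_diff \<alpha>.hom_add \<alpha>.hom_mult distrib_left distrib_right mult_ac)
    with x relations_subset show "x \<in> ?K" by blast
  qed
  ultimately have "I \<subseteq> ?K"
    unfolding tensor_ideal_def by (rule P.genideal_minimal)
  with assms(3) show ?thesis by blast
qed

abbreviation \<mu> where "\<mu> \<equiv> mulmap (\<lambda>x. x)"

lemma id_R: "subring_hom R (\<lambda>x. x)"
  by unfold_locales simp_all

text \<open>A nontrivial relation \<open>\<Sum>i. r i * s i = 0\<close> makes the \<open>s i\<close> linearly dependent over the
  constants, which allows to shorten the tensor.\<close>

lemma sum_tensor_I:
  assumes "finite J" "\<And>i. i \<in> J \<Longrightarrow> r i \<in> R" "\<And>i. i \<in> J \<Longrightarrow> s i \<in> S"
    and "(\<Sum>i\<in>J. r i * s i) = 0"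
  shows "(\<Sum>i\<in>J. frag_of (r i, s (i :: 'a \<times> 'a))) \<in> I"
  using assms
proof (induction "card J" arbitrary: J r rule: less_induct)
  case less
  show ?case
  proof (cases "\<exists>i\<in>J. r i \<noteq> 0")
    case False
    then show ?thesis
      using less.prems by (intro I_sum) (simp add: I_tensor_zero_left)
  next
    case True
    from linearly_disjoint[OF less.prems True] obtain c l
      where c: "\<And>i. i \<in> J \<Longrightarrow> c i \<in> C" "(\<Sum>i\<in>J. c i * s i) = 0" and l: "l \<in> J" "c l \<noteq> 0"
      by blast
    let ?J = "J - {l}"
    define e where "e i = - (c i / c l)" for i
    have e: "e i \<in> C" if "i \<in> J" for i
      using c(1)[OF that] c(1)[OF l(1)]
      by (auto simp: e_def constants_def divide hom_uminus F.uminus_closed F.divide_closed)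
    have "c l * s l + (\<Sum>i\<in>?J. c i * s i) = 0"
      using c(2) less.prems(1) l(1) by (simp add: sum.remove)
    then have "s l = - (\<Sum>i\<in>?J. c i * s i) / c l"
      using l(2) by (simp add: field_simps add_eq_0_iff)
    then have sl: "s l = (\<Sum>i\<in>?J. e i * s i)"
      by (simp add: e_def sum_divide_distrib sum_negf)
    have "frag_of (r l, s l) - (\<Sum>i\<in>?J. frag_of (r l, e i * s i)) \<in> I"
      unfolding sl using less.prems l e by (intro I_tensor_sum_right C_mult_S) auto
    moreover have "(\<Sum>i\<in>?J. frag_of (r l, e i * s i)) - (\<Sum>i\<in>?J. frag_of (e i * r l, s i)) \<in> I"
      unfolding sum_subtractf[symmetric]
    proof (rule I_sum)
      fix i assume "i \<in> ?J"
      then show "frag_of (r l, e i * s i) - frag_of (e i * r l, s i) \<in> I"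
        using I_minus[OF I_tensor_scale[of "e i" "r l" "s i"]] less.prems l e by simp
    qed
    ultimately have 1: "frag_of (r l, s l) - (\<Sum>i\<in>?J. frag_of (e i * r l, s i)) \<in> I"
      by (rule I_trans)
    \<comment> \<open>With \<open>s l\<close> eliminated, the l-th term is distributed over the
      others, and the tensor becomes the sum of the (r i + e i r l) \<otimes> s i over the remaining
      indices.\<close>
    have 2: "(\<Sum>i\<in>?J. frag_of (r i + e i * r l, s i)) -
        (\<Sum>i\<in>?J. frag_of (r i, s i) + frag_of (e i * r l, s i)) \<in> I"
      unfolding sum_subtractf[symmetric]
      using less.prems l e by (intro I_sum I_tensor_add_left C_mult_R) auto
    have 3: "(\<Sum>i\<in>?J. frag_of (r i + e i * r l, s i)) \<in> I"
    proof (rule less.hyps)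
      show "card ?J < card J" using less.prems(1) l(1) by (intro psubset_card_mono) auto
      have "(\<Sum>i\<in>?J. (r i + e i * r l) * s i) = (\<Sum>i\<in>?J. r i * s i) + r l * s l"
        by (simp add: sl sum_distrib_left algebra_simps sum.distrib)
      also have "\<dots> = (\<Sum>i\<in>J. r i * s i)"
        using less.prems(1) l(1) by (simp add: sum.remove add.commute)
      finally show "(\<Sum>i\<in>?J. (r i + e i * r l) * s i) = 0"
        using less.prems(4) by simp
      show "r i + e i * r l \<in> R" if "i \<in> ?J" for i
        using that less.prems(2) l(1) e by (intro R.add_closed C_mult_R) auto
    qed (use less.prems in auto)
    have "(\<Sum>i\<in>J. frag_of (r i, s i)) = frag_of (r l, s l) + (\<Sum>i\<in>?J. frag_of (r i, s i))"
      using less.prems(1) l(1) by (simp add: sum.remove)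
    also have "\<dots> = (frag_of (r l, s l) - (\<Sum>i\<in>?J. frag_of (e i * r l, s i))) -
        ((\<Sum>i\<in>?J. frag_of (r i + e i * r l, s i)) -
          (\<Sum>i\<in>?J. frag_of (r i, s i) + frag_of (e i * r l, s i))) +
        (\<Sum>i\<in>?J. frag_of (r i + e i * r l, s i))"
      by (simp add: sum.distrib)
    also have "\<dots> \<in> I"
      by (intro I_add I_diff 1 2 3)
    finally show ?thesis .
  qed
qed

text \<open>Absorbing the integer coefficients makes x a sum of pure tensors modulo
  \<open>I\<close>, and \<open>sum_tensor_I\<close> puts that sum into \<open>I\<close> if its value
  is 0. Hence R \<otimes> S embeds into the field as the subring \<open>RS\<close>.\<close>

lemma I_eq_kernel: "x \<in> I \<longleftrightarrow> x \<in> carrier P \<and> \<mu> x = 0"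
proof (intro iffI conjI)
  assume x: "x \<in> carrier P \<and> \<mu> x = 0"
  let ?K = "Poly_Mapping.keys x"
  let ?y = "\<Sum>z\<in>?K. frag_of (of_int (Poly_Mapping.lookup x z) * fst z, snd z)"
  have K: "fst z \<in> R" "snd z \<in> S" if "z \<in> ?K" for z
    using x that by (auto simp: carrier_P)
  have "?y \<in> I"
  proof (rule sum_tensor_I)
    show "(\<Sum>z\<in>?K. of_int (Poly_Mapping.lookup x z) * fst z * snd z) = 0"
      using x by (simp add: frag_sum_def mult.assoc)
  qed (auto simp: K R.mult_closed R.of_int_closed)
  moreover have "?y - x \<in> I"
  proof -
    have "x = (\<Sum>z\<in>?K. frag_cmul (Poly_Mapping.lookup x z) (frag_of z))"
      using frag_expansion[of x] unfolding frag_extend_def .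
    from arg_cong[OF this, of "\<lambda>t. ?y - t"]
    have "?y - x = (\<Sum>z\<in>?K. frag_of (of_int (Poly_Mapping.lookup x z) * fst z, snd z) -
        frag_cmul (Poly_Mapping.lookup x z) (frag_of (fst z, snd z)))"
      by (simp add: sum_subtractf)
    also have "\<dots> \<in> I"
      by (intro I_sum I_tensor_of_int K)
    finally show ?thesis .
  qed
  ultimately show "x \<in> I"
    using I_diff[of ?y "?y - x"] by simp
qed (use I_carrier mulmap_I[OF id_R] in auto)

abbreviation RS where "RS \<equiv> \<mu> ` carrier P"

text \<open>The tensor ideal is the kernel of \<open>\<mu>\<close>, so the elements of \<open>R \<otimes>\<^sub>C S\<close> are the fibres of \<open>\<mu>\<close>.\<close>

definition fib :: "'a \<Rightarrow> (('a \<times> 'a) \<Rightarrow>\<^sub>0 int) set" where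
  "fib u = {x \<in> carrier P. \<mu> x = u}"

lemma coset_eq_fib:
  assumes "x \<in> carrier P"
  shows "I +>\<^bsub>P\<^esub> x = fib (\<mu> x)"
proof
  show "I +>\<^bsub>P\<^esub> x \<subseteq> fib (\<mu> x)"
    using assms by (auto simp: a_r_coset_def' fib_def frag_sum_add I_eq_kernel intro: P_add)
  show "fib (\<mu> x) \<subseteq> I +>\<^bsub>P\<^esub> x"
  proof
    fix y assume y: "y \<in> fib (\<mu> x)"
    then have "y - x \<in> I"
      using assms by (auto simp: fib_def I_eq_kernel frag_sum_diff intro: P_diff)
    then have "\<exists>h\<in>I. y = h + x"
      by (intro bexI[of _ "y - x"]) auto
    then show "y \<in> I +>\<^bsub>P\<^esub> x" by (auto simp: a_r_coset_def')
  qed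
qed

lemma T_simps: "T = \<lparr>carrier = a_rcosets\<^bsub>P\<^esub> I, monoid.mult = rcoset_mult P I,
    one = I +>\<^bsub>P\<^esub> \<one>\<^bsub>P\<^esub>, ring.zero = I, add = set_add P\<rparr>"
  by (simp add: tensor_ring_def FactRing_def)

lemma carrier_T: "carrier T = fib ` RS"
  by (auto simp: T_simps A_RCOSETS_def' coset_eq_fib)

lemma T_mult:
  assumes "u \<in> RS" "v \<in> RS"
  shows "fib u \<otimes>\<^bsub>T\<^esub> fib v = fib (u * v)"
proof -
  obtain x y where xy: "x \<in> carrier P" "u = \<mu> x" "y \<in> carrier P" "v = \<mu> y"
    using assms by auto
  have "fib u \<otimes>\<^bsub>T\<^esub> fib v = I +>\<^bsub>P\<^esub> (x \<otimes>\<^bsub>P\<^esub> y)"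
    using I.rcoset_mult_add[OF xy(1,3)] by (simp add: T_simps xy coset_eq_fib)
  also have "\<dots> = fib (u * v)"
    using xy by (simp add: coset_eq_fib P_mult mulmap_mult[OF id_R])
  finally show ?thesis .
qed

lemma T_add:
  assumes "u \<in> RS" "v \<in> RS"
  shows "fib u \<oplus>\<^bsub>T\<^esub> fib v = fib (u + v)"
proof -
  obtain x y where xy: "x \<in> carrier P" "u = \<mu> x" "y \<in> carrier P" "v = \<mu> y"
    using assms by auto
  have "fib u \<oplus>\<^bsub>T\<^esub> fib v = I +>\<^bsub>P\<^esub> (x \<oplus>\<^bsub>P\<^esub> y)"
    using I.a_rcos_sum[OF xy(1,3)] by (simp add: T_simps xy coset_eq_fib)
  also have "\<dots> = fib (u + v)"
    using xy by (simp add: coset_eq_fib P_add frag_sum_add)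
  finally show ?thesis .
qed

lemma T_one: "\<one>\<^bsub>T\<^esub> = fib 1"
  by (simp add: T_simps coset_eq_fib P_of R.one_closed S.one_closed)

lemma T_zero: "\<zero>\<^bsub>T\<^esub> = fib 0"
  by (auto simp: T_simps fib_def I_eq_kernel)

lemma pure_tensor_eq_fib: "r \<in> R \<Longrightarrow> s \<in> S \<Longrightarrow> \<tau> r s = fib (r * s)"
  by (simp add: pure_tensor_def coset_eq_fib P_of)

lemma mult_RS: "r \<in> R \<Longrightarrow> s \<in> S \<Longrightarrow> r * s \<in> RS"
  using P_of[of r s] by (force intro: image_eqI[of _ _ "frag_of (r, s)"])

lemma R_RS: "r \<in> R \<Longrightarrow> r \<in> RS"
  using mult_RS[OF _ S.one_closed] by simp

lemma S_RS: "s \<in> S \<Longrightarrow> s \<in> RS"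
  using mult_RS[OF R.one_closed] by simp

sublocale RS: subring_set RS
proof
  show "1 \<in> RS" by (rule R_RS) (rule R.one_closed)
  fix u assume "u \<in> RS"
  then obtain x where x: "x \<in> carrier P" "u = \<mu> x" by auto
  then show "- u \<in> RS"
    using P_diff[OF P_0 x(1)] frag_sum_diff[of "\<lambda>z. fst z * snd z" 0 x]
    by (intro image_eqI[of _ _ "- x"]) auto
  fix v assume "v \<in> RS"
  then obtain y where y: "y \<in> carrier P" "v = \<mu> y" by auto
  show "u + v \<in> RS"
    using x y P_add by (intro image_eqI[of _ _ "x + y"]) (auto simp: frag_sum_add)
  show "u * v \<in> RS"
    using x y P_mult by (intro image_eqI[of _ _ "frag_times x y"]) (auto simp: mulmap_mult[OF id_R])
qed

lemma fib_inj: "u \<in> RS \<Longrightarrow> fib u = fib v \<Longrightarrow> u = v"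
  by (auto simp: fib_def)

lemma ring_T: "Ring.ring T"
  unfolding tensor_ring_def by (rule I.quotient_is_ring)

lemma T_finsum:
  assumes "finite J" "\<And>j. j \<in> J \<Longrightarrow> u j \<in> RS"
  shows "(\<Oplus>\<^bsub>T\<^esub>j\<in>J. fib (u j)) = fib (\<Sum>j\<in>J. u j)"
proof -
  interpret T: Ring.ring T by (rule ring_T)
  show ?thesis
    using assms
  proof (induction J rule: finite_induct)
    case (insert j J)
    then have "(\<Oplus>\<^bsub>T\<^esub>j\<in>insert j J. fib (u j)) = fib (u j) \<oplus>\<^bsub>T\<^esub> (\<Oplus>\<^bsub>T\<^esub>j\<in>J. fib (u j))"
      by (intro T.finsum_insert) (auto simp: carrier_T)
    also have "\<dots> = fib (u j + (\<Sum>j\<in>J. u j))"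
      using insert by (simp add: T_add RS.sum_closed)
    finally show ?case using insert by simp
  qed (simp add: T_zero)
qed

lemma \<phi>_tensor:
  assumes "x \<in> carrier P"
  shows "frag_extend (\<lambda>z. frag_of (\<phi> (fst z), snd z)) x \<in> carrier P \<and>
    \<mu> (frag_extend (\<lambda>z. frag_of (\<phi> (fst z), snd z)) x) = \<phi> (\<mu> x)"
proof -
  have "Poly_Mapping.keys x \<subseteq> R \<times> S" using assms by (simp add: carrier_P)
  then show ?thesis
  proof (induction x rule: frag_induction)
    case zero
    show ?case using P_0 hom_zero by simp
  next
    case (one p)
    then show ?case by (cases p) (auto simp: P_of \<phi>_R \<phi>_S mult)
  next
    case (diff a b)
    then show ?case by (simp add: frag_extend_diff P_diff frag_sum_diff hom_diff)
  qed
qed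

lemma tensor_endo_fib:
  assumes "u \<in> RS"
  shows "tensor_endo C R S \<phi> (fib u) = fib (\<phi> u)"
proof -
  have "I +>\<^bsub>P\<^esub> frag_extend (\<lambda>z. frag_of (\<phi> (fst z), snd z)) x = fib (\<phi> u)" if "x \<in> fib u" for x
    using that \<phi>_tensor[of x] by (simp add: fib_def coset_eq_fib)
  moreover have "fib u \<noteq> {}" using assms by (auto simp: fib_def)
  ultimately show ?thesis unfolding tensor_endo_def by auto
qed

lemma \<phi>_RS: "u \<in> RS \<Longrightarrow> \<phi> u \<in> RS"
proof (elim imageE)
  fix x assume "x \<in> carrier P" "u = \<mu> x"
  then show "\<phi> u \<in> RS"
    using \<phi>_tensor[of x]
    by (intro image_eqI[of _ _ "frag_extend (\<lambda>z. frag_of (\<phi> (fst z), snd z)) x"]) auto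
qed

text \<open>This is \<alpha> \<otimes> id read on \<open>RS\<close>. Two formal sums with the same
  value under \<mu> differ by an element of \<open>I\<close>, on which
  \<open>mulmap \<alpha>\<close> vanishes, so the chosen preimage does not matter.\<close>

lemma extend_hom:
  assumes "subring_hom R \<alpha>" "\<And>c. c \<in> C \<Longrightarrow> \<alpha> c = c"
  obtains \<theta> where "subring_hom RS \<theta>" "\<And>r. r \<in> R \<Longrightarrow> \<theta> r = \<alpha> r" "\<And>s. s \<in> S \<Longrightarrow> \<theta> s = s"
proof -
  interpret \<alpha>: subring_hom R \<alpha> by fact
  define \<theta> where "\<theta> u = mulmap \<alpha> (SOME x. x \<in> fib u)" for u
  have \<theta>: "\<theta> (\<mu> x) = mulmap \<alpha> x" if x: "x \<in> carrier P" for x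
  proof -
    have "(SOME y. y \<in> fib (\<mu> x)) \<in> fib (\<mu> x)"
      by (rule someI[of _ x]) (simp add: fib_def x)
    then have "(SOME y. y \<in> fib (\<mu> x)) - x \<in> I"
      using x P_diff by (auto simp: I_eq_kernel fib_def frag_sum_diff)
    from mulmap_I[OF assms this] show ?thesis
      by (simp add: \<theta>_def frag_sum_diff)
  qed
  have prod: "\<theta> (r * s) = \<alpha> r * s" if "r \<in> R" "s \<in> S" for r s
    using \<theta>[OF P_of[OF that]] by simp
  show thesis
  proof
    show "subring_hom RS \<theta>"
    proof
      show "\<theta> 1 = 1"
        using prod[OF R.one_closed S.one_closed] by (simp add: \<alpha>.hom_one)
      fix u v assume "u \<in> RS" "v \<in> RS"
      then obtain x y where xy: "x \<in> carrier P" "u = \<mu> x" "y \<in> carrier P" "v = \<mu> y" by auto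
      have "\<theta> (u + v) = mulmap \<alpha> (x + y)"
        using \<theta>[OF P_add[OF xy(1,3)]] xy by (simp add: frag_sum_add)
      then show "\<theta> (u + v) = \<theta> u + \<theta> v"
        using xy \<theta> by (simp add: frag_sum_add)
      have "\<theta> (u * v) = mulmap \<alpha> (frag_times x y)"
        using \<theta>[OF P_mult[OF xy(1,3)]] xy by (simp add: mulmap_mult[OF id_R])
      then show "\<theta> (u * v) = \<theta> u * \<theta> v"
        using xy \<theta> by (simp add: mulmap_mult[OF assms(1)])
    qed
    show "\<theta> r = \<alpha> r" if "r \<in> R" for r using prod[OF that S.one_closed] by simp
    show "\<theta> s = s" if "s \<in> S" for s using prod[OF R.one_closed that] by (simp add: \<alpha>.hom_one)
  qed
qed

lemma RS_induct [consumes 1, case_names mult zero diff]: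
  assumes "u \<in> RS" "\<And>r s. r \<in> R \<Longrightarrow> s \<in> S \<Longrightarrow> Q (r * s)" "Q 0"
    "\<And>a b. a \<in> RS \<Longrightarrow> b \<in> RS \<Longrightarrow> Q a \<Longrightarrow> Q b \<Longrightarrow> Q (a - b)"
  shows "Q u"
proof -
  obtain x where x: "Poly_Mapping.keys x \<subseteq> R \<times> S" "u = \<mu> x"
    using assms(1) by (auto simp: carrier_P)
  from x(1) have "\<mu> x \<in> RS \<and> Q (\<mu> x)"
  proof (induction x rule: frag_induction)
    case zero
    then show ?case using assms(3) RS.zero_closed by simp
  next
    case (one p)
    then show ?case using assms(2) mult_RS by (cases p) auto
  next
    case (diff a b)
    then show ?case using assms(4) RS.diff_closed by (simp add: frag_sum_diff)
  qed
  with x show ?thesis by simp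
qed

lemma RS_hom_eqI:
  assumes "subring_hom RS \<theta>" "subring_hom RS \<theta>'" "u \<in> RS"
    and "\<And>r. r \<in> R \<Longrightarrow> \<theta> r = \<theta>' r" "\<And>s. s \<in> S \<Longrightarrow> \<theta> s = \<theta>' s"
  shows "\<theta> u = \<theta>' u"
proof -
  interpret \<theta>: subring_hom RS \<theta> by fact
  interpret \<theta>': subring_hom RS \<theta>' by fact
  show ?thesis
    using assms(3)
    by (induction rule: RS_induct)
      (simp_all add: assms(4,5) \<theta>.hom_mult \<theta>'.hom_mult R_RS S_RS \<theta>.hom_zero \<theta>'.hom_zero
        \<theta>.hom_diff \<theta>'.hom_diff)
qed

lemma hom_closed_RS:
  assumes "subring_hom RS \<theta>" "u \<in> RS"
    and "\<And>r. r \<in> R \<Longrightarrow> \<theta> r \<in> RS" "\<And>s. s \<in> S \<Longrightarrow> \<theta> s \<in> RS"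
  shows "\<theta> u \<in> RS"
proof -
  interpret \<theta>: subring_hom RS \<theta> by fact
  show ?thesis
    using assms(2)
    by (induction rule: RS_induct)
      (simp_all add: assms(3,4) \<theta>.hom_mult R_RS S_RS \<theta>.hom_zero \<theta>.hom_diff RS.zero_closed
        RS.diff_closed RS.mult_closed del: image_iff)
qed

text \<open>\<open>fib\<close> is an isomorphism from \<open>RS\<close> to the tensor ring that
  turns \<phi> into \<phi> \<otimes> id; \<sigma> is \<theta> transported along it, and \<theta>'
  provides bijectivity.\<close>

lemma tensor_automorphism:
  assumes \<theta>: "subring_hom RS \<theta>" "\<And>u. u \<in> RS \<Longrightarrow> \<theta> u \<in> RS" "\<And>u. u \<in> RS \<Longrightarrow> \<theta>' u \<in> RS"
    and inv: "\<And>u. u \<in> RS \<Longrightarrow> \<theta>' (\<theta> u) = u" "\<And>u. u \<in> RS \<Longrightarrow> \<theta> (\<theta>' u) = u"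
    and fixed: "\<And>a. a \<in> F \<Longrightarrow> \<theta> a = a" "\<And>s. s \<in> S \<Longrightarrow> \<theta> s = s"
    and comm: "\<And>u. u \<in> RS \<Longrightarrow> \<theta> (\<phi> u) = \<phi> (\<theta> u)"
  shows "\<exists>\<sigma>\<in>difference_automorphisms F \<phi> R S. \<forall>u\<in>RS. \<sigma> (fib u) = fib (\<theta> u)"
proof -
  interpret \<theta>: subring_hom RS \<theta> by fact
  define \<sigma> where "\<sigma> W = fib (\<theta> (\<mu> (SOME x. x \<in> W)))" for W
  have \<sigma>: "\<sigma> (fib u) = fib (\<theta> u)" if "u \<in> RS" for u
  proof -
    have "\<exists>x. x \<in> fib u" using that by (auto simp: fib_def)
    then have "(SOME x. x \<in> fib u) \<in> fib u" by (rule someI_ex)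
    then have "\<mu> (SOME x. x \<in> fib u) = u" by (simp add: fib_def)
    then show ?thesis by (simp add: \<sigma>_def)
  qed
  have "\<sigma> \<in> ring_hom T T"
  proof (rule ring_hom_memI)
    fix W V assume "W \<in> carrier T" "V \<in> carrier T"
    then obtain u v where uv: "u \<in> RS" "W = fib u" "v \<in> RS" "V = fib v"
      unfolding carrier_T by blast
    show "\<sigma> W \<in> carrier T"
      unfolding carrier_T uv(2) \<sigma>[OF uv(1)] by (intro imageI \<theta>(2) uv)
    show "\<sigma> (W \<otimes>\<^bsub>T\<^esub> V) = \<sigma> W \<otimes>\<^bsub>T\<^esub> \<sigma> V"
      unfolding uv(2,4) T_mult[OF uv(1,3)] \<sigma>[OF uv(1)] \<sigma>[OF uv(3)] \<sigma>[OF RS.mult_closed[OF uv(1,3)]]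
        T_mult[OF \<theta>(2)[OF uv(1)] \<theta>(2)[OF uv(3)]] \<theta>.hom_mult[OF uv(1,3)] ..
    show "\<sigma> (W \<oplus>\<^bsub>T\<^esub> V) = \<sigma> W \<oplus>\<^bsub>T\<^esub> \<sigma> V"
      unfolding uv(2,4) T_add[OF uv(1,3)] \<sigma>[OF uv(1)] \<sigma>[OF uv(3)] \<sigma>[OF RS.add_closed[OF uv(1,3)]]
        T_add[OF \<theta>(2)[OF uv(1)] \<theta>(2)[OF uv(3)]] \<theta>.hom_add[OF uv(1,3)] ..
  next
    show "\<sigma> \<one>\<^bsub>T\<^esub> = \<one>\<^bsub>T\<^esub>"
      unfolding T_one \<sigma>[OF RS.one_closed] \<theta>.hom_one ..
  qed
  moreover have "bij_betw \<sigma> (carrier T) (carrier T)"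
  proof (rule bij_betwI')
    fix W V assume "W \<in> carrier T" "V \<in> carrier T"
    then obtain u v where uv: "u \<in> RS" "W = fib u" "v \<in> RS" "V = fib v"
      unfolding carrier_T by blast
    show "\<sigma> W = \<sigma> V \<longleftrightarrow> W = V"
    proof
      assume "\<sigma> W = \<sigma> V"
      then have "fib (\<theta> u) = fib (\<theta> v)"
        unfolding uv(2,4) \<sigma>[OF uv(1)] \<sigma>[OF uv(3)] .
      then have "\<theta> u = \<theta> v"
        by (rule fib_inj[OF \<theta>(2)[OF uv(1)]])
      then have "\<theta>' (\<theta> u) = \<theta>' (\<theta> v)" by (rule arg_cong)
      then show "W = V"
        unfolding inv(1)[OF uv(1)] inv(1)[OF uv(3)] uv(2,4) by (rule arg_cong)
    qed simp
  next
    fix W assume "W \<in> carrier T"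
    then obtain u where u: "u \<in> RS" "W = fib u" unfolding carrier_T by blast
    show "\<sigma> W \<in> carrier T"
      unfolding carrier_T u(2) \<sigma>[OF u(1)] by (intro imageI \<theta>(2) u)
    show "\<exists>V\<in>carrier T. W = \<sigma> V"
    proof
      show "fib (\<theta>' u) \<in> carrier T" unfolding carrier_T by (intro imageI \<theta>(3) u)
      show "W = \<sigma> (fib (\<theta>' u))"
        unfolding \<sigma>[OF \<theta>(3)[OF u(1)]] inv(2)[OF u(1)] by (rule u(2))
    qed
  qed
  moreover have "\<sigma> (\<tau> a s) = \<tau> a s" if "a \<in> F" "s \<in> S" for a s
  proof -
    have a: "a \<in> R" using that F_R by blast
    then show ?thesis
      using \<sigma>[OF mult_RS[OF a that(2)]] that fixed \<theta>.hom_mult[OF R_RS[OF a] S_RS[OF that(2)]]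
      by (simp add: pure_tensor_eq_fib)
  qed
  moreover have "\<sigma> (tensor_endo C R S \<phi> W) = tensor_endo C R S \<phi> (\<sigma> W)" if "W \<in> carrier T" for W
  proof -
    have "W \<in> fib ` RS" using that by (simp only: carrier_T)
    then obtain u where u: "W = fib u" "u \<in> RS" by (rule imageE)
    note u = u(2,1)
    show ?thesis
      unfolding u(2) tensor_endo_fib[OF u(1)] \<sigma>[OF u(1)] \<sigma>[OF \<phi>_RS[OF u(1)]] comm[OF u(1)]
        tensor_endo_fib[OF \<theta>(2)[OF u(1)]] ..
  qed
  ultimately have "\<sigma> \<in> difference_automorphisms F \<phi> R S"
    by (auto simp: difference_automorphisms_def Let_def ring_iso_def)
  with \<sigma> show ?thesis by blast
qed

text \<open>The matrix belonging to \<sigma> is Y^-1 \<theta>(Y) = Y^-1 (Y A) = A, computed in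
  \<open>RS\<close> and carried to the tensor ring by \<open>fib\<close>.\<close>

lemma galois_group_pointsI:
  fixes A Y :: "'a^'n::finite^'n"
  assumes A: "A \<in> GL S" and Y: "\<And>i j. Y $ i $ j \<in> R" "\<And>i j. matrix_inv Y $ i $ j \<in> R"
    "matrix_inv Y ** Y = mat 1"
    and \<theta>: "\<And>i j. \<theta> (Y $ i $ j) = (Y ** A) $ i $ j"
    and \<sigma>: "\<sigma> \<in> difference_automorphisms F \<phi> R S" "\<And>u. u \<in> RS \<Longrightarrow> \<sigma> (fib u) = fib (\<theta> u)"
  shows "A \<in> galois_group_points F \<phi> R Y S"
proof -
  have AS: "A $ i $ j \<in> S" for i j using A by (simp add: GL_def)
  have YA: "(Y ** A) $ i $ j \<in> RS" for i j
    unfolding matrix_matrix_mult_def using Y(1) AS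
    by (simp del: image_iff add: RS.sum_closed mult_RS)
  have "\<tau> 1 (A $ i $ j) = (\<Oplus>\<^bsub>T\<^esub>l\<in>UNIV. \<tau> (matrix_inv Y $ i $ l) 1 \<otimes>\<^bsub>T\<^esub> \<sigma> (\<tau> (Y $ l $ j) 1))" for i j
  proof -
    have "\<tau> (matrix_inv Y $ i $ l) 1 \<otimes>\<^bsub>T\<^esub> \<sigma> (\<tau> (Y $ l $ j) 1) =
        fib (matrix_inv Y $ i $ l * (Y ** A) $ l $ j)" for l
      using \<sigma>(2)[OF R_RS[OF Y(1)[of l j]]] T_mult[OF R_RS[OF Y(2)[of i l]] YA[of l j]]
      by (simp add: pure_tensor_eq_fib Y S.one_closed \<theta>)
    then have "(\<Oplus>\<^bsub>T\<^esub>l\<in>UNIV. \<tau> (matrix_inv Y $ i $ l) 1 \<otimes>\<^bsub>T\<^esub> \<sigma> (\<tau> (Y $ l $ j) 1)) =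
        (\<Oplus>\<^bsub>T\<^esub>l\<in>UNIV. fib (matrix_inv Y $ i $ l * (Y ** A) $ l $ j))"
      by simp
    also have "\<dots> = fib (\<Sum>l\<in>UNIV. matrix_inv Y $ i $ l * (Y ** A) $ l $ j)"
      by (rule T_finsum) (simp_all del: image_iff add: RS.mult_closed R_RS Y YA)
    also have "(\<Sum>l\<in>UNIV. matrix_inv Y $ i $ l * (Y ** A) $ l $ j) = (matrix_inv Y ** (Y ** A)) $ i $ j"
      by (simp add: matrix_matrix_mult_def)
    also have "\<dots> = A $ i $ j"
      by (simp add: matrix_mul_assoc Y(3))
    finally show ?thesis
      using pure_tensor_eq_fib[OF R.one_closed AS[of i j]] by simp
  qed
  with A \<sigma>(1) show ?thesis
    unfolding galois_group_points_def Let_def by blast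
qed

end

section \<open>Homomorphisms of the algebra generated by a matrix\<close>

lemma ring_of_type_algebra_simps [simp]:
  "carrier (ring_of_type_algebra :: 'a::comm_ring_1 ring) = UNIV"
  "x \<otimes>\<^bsub>ring_of_type_algebra\<^esub> y = x * (y :: 'a)"
  "x \<oplus>\<^bsub>ring_of_type_algebra\<^esub> y = x + (y :: 'a)"
  "\<one>\<^bsub>ring_of_type_algebra\<^esub> = (1 :: 'a)" "\<zero>\<^bsub>ring_of_type_algebra\<^esub> = (0 :: 'a)"
  by (simp_all add: ring_of_type_algebra_def)

lemma ring_of_type_algebra_uminus [simp]:
  "\<ominus>\<^bsub>ring_of_type_algebra\<^esub> x = - (x :: 'a::comm_ring_1)"
proof -
  interpret Ring.ring "ring_of_type_algebra :: 'a ring" by (rule ring_from_type_algebra)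
  show ?thesis using minus_equality[of "- x" x] by simp
qed

lemma
  fixes Y :: "'a::field^'n::finite^'n"
  shows matrix_algebra_subring: "subring_set (matrix_algebra F Y)"
    and matrix_algebra_base: "x \<in> F \<Longrightarrow> x \<in> matrix_algebra F Y"
    and matrix_algebra_entry: "Y $ i $ j \<in> matrix_algebra F Y"
    and matrix_algebra_inverse_det: "inverse (det Y) \<in> matrix_algebra F Y"
proof -
  let ?H = "F \<union> {Y $ i $ j | i j. True} \<union> {inverse (det Y)}"
  show "subring_set (matrix_algebra F Y)"
    unfolding matrix_algebra_def
    using generate_ring.intros[where R = ring_of_type_algebra and H = ?H] by unfold_locales auto
  show "x \<in> F \<Longrightarrow> x \<in> matrix_algebra F Y" "Y $ i $ j \<in> matrix_algebra F Y"
    "inverse (det Y) \<in> matrix_algebra F Y"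
    unfolding matrix_algebra_def by (auto intro: generate_ring.incl)
qed

lemma matrix_algebra_induct [consumes 1, case_names one base entry inverse_det uminus add mult]:
  fixes Y :: "'a::field^'n::finite^'n"
  assumes "r \<in> matrix_algebra F Y" "Q 1" "\<And>x. x \<in> F \<Longrightarrow> Q x" "\<And>i j. Q (Y $ i $ j)"
    "Q (inverse (det Y))" "\<And>x. x \<in> matrix_algebra F Y \<Longrightarrow> Q x \<Longrightarrow> Q (- x)"
    "\<And>x y. x \<in> matrix_algebra F Y \<Longrightarrow> y \<in> matrix_algebra F Y \<Longrightarrow> Q x \<Longrightarrow> Q y \<Longrightarrow> Q (x + y)"
    "\<And>x y. x \<in> matrix_algebra F Y \<Longrightarrow> y \<in> matrix_algebra F Y \<Longrightarrow> Q x \<Longrightarrow> Q y \<Longrightarrow> Q (x * y)"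
  shows "Q r"
  using assms(1) unfolding matrix_algebra_def
proof induction
  case one
  then show ?case using assms(2) by simp
next
  case (incl h)
  then show ?case using assms(3-5) by auto
next
  case (a_inv h)
  then show ?case using assms(6) by (simp add: matrix_algebra_def)
next
  case (eng_add h1 h2)
  then show ?case using assms(7) by (simp add: matrix_algebra_def)
next
  case (eng_mult h1 h2)
  then show ?case using assms(8) by (simp add: matrix_algebra_def)
qed

lemma (in subring_hom) hom_inverse:
  fixes x :: "'a"
  assumes "x \<in> A" "y \<in> A" "x * y = 1"
  shows "h x * h y = 1"
  using hom_mult[OF assms(1,2)] assms(3) hom_one by simp

text \<open>The image of 1/det(Y) is forced: it is the inverse of the image of det(Y), a polynomial
  in the entries.\<close>

lemma matrix_algebra_hom_eqI:
  fixes Y :: "'a::field^'n::finite^'n" and \<alpha> \<beta> :: "'a \<Rightarrow> 'b::field"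
  assumes "det Y \<noteq> 0"
    and "subring_hom (matrix_algebra F Y) \<alpha>" "subring_hom (matrix_algebra F Y) \<beta>"
    and "\<And>x. x \<in> F \<Longrightarrow> \<alpha> x = \<beta> x" "\<And>i j. \<alpha> (Y $ i $ j) = \<beta> (Y $ i $ j)"
    and "r \<in> matrix_algebra F Y"
  shows "\<alpha> r = \<beta> r"
proof -
  interpret \<alpha>: subring_hom "matrix_algebra F Y" \<alpha> by fact
  interpret \<beta>: subring_hom "matrix_algebra F Y" \<beta> by fact
  show ?thesis
    using assms(6)
  proof (induction rule: matrix_algebra_induct)
    case inverse_det
    have det: "det Y \<in> matrix_algebra F Y" "\<alpha> (det Y) = \<beta> (det Y)"
      using \<alpha>.hom_det[of Y] \<beta>.hom_det[of Y] assms(5)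
      by (auto simp: matrix_algebra_entry map_matrix_def)
    have "\<alpha> (det Y) * \<alpha> (inverse (det Y)) = 1" "\<beta> (det Y) * \<beta> (inverse (det Y)) = 1"
      using assms(1) det(1) matrix_algebra_inverse_det[of Y F]
      by (auto intro!: \<alpha>.hom_inverse \<beta>.hom_inverse)
    then show ?case using det(2) by (metis mult_cancel_left mult_zero_left zero_neq_one)
  qed (use assms(4,5) in \<open>simp_all add: \<alpha>.hom_one \<beta>.hom_one \<alpha>.hom_uminus \<beta>.hom_uminus
      \<alpha>.hom_add \<beta>.hom_add \<alpha>.hom_mult \<beta>.hom_mult\<close>)
qed

text \<open>Every element of the algebra has the form f(Y) / det(Y)^N and is sent to f(Z) /
  det(Z)^N. Two such forms of one element differ, after clearing denominators, by a relation of Y,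
  which holds at Z by assumption.\<close>

lemma ex_matrix_algebra_hom:
  fixes Y Z :: "'a::field^'n::finite^'n"
  assumes "subfield_set F" "det Y \<noteq> 0" "det Z \<noteq> 0"
    and rel: "\<And>f. f \<in> mpolys F \<Longrightarrow> ev Y f = 0 \<Longrightarrow> ev Z f = 0"
  obtains \<alpha> where "subring_hom (matrix_algebra F Y) \<alpha>" "\<And>x. x \<in> F \<Longrightarrow> \<alpha> x = x"
    "\<And>i j. \<alpha> (Y $ i $ j) = Z $ i $ j"
proof -
  interpret F: subfield_set F by fact
  interpret M: subring_set "mpolys F :: ('n \<times> 'n, 'a) mpoly set" by (rule F.subring_mpolys)
  interpret R: subring_set "matrix_algebra F Y" by (rule matrix_algebra_subring)
  interpret evY: subring_hom UNIV "ev Y" by (rule ev_hom)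
  interpret evZ: subring_hom UNIV "ev Z" by (rule ev_hom)
  define detp :: "('n \<times> 'n, 'a) mpoly" where "detp = det (\<chi> i j. Var (i, j))"
  have detp: "detp \<in> mpolys F"
  proof -
    interpret id: subring_hom "mpolys F :: ('n \<times> 'n, 'a) mpoly set" "\<lambda>x. x"
      by unfold_locales auto
    show ?thesis unfolding detp_def by (rule id.hom_det) (simp add: F.Var_mpolys)
  qed
  have ev_detp: "ev W detp = det W" for W :: "'a^'n^'n"
  proof -
    interpret ev: subring_hom UNIV "ev W" by (rule ev_hom)
    have "map_matrix (ev W) (\<chi> i j. Var (i, j)) = W"
      by (simp add: map_matrix_def vec_eq_iff)
    then show ?thesis unfolding detp_def by (subst ev.hom_det) auto
  qed
  define rep where "rep r f N \<longleftrightarrow> f \<in> mpolys F \<and> r * det Y ^ N = ev Y f" for r f N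
  have rep_mult: "rep (x * y) (f * g) (N + M)" if "rep x f N" "rep y g M" for x y f g N M
    using that by (auto simp: rep_def M.mult_closed evY.hom_mult power_add) (metis mult.assoc mult.commute)
  have rep_add: "rep (x + y) (f * detp ^ M + g * detp ^ N) (N + M)"
    if "rep x f N" "rep y g M" for x y f g N M
  proof -
    have "(x + y) * det Y ^ (N + M) = x * det Y ^ N * det Y ^ M + y * det Y ^ M * det Y ^ N"
      by (simp add: algebra_simps power_add)
    then show ?thesis
      using that by (auto simp: rep_def M.add_closed M.mult_closed M.power_closed detp evY.hom_add
          evY.hom_mult evY.hom_power ev_detp)
  qed
  have ex_rep: "\<exists>f N. rep r f N" if "r \<in> matrix_algebra F Y" for r
    using that
  proof (induction rule: matrix_algebra_induct)
    case one
    show ?case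
      by (intro exI[of _ 1] exI[of _ 0]) (simp add: rep_def M.one_closed evY.hom_one)
  next
    case (base x)
    then show ?case
      by (intro exI[of _ "Cst x"] exI[of _ 0]) (simp add: rep_def F.Cst_mpolys)
  next
    case (entry i j)
    show ?case
      by (intro exI[of _ "Var (i, j)"] exI[of _ 0]) (simp add: rep_def F.Var_mpolys)
  next
    case inverse_det
    show ?case
      using assms(2) by (intro exI[of _ 1] exI[of _ 1]) (simp add: rep_def M.one_closed evY.hom_one)
  next
    case (uminus x)
    then obtain f N where "rep x f N" by blast
    then show ?case
      by (intro exI[of _ "- f"] exI[of _ N]) (auto simp: rep_def M.uminus_closed evY.hom_uminus)
  next
    case (add x y)
    then show ?case using rep_add by blast
  next
    case (mult x y)
    then show ?case using rep_mult by blast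
  qed
  define \<alpha> where "\<alpha> r = (THE b. \<exists>f N. rep r f N \<and> b = ev Z f / det Z ^ N)" for r
  have \<alpha>: "\<alpha> r = ev Z f / det Z ^ N" if "rep r f N" for r f N
    unfolding \<alpha>_def
  proof (rule the_equality)
    show "\<exists>f' N'. rep r f' N' \<and> ev Z f / det Z ^ N = ev Z f' / det Z ^ N'"
      using that by blast
    fix b assume "\<exists>f N. rep r f N \<and> b = ev Z f / det Z ^ N"
    then obtain g M where g: "rep r g M" "b = ev Z g / det Z ^ M" by blast
    have "ev Z (g * detp ^ N - f * detp ^ M) = 0"
    proof (rule rel)
      show "g * detp ^ N - f * detp ^ M \<in> mpolys F"
        using that g by (auto simp: rep_def intro!: M.diff_closed M.mult_closed M.power_closed detp)
      have "ev Y g * det Y ^ N = ev Y f * det Y ^ M"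
        using that g by (auto simp: rep_def) (metis mult.assoc mult.commute)
      then show "ev Y (g * detp ^ N - f * detp ^ M) = 0"
        by (simp add: evY.hom_diff evY.hom_mult evY.hom_power ev_detp)
    qed
    then have "ev Z g * det Z ^ N = ev Z f * det Z ^ M"
      by (simp add: evZ.hom_diff evZ.hom_mult evZ.hom_power ev_detp)
    then show "b = ev Z f / det Z ^ N"
      unfolding g(2) using assms(3) by (simp add: frac_eq_eq)
  qed
  show thesis
  proof
    show "subring_hom (matrix_algebra F Y) \<alpha>"
    proof
      show "\<alpha> 1 = 1"
        using \<alpha>[of 1 1 0] by (simp add: rep_def M.one_closed evY.hom_one evZ.hom_one)
      fix x y assume "x \<in> matrix_algebra F Y" "y \<in> matrix_algebra F Y"
      then obtain f N g M where reps: "rep x f N" "rep y g M" using ex_rep by blast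
      show "\<alpha> (x * y) = \<alpha> x * \<alpha> y"
        unfolding \<alpha>[OF rep_mult[OF reps]] \<alpha>[OF reps(1)] \<alpha>[OF reps(2)]
        by (simp add: evZ.hom_mult power_add)
      show "\<alpha> (x + y) = \<alpha> x + \<alpha> y"
        unfolding \<alpha>[OF rep_add[OF reps]] \<alpha>[OF reps(1)] \<alpha>[OF reps(2)]
        using assms(3)
        by (simp add: evZ.hom_add evZ.hom_mult evZ.hom_power ev_detp power_add field_simps)
    qed
    show "\<alpha> x = x" if "x \<in> F" for x
      using \<alpha>[of x "Cst x" 0] that by (simp add: rep_def F.Cst_mpolys)
    show "\<alpha> (Y $ i $ j) = Z $ i $ j" for i j
      using \<alpha>[of "Y $ i $ j" "Var (i, j)" 0] by (simp add: rep_def F.Var_mpolys)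
  qed
qed

section \<open>Integrality of the fundamental matrix\<close>

lemma (in subring_set) matrix_mult_closed:
  fixes W Z :: "'a^'n::finite^'n"
  assumes "\<And>i j. W $ i $ j \<in> A" "\<And>i j. Z $ i $ j \<in> A"
  shows "(W ** Z) $ i $ j \<in> A"
  unfolding matrix_matrix_mult_def using assms by (simp add: sum_closed mult_closed)

lemma (in subring_hom) map_matrix_mult:
  fixes W Z :: "'a^'n::finite^'n"
  assumes "\<And>i j. W $ i $ j \<in> A" "\<And>i j. Z $ i $ j \<in> A"
  shows "map_matrix h (W ** Z) = map_matrix h W ** map_matrix h Z"
  using assms by (simp add: vec_eq_iff matrix_matrix_mult_def hom_sum hom_mult mult_closed)

lemma (in subring_hom) map_matrix_one: "map_matrix h (mat 1) = mat 1"
  by (simp add: vec_eq_iff mat_def hom_one hom_zero)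

lemma matrix_inv_eqI:
  fixes W Z :: "'a::semiring_1^'n::finite^'n"
  assumes "W ** Z = mat 1" "Z ** W = mat 1"
  shows "matrix_inv W = Z"
proof -
  have "W ** matrix_inv W = mat 1"
    unfolding matrix_inv_def by (rule someI2[of _ Z]) (use assms in auto)
  then have "Z ** (W ** matrix_inv W) = Z ** mat 1" by simp
  then show ?thesis by (simp add: matrix_mul_assoc assms(2))
qed

text \<open>Multiplication by a power series acts on truncated coefficient vectors as a lower
  triangular Toeplitz matrix, whose entry at (a, b) is the coefficient of index a - b. Cutting at
  \<open>N\<close> is harmless, since terms with b > a vanish.\<close>

lemma nth_mult_power_series:
  fixes f g :: "'a::comm_ring_1 fls"
  assumes "\<And>n. n < 0 \<Longrightarrow> fls_nth f n = 0" "\<And>n. n < 0 \<Longrightarrow> fls_nth g n = 0" "a < N"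
  shows "fls_nth (f * g) (int a - int c) =
    (\<Sum>b<N. fls_nth f (int a - int b) * fls_nth g (int b - int c))"
proof -
  define g' where "g' = fls_shift (- int c) g"
  have g': "fls_nth g' n = fls_nth g (n - int c)" for n by (simp add: g'_def)
  have "fls_nth (f * g) (int a - int c) = fls_nth (f * g') (int a)"
    by (simp add: g'_def fls_shifted_times_simps)
  also have "\<dots> = fls_nth (g' * f) (int a)"
    by (simp add: mult.commute)
  also have "\<dots> = (\<Sum>i=0..int a - 0. fls_nth g' i * fls_nth f (int a - i))"
    by (rule fls_times_nth_bounds) (use assms in \<open>auto simp: g'\<close>)
  also have "\<dots> = (\<Sum>b\<le>a. fls_nth g' (int b) * fls_nth f (int a - int b))"
    by (rule sum.reindex_bij_witness[of _ int nat]) auto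
  also have "\<dots> = (\<Sum>b<N. fls_nth g' (int b) * fls_nth f (int a - int b))"
    using assms by (intro sum.mono_neutral_left) auto
  finally show ?thesis by (simp add: g' mult.commute)
qed

text \<open>By comparison of coefficients in \<phi>(Y) = U Y, the coefficients of a column up to a
  fixed order satisfy x^q = P x with the block Toeplitz matrix \<open>P\<close> of \<open>U\<close>,
  which the one of \<open>V\<close> inverts. So \<open>system_integral\<close> applies.\<close>

lemma (in specialization) fundamental_matrix_integral:
  fixes U V Y :: "'a fls^'n::finite^'n"
  assumes \<O>: "valuation_ring_of (separable_closure_of k) \<O>"
    and Y: "\<And>i j. Y $ i $ j \<in> power_series_over UNIV" "map_matrix \<phi> Y = U ** Y"
    and U: "\<And>i j. U $ i $ j \<in> power_series_over \<oo>" "\<And>i j. V $ i $ j \<in> power_series_over \<oo>"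
      "U ** V = mat 1"
  shows "Y $ r $ c \<in> power_series_over \<O>"
proof -
  have neg: "fls_nth f n = 0" if "f \<in> power_series_over A" "n < 0" for f :: "'a fls" and A n
    using that by (simp add: power_series_over_def)
  have "fls_nth (Y $ r $ c) n \<in> \<O>" for n
  proof (cases "n < 0")
    case True
    then show ?thesis using neg[OF Y(1)] \<O>.zero_closed by simp
  next
    case False
    \<comment> \<open>Just large enough for the coefficient of index n to occur.\<close>
    define N where "N = Suc (nat n)"
    define S where "S = (UNIV :: 'n set) \<times> {..<N}"
    define x where "x p = fls_nth (Y $ fst p $ c) (int (snd p))" for p :: "'n \<times> nat"
    define P where "P p r = fls_nth (U $ fst p $ fst r) (int (snd p) - int (snd r))"
      for p r :: "'n \<times> nat"
    define P' where "P' p r = fls_nth (V $ fst p $ fst r) (int (snd p) - int (snd r))"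
      for p r :: "'n \<times> nat"
    have sum_S: "(\<Sum>p\<in>S. h p) = (\<Sum>l\<in>UNIV. \<Sum>b<N. h (l, b))" for h :: "'n \<times> nat \<Rightarrow> 'a"
      by (simp add: S_def sum.cartesian_product)
    have inverse: "(\<Sum>s\<in>S. P p s * P' s t) = (if p = t then 1 else 0)" if "p \<in> S" "t \<in> S" for p t
    proof -
      have "(\<Sum>s\<in>S. P p s * P' s t) = (\<Sum>l\<in>UNIV. fls_nth (U $ fst p $ l * V $ l $ fst t)
          (int (snd p) - int (snd t)))"
        unfolding sum_S using that
        by (intro sum.cong refl) (subst nth_mult_power_series[where N = N];
            auto simp: P_def P'_def S_def neg[OF U(1)] neg[OF U(2)])
      also have "\<dots> = fls_nth ((U ** V) $ fst p $ fst t) (int (snd p) - int (snd t))"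
        by (simp add: matrix_matrix_mult_def fls_nth_sum)
      also have "\<dots> = (if p = t then 1 else 0)"
        by (auto simp: U(3) mat_def prod_eq_iff)
      finally show ?thesis .
    qed
    interpret frobenius_system q ty k S P x
    proof
      show "finite S" by (simp add: S_def)
      show "P i j \<in> k" for i j
        using U(1) \<oo>_k by (auto simp: P_def power_series_over_def)
      show "x p ^ q = (\<Sum>s\<in>S. P p s * x s)" if "p \<in> S" for p
      proof -
        have "x p ^ q = fls_nth ((U ** Y) $ fst p $ c) (int (snd p))"
          by (simp add: x_def flip: Y(2))
        also have "\<dots> = (\<Sum>l\<in>UNIV. fls_nth (U $ fst p $ l * Y $ l $ c) (int (snd p) - int 0))"
          by (simp add: matrix_matrix_mult_def fls_nth_sum)
        also have "\<dots> = (\<Sum>s\<in>S. P p s * x s)"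
          unfolding sum_S using that
          by (intro sum.cong refl) (subst nth_mult_power_series[where N = N];
              auto simp: P_def x_def S_def neg[OF U(1)] neg[OF Y(1)])
        finally show ?thesis .
      qed
      show "w t = 0" if w: "\<And>s. s \<in> S \<Longrightarrow> (\<Sum>p\<in>S. w p * P p s) = 0" and t: "t \<in> S" for w t
      proof -
        have "w t = (\<Sum>p\<in>S. if p = t then w p else 0)"
          using t by (simp add: S_def)
        also have "\<dots> = (\<Sum>p\<in>S. w p * (\<Sum>s\<in>S. P p s * P' s t))"
          using t by (intro sum.cong) (auto simp: inverse)
        also have "\<dots> = (\<Sum>s\<in>S. (\<Sum>p\<in>S. w p * P p s) * P' s t)"
          unfolding sum_distrib_left sum_distrib_right
          by (subst sum.swap) (simp add: mult.assoc)
        also have "\<dots> = 0" by (simp add: w)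
        finally show ?thesis .
      qed
    qed
    have "x (r, nat n) \<in> \<O>"
    proof (rule system_integral[OF \<O>])
      show "P i j \<in> \<O>" for i j
        using U(1) \<oo>_\<O> by (auto simp: P_def power_series_over_def)
    qed (simp add: S_def N_def)
    then show ?thesis using False by (simp add: x_def)
  qed
  then show ?thesis using neg[OF Y(1)] by (simp add: power_series_over_def)
qed

section \<open>The specialized matrix in the Galois group\<close>

text \<open>The assumption on \<open>A\<close> lets Y \<mapsto> Y A define an endomorphism of
  \<open>RS\<close>, and the one on \<open>A'\<close> gives its inverse. It commutes with \<phi>
  because \<phi>(Y) = Di Y with \<open>Di\<close> over \<open>F\<close>, and \<phi> fixes the
  entries of \<open>A\<close>.\<close>

lemma (in difference_tensor) galois_group_points_matrixI:
  fixes A A' Y Yi Di :: "'a^'n::finite^'n"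
  assumes R: "R = matrix_algebra F Y"
    and A: "\<And>i j. A $ i $ j \<in> S" "\<And>i j. A' $ i $ j \<in> S" "A ** A' = mat 1" "A' ** A = mat 1"
    and Y: "\<And>i j. Yi $ i $ j \<in> R" "Y ** Yi = mat 1" "Yi ** Y = mat 1"
    and Di: "\<And>i j. Di $ i $ j \<in> F" "map_matrix \<phi> Y = Di ** Y"
    and rel: "\<And>f. f \<in> mpolys F \<Longrightarrow> ev Y f = 0 \<Longrightarrow> ev (Y ** A) f = 0"
      "\<And>f. f \<in> mpolys F \<Longrightarrow> ev Y f = 0 \<Longrightarrow> ev (Y ** A') f = 0"
  shows "A \<in> galois_group_points F \<phi> R Y S"
proof -
  have detY: "det Y * det Yi = 1" and detA: "det A * det A' = 1"
    and detA': "det A' * det A = 1"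
    using Y(2) A(3,4) by (metis det_I det_mul)+
  then have detY0: "det Y \<noteq> 0" by auto
  have YR: "Y $ i $ j \<in> R" for i j
    unfolding R by (rule matrix_algebra_entry)
  have step: "\<exists>\<theta>. subring_hom RS \<theta> \<and> (\<forall>u\<in>RS. \<theta> u \<in> RS) \<and> (\<forall>a\<in>F. \<theta> a = a) \<and>
      (\<forall>s\<in>S. \<theta> s = s) \<and> (\<forall>i j. \<theta> (Y $ i $ j) = (Y ** B) $ i $ j)"
    if B: "\<And>i j. B $ i $ j \<in> S" "\<And>i j. B' $ i $ j \<in> S" "det B * det B' = 1"
      and rel: "\<And>f. f \<in> mpolys F \<Longrightarrow> ev Y f = 0 \<Longrightarrow> ev (Y ** B) f = 0" for B B' :: "'a^'n^'n"
  proof -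
    have nz: "det Y \<noteq> 0" "det (Y ** B) \<noteq> 0"
      using detY B(3) by (auto simp: det_mul)
    from ex_matrix_algebra_hom[OF F.subfield_set_axioms this rel] obtain \<alpha> where
      \<alpha>: "subring_hom R \<alpha>" "\<And>x. x \<in> F \<Longrightarrow> \<alpha> x = x" "\<And>i j. \<alpha> (Y $ i $ j) = (Y ** B) $ i $ j"
      unfolding R by blast
    interpret \<alpha>: subring_hom R \<alpha> by fact
    obtain \<theta> where \<theta>: "subring_hom RS \<theta>" "\<And>r. r \<in> R \<Longrightarrow> \<theta> r = \<alpha> r" "\<And>s. s \<in> S \<Longrightarrow> \<theta> s = s"
      using extend_hom[OF \<alpha>(1)] \<alpha>(2) by (auto simp: constants_def)
    have YB: "(Y ** B) $ i $ j \<in> RS" for i j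
      using YR B(1) by (intro RS.matrix_mult_closed R_RS S_RS)
    \<comment> \<open>The generator 1/det(Y) requires 1/det(B), which is det(B') and hence in
      \<open>S\<close>.\<close>
    have \<alpha>_RS: "\<alpha> r \<in> RS" if "r \<in> R" for r
      using that[unfolded R]
    proof (induction rule: matrix_algebra_induct)
      case one
      then show ?case using RS.one_closed by (simp only: \<alpha>.hom_one)
    next
      case (base x)
      then show ?case using F_R R_RS by (metis \<alpha>(2) subsetD)
    next
      case (entry i j)
      then show ?case using YB by (simp only: \<alpha>(3))
    next
      case inverse_det
      interpret S: subring_hom S "\<lambda>x. x" by unfold_locales auto
      have detB': "det B' \<in> S" by (rule S.hom_det(1)) (rule B(2))
      have "map_matrix \<alpha> Y = Y ** B" by (simp add: vec_eq_iff \<alpha>(3))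
      then have det: "det Y \<in> R" "\<alpha> (det Y) = det Y * det B"
        using \<alpha>.hom_det[OF YR] by (simp_all add: det_mul)
      have iR: "inverse (det Y) \<in> R" unfolding R by (rule matrix_algebra_inverse_det)
      have "\<alpha> (det Y) * \<alpha> (inverse (det Y)) = 1"
        by (intro \<alpha>.hom_inverse det iR right_inverse nz)
      then have "\<alpha> (inverse (det Y)) = inverse (det Y * det B)"
        unfolding det(2) by (metis inverse_unique)
      also have "\<dots> = inverse (det Y) * det B'"
        using inverse_unique[OF B(3)] by simp
      finally show ?case using mult_RS[OF iR detB'] by (simp only:)
    next
      case (uminus x)
      then show ?case using RS.uminus_closed by (simp only: \<alpha>.hom_uminus flip: R)
    next
      case (add x y)
      then show ?case using RS.add_closed by (simp only: \<alpha>.hom_add flip: R)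
    next
      case (mult x y)
      then show ?case using RS.mult_closed by (simp only: \<alpha>.hom_mult flip: R)
    qed
    have "\<theta> u \<in> RS" if "u \<in> RS" for u
    proof (rule hom_closed_RS[OF \<theta>(1) that])
      show "\<theta> r \<in> RS" if "r \<in> R" for r
        unfolding \<theta>(2)[OF that] by (rule \<alpha>_RS[OF that])
      show "\<theta> s \<in> RS" if "s \<in> S" for s
        unfolding \<theta>(3)[OF that] by (rule S_RS[OF that])
    qed
    moreover have "\<theta> a = a" if "a \<in> F" for a
      using \<theta>(2)[of a] \<alpha>(2)[OF that] that F_R by auto
    moreover have "\<theta> (Y $ i $ j) = (Y ** B) $ i $ j" for i j
      using \<theta>(2)[OF YR] \<alpha>(3) by simp
    ultimately show ?thesis
      using \<theta>(1,3) by (intro exI[of _ \<theta>] conjI) blast+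
  qed
  obtain \<theta> where \<theta>: "subring_hom RS \<theta>" "\<And>u. u \<in> RS \<Longrightarrow> \<theta> u \<in> RS" "\<And>a. a \<in> F \<Longrightarrow> \<theta> a = a"
    "\<And>s. s \<in> S \<Longrightarrow> \<theta> s = s" "\<And>i j. \<theta> (Y $ i $ j) = (Y ** A) $ i $ j"
    using step[OF A(1,2) detA rel(1)] by blast
  obtain \<theta>' where \<theta>': "subring_hom RS \<theta>'" "\<And>u. u \<in> RS \<Longrightarrow> \<theta>' u \<in> RS" "\<And>a. a \<in> F \<Longrightarrow> \<theta>' a = a"
    "\<And>s. s \<in> S \<Longrightarrow> \<theta>' s = s" "\<And>i j. \<theta>' (Y $ i $ j) = (Y ** A') $ i $ j"
    using step[OF A(2,1) detA' rel(2)] by blast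
  have sub: "subring_hom R \<psi>" if "subring_hom RS \<psi>" for \<psi> :: "'a \<Rightarrow> 'a"
    by (rule subring_hom_mono[OF that R.subring_set_axioms]) (rule subsetI, rule R_RS)
  have eqI: "\<psi> u = \<psi>' u" if "subring_hom RS \<psi>" "subring_hom RS \<psi>'" "u \<in> RS"
    "\<And>a. a \<in> F \<Longrightarrow> \<psi> a = \<psi>' a" "\<And>s. s \<in> S \<Longrightarrow> \<psi> s = \<psi>' s"
    "\<And>i j. \<psi> (Y $ i $ j) = \<psi>' (Y $ i $ j)" for \<psi> \<psi>' :: "'a \<Rightarrow> 'a" and u
  proof (rule RS_hom_eqI[OF that(1,2,3) _ that(5)])
    fix r assume "r \<in> R"
    then show "\<psi> r = \<psi>' r"
      using matrix_algebra_hom_eqI[OF detY0, of F \<psi> \<psi>' r] sub[OF that(1)] sub[OF that(2)] that(4,6)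
      by (auto simp: R)
  qed
  have inverse: "\<theta>2 (\<theta>1 u) = u"
    if \<theta>1: "subring_hom RS \<theta>1" "\<And>u. u \<in> RS \<Longrightarrow> \<theta>1 u \<in> RS" "\<And>a. a \<in> F \<Longrightarrow> \<theta>1 a = a"
        "\<And>s. s \<in> S \<Longrightarrow> \<theta>1 s = s" "\<And>i j. \<theta>1 (Y $ i $ j) = (Y ** A1) $ i $ j"
      and \<theta>2: "subring_hom RS \<theta>2" "\<And>a. a \<in> F \<Longrightarrow> \<theta>2 a = a"
        "\<And>s. s \<in> S \<Longrightarrow> \<theta>2 s = s" "\<And>i j. \<theta>2 (Y $ i $ j) = (Y ** A2) $ i $ j"
      and A12: "\<And>i j. A1 $ i $ j \<in> S" "A2 ** A1 = mat 1" and u: "u \<in> RS"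
    for \<theta>1 \<theta>2 :: "'a \<Rightarrow> 'a" and A1 A2 :: "'a^'n^'n" and u
  proof (rule eqI[of "\<lambda>x. \<theta>2 (\<theta>1 x)" "\<lambda>x. x", OF _ _ u])
    interpret \<theta>2: subring_hom RS \<theta>2 by fact
    show "subring_hom RS (\<lambda>x. \<theta>2 (\<theta>1 x))"
      by (rule subring_hom_comp[OF \<theta>1(1) \<theta>2(1) \<theta>1(2)])
    show "subring_hom RS (\<lambda>x. x)" by unfold_locales auto
    have "map_matrix \<theta>2 (Y ** A1) = map_matrix \<theta>2 Y ** map_matrix \<theta>2 A1"
      by (intro \<theta>2.map_matrix_mult R_RS S_RS YR A12)
    also have "map_matrix \<theta>2 A1 = A1"
      using A12(1) by (simp add: vec_eq_iff \<theta>2)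
    also have "map_matrix \<theta>2 Y = Y ** A2" by (simp add: vec_eq_iff \<theta>2)
    also have "Y ** A2 ** A1 = Y"
      by (simp add: A12(2) flip: matrix_mul_assoc)
    finally have eq: "map_matrix \<theta>2 (Y ** A1) = Y" .
    show "\<theta>2 (\<theta>1 (Y $ i $ j)) = Y $ i $ j" for i j
      unfolding \<theta>1(5) using arg_cong[OF eq, of "\<lambda>M. M $ i $ j"] by simp
  qed (simp_all add: \<theta>1 \<theta>2)
  have comm: "\<theta> (\<phi> u) = \<phi> (\<theta> u)" if u: "u \<in> RS" for u
  proof (rule eqI[of "\<lambda>x. \<theta> (\<phi> x)" "\<lambda>x. \<phi> (\<theta> x)", OF _ _ u])
    interpret \<theta>: subring_hom RS \<theta> by fact
    interpret \<phi>RS: subring_hom RS \<phi>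
      by (rule subring_hom_mono[OF subring_hom_axioms RS.subring_set_axioms]) simp
    show "subring_hom RS (\<lambda>x. \<theta> (\<phi> x))"
      by (rule subring_hom_comp[OF \<phi>RS.subring_hom_axioms \<theta>(1) \<phi>_RS])
    show "subring_hom RS (\<lambda>x. \<phi> (\<theta> x))"
      by (rule subring_hom_comp[OF \<theta>(1) subring_hom_axioms]) simp
    show "\<theta> (\<phi> s) = \<phi> (\<theta> s)" if "s \<in> S" for s
      using that by (simp add: \<theta> \<phi>_S)
    show "\<theta> (\<phi> a) = \<phi> (\<theta> a)" if "a \<in> F" for a
      using \<theta>(3)[OF that] \<theta>(3)[OF \<phi>_F[OF that]] by simp
    have DiR: "Di $ i $ j \<in> R" for i j using Di(1) F_R by blast
    have "map_matrix \<theta> (map_matrix \<phi> Y) = map_matrix \<theta> Di ** map_matrix \<theta> Y"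
      unfolding Di(2) by (intro \<theta>.map_matrix_mult R_RS DiR YR)
    also have "\<dots> = Di ** (Y ** A)"
      using Di(1) \<theta> by (intro arg_cong2[where f = "(**)"]) (simp_all add: vec_eq_iff)
    also have "\<dots> = map_matrix \<phi> Y ** map_matrix \<phi> A"
    proof -
      have "map_matrix \<phi> A = A" using A(1) \<phi>_S by (simp add: vec_eq_iff)
      then show ?thesis by (simp add: Di(2) matrix_mul_assoc)
    qed
    also have "\<dots> = map_matrix \<phi> (Y ** A)"
      by (rule map_matrix_mult[symmetric]) simp_all
    finally have eq: "map_matrix \<theta> (map_matrix \<phi> Y) = map_matrix \<phi> (Y ** A)" .
    show "\<theta> (\<phi> (Y $ i $ j)) = \<phi> (\<theta> (Y $ i $ j))" for i j
      unfolding \<theta>(5) using arg_cong[OF eq, of "\<lambda>M. M $ i $ j"] by simp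
  qed
  have "\<exists>\<sigma>\<in>difference_automorphisms F \<phi> R S. \<forall>u\<in>RS. \<sigma> (fib u) = fib (\<theta> u)"
  proof (rule tensor_automorphism[where \<theta>' = \<theta>'])
    show "\<theta>' (\<theta> u) = u" if "u \<in> RS" for u
      by (rule inverse[OF \<theta> \<theta>'(1,3,4,5) A(1,4) that])
    show "\<theta> (\<theta>' u) = u" if "u \<in> RS" for u
      by (rule inverse[OF \<theta>' \<theta>(1,3,4,5) A(2,3) that])
  qed (fact \<theta> \<theta>' comm)+
  then obtain \<sigma> where \<sigma>: "\<sigma> \<in> difference_automorphisms F \<phi> R S"
    "\<And>u. u \<in> RS \<Longrightarrow> \<sigma> (fib u) = fib (\<theta> u)" by blast
  have inv: "matrix_inv Y = Yi" by (rule matrix_inv_eqI[OF Y(2,3)])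
  show ?thesis
  proof (rule galois_group_pointsI[OF _ YR _ _ \<theta>(5) \<sigma>])
    show "A \<in> GL S" using A by (auto simp: GL_def)
  qed (simp_all add: inv Y)
qed

section \<open>Linear disjointness of a simple difference ring from fixed elements\<close>

lemma ideal_ring_onI:
  fixes R J :: "'a::comm_ring_1 set"
  assumes "subring R ring_of_type_algebra" "J \<subseteq> R" "0 \<in> J"
    and "\<And>a b. a \<in> J \<Longrightarrow> b \<in> J \<Longrightarrow> a + b \<in> J"
    and "\<And>r a. r \<in> R \<Longrightarrow> a \<in> J \<Longrightarrow> r * a \<in> J"
  shows "ideal J (ring_on R)"
proof -
  interpret A: Ring.ring "ring_of_type_algebra :: 'a ring" by (rule ring_from_type_algebra)
  interpret R: Ring.ring "ring_on R" by (rule A.subring_is_ring[OF assms(1)])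
  interpret Rs: subring_set R by (rule subring_imp_subring_set[OF assms(1)])
  show ?thesis
  proof (rule idealI[OF R.ring_axioms])
    show "subgroup J (add_monoid (ring_on R))"
    proof (rule group.subgroupI[OF R.a_group])
      fix a assume a: "a \<in> J"
      have "- 1 * a \<in> J"
        using a by (intro assms(5) Rs.uminus_closed Rs.one_closed)
      moreover have "a_inv (ring_on R) a = - a"
        using a assms(2) Rs.uminus_closed by (intro R.minus_equality) auto
      ultimately show "m_inv (add_monoid (ring_on R)) a \<in> J"
        by (simp add: a_inv_def)
    qed (use assms in auto)
    fix a r assume "a \<in> J" "r \<in> carrier (ring_on R)"
    then have "r * a \<in> J" by (intro assms(5)) simp
    then show "r \<otimes>\<^bsub>ring_on R\<^esub> a \<in> J" "a \<otimes>\<^bsub>ring_on R\<^esub> r \<in> J"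
      by (simp_all add: mult.commute)
  qed
qed

text \<open>The denominators of x form an ideal of \<open>R\<close>, which is \<phi>-stable because
  x is fixed and nonzero because x is a fraction. Simplicity makes it all of \<open>R\<close>, so 1
  is a denominator.\<close>

lemma (in field_endo) constants_quotient_field:
  assumes "subring R ring_of_type_algebra" "\<And>r. r \<in> R \<Longrightarrow> \<phi> r \<in> R"
    and "simple_difference_ring \<phi> R" and x: "x \<in> quotient_field R" "\<phi> x = x"
  shows "x \<in> R"
proof -
  interpret R: subring_set R by (rule subring_imp_subring_set[OF assms(1)])
  define J where "J = {r \<in> R. r * x \<in> R}"
  have "ideal J (ring_on R)"
    by (rule ideal_ring_onI[OF assms(1)])
      (auto simp: J_def R.ring_closed distrib_right mult.assoc)
  moreover have "\<phi> ` J \<subseteq> J"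
  proof
    fix y assume "y \<in> \<phi> ` J"
    then obtain r where r: "r \<in> R" "r * x \<in> R" "y = \<phi> r" by (auto simp: J_def)
    have "\<phi> (r * x) = \<phi> r * x" by (simp add: mult x)
    with r assms(2) show "y \<in> J" by (metis (mono_tags, lifting) J_def mem_Collect_eq)
  qed
  ultimately have "J = {0} \<or> J = R"
    using assms(3) by (simp add: simple_difference_ring_def)
  moreover obtain a b where "x = a / b" "a \<in> R" "b \<in> R" "b \<noteq> 0"
    using x by (auto simp: quotient_field_def)
  then have "b \<in> J" "b \<noteq> 0" by (auto simp: J_def)
  ultimately have "J = R" by auto
  then have "1 \<in> J" using R.one_closed by simp
  then show ?thesis by (simp add: J_def)
qed

lemma lin_span_nonzero:
  assumes "w \<in> lin_span E S" "w i \<noteq> 0"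
  shows "\<exists>v\<in>S. \<exists>i. v i \<noteq> (0 :: 'a::comm_ring_1)"
proof (rule ccontr)
  assume *: "\<not> ?thesis"
  have "w i = 0" for i
    using assms(1) by induction (use * in auto)
  with assms(2) show False by blast
qed

text \<open>The linear relations of the \<open>s i\<close> over Quot(R) form a \<phi>-stable space
  since the \<open>s i\<close> are fixed. Descent yields a nonzero fixed relation, and fixed
  elements of Quot(R) lie in \<open>R\<close>.\<close>

lemma (in field_endo) linearly_disjoint_fixed:
  assumes "subring R ring_of_type_algebra" "\<And>r. r \<in> R \<Longrightarrow> \<phi> r \<in> R"
    and "simple_difference_ring \<phi> R"
    and I: "finite I" "\<And>i. i \<in> I \<Longrightarrow> r i \<in> R" "\<And>i. i \<in> I \<Longrightarrow> \<phi> (s i) = s i"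
      "(\<Sum>i\<in>I. r i * s i) = 0" "\<exists>i\<in>I. r i \<noteq> 0"
  shows "\<exists>c. (\<forall>i\<in>I. c i \<in> constants \<phi> R) \<and> (\<exists>i\<in>I. c i \<noteq> 0) \<and> (\<Sum>i\<in>I. c i * s i) = 0"
proof -
  have R: "subring_set R" by (rule subring_imp_subring_set[OF assms(1)])
  let ?E = "quotient_field R"
  interpret E: subfield_set ?E by (rule subfield_quotient_field[OF R])
  define J where "J = {w. (\<forall>i. w i \<in> ?E) \<and> (\<forall>i. i \<notin> I \<longrightarrow> w i = 0) \<and> (\<Sum>i\<in>I. w i * s i) = 0}"
  define w where "w i = (if i \<in> I then r i else 0)" for i
  have w: "w \<in> J"
    using I subset_quotient_field[OF R] E.zero_closed by (auto simp: J_def w_def)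
  have span: "w \<in> lin_span ?E {h \<in> J. \<forall>i. \<phi> (h i) = h i}"
  proof (rule descent[OF E.subfield_set_axioms])
    show "subring_hom ?E \<phi>"
      by (rule subring_hom_mono[OF subring_hom_axioms E.subring_set_axioms]) simp
    show "(\<lambda>i. u i + v i) \<in> J" if "u \<in> J" "v \<in> J" for u v
      using that by (auto simp: J_def E.add_closed distrib_right sum.distrib)
    show "(\<lambda>i. c * u i) \<in> J" if "c \<in> ?E" "u \<in> J" for c u
      using that by (auto simp: J_def E.mult_closed mult.assoc simp flip: sum_distrib_left)
    show "(\<lambda>i. \<phi> (u i)) \<in> J" if u: "u \<in> J" for u
    proof -
      have "(\<Sum>i\<in>I. \<phi> (u i) * s i) = \<phi> (\<Sum>i\<in>I. u i * s i)"
        using I(3) by (simp add: hom_sum mult)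
      then show ?thesis
        using u assms(2) quotient_field_closed[of R] by (auto simp: J_def)
    qed
    show "finite {i. w i \<noteq> 0}"
      by (rule finite_subset[OF _ I(1)]) (auto simp: w_def)
  qed (use w in \<open>auto simp: J_def\<close>)
  obtain i0 where "i0 \<in> I" "r i0 \<noteq> 0" using I(5) by blast
  then have "w i0 \<noteq> 0" by (simp add: w_def)
  from lin_span_nonzero[OF span this] obtain h i1
    where h: "h \<in> J" "\<And>i. \<phi> (h i) = h i" "h i1 \<noteq> 0" by auto
  then have "h i \<in> constants \<phi> R" for i
    using constants_quotient_field[OF assms(1-3), of "h i"] by (auto simp: J_def constants_def)
  moreover have "i1 \<in> I" using h by (auto simp: J_def)
  ultimately show ?thesis using h by (intro exI[of _ h]) (auto simp: J_def)
qed

section \<open>The specialized fundamental matrix and the groups containing it\<close>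

context specialization
begin

lemma power_series_frobenius_iter:
  "x \<in> power_series_over \<O> \<Longrightarrow> (\<phi> ^^ m) x \<in> power_series_over \<O>"
  using q_gt_1
  by (auto simp: power_series_over_def nth_frobenius_iter \<O>.power_closed power_0_left)

lemma s0_frobenius_iter: "x \<in> power_series_over \<O> \<Longrightarrow> s0 ((\<phi> ^^ m) x) = (\<phi> ^^ m) (s0 x)"
  by (rule fls_eqI) (simp add: nth_s0 nth_frobenius_iter power_series_over_def \<kappa>.hom_power)

lemma s0_frobenius: "x \<in> power_series_over \<O> \<Longrightarrow> s0 (\<phi> x) = \<phi> (s0 x)"
  using s0_frobenius_iter[of x 1] by simp

lemma s1_frobenius: "x \<in> power_series_over \<O> \<Longrightarrow> s1 (\<phi> x) = \<phi> (s1 x)"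
  by (simp add: s1_def s0_frobenius funpow_swap1)

lemma twisted_product_closed:
  fixes D :: "'a fls^'n::finite^'n"
  assumes "\<And>i j. D $ i $ j \<in> power_series_over \<O>"
  shows "twisted_product \<phi> D m $ i $ j \<in> power_series_over \<O>"
proof (induction m arbitrary: i j)
  case 0
  then show ?case by (simp add: mat_def s0.zero_closed s0.one_closed)
next
  case (Suc m)
  then show ?case
    using assms by (simp add: s0.matrix_mult_closed power_series_frobenius_iter)
qed

text \<open>Iterates Y = D \<phi>(Y): applying \<open>\<phi> ^^ m\<close> to this identity produces
  the next factor.\<close>

lemma twisted_product_fundamental:
  fixes D Y :: "'a fls^'n::finite^'n"
  assumes "D ** map_matrix \<phi> Y = Y"
  shows "twisted_product \<phi> D m ** map_matrix (\<phi> ^^ m) Y = Y"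
proof (induction m)
  case 0
  then show ?case by (simp add: vec_eq_iff matrix_mul_lid)
next
  case (Suc m)
  have "map_matrix (\<phi> ^^ m) D ** map_matrix (\<phi> ^^ Suc m) Y = map_matrix (\<phi> ^^ m) (D ** map_matrix \<phi> Y)"
  proof -
    have iter: "(\<phi> ^^ m) (sum f J) = (\<Sum>j\<in>J. (\<phi> ^^ m) (f j))" for f :: "'n \<Rightarrow> 'a fls" and J
    proof -
      have "(\<phi> ^^ m) 0 = 0" by (induction m) (auto simp: frobenius.hom_zero)
      then show ?thesis
        by (induction J rule: infinite_finite_induct) (auto simp: frobenius_iter_add)
    qed
    show ?thesis
      by (simp add: vec_eq_iff matrix_matrix_mult_def iter frobenius_iter_mult funpow_swap1)
  qed
  then show ?case
    using Suc assms by (simp flip: matrix_mul_assoc del: funpow.simps)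
qed

text \<open>The vanishing ideal of G is generated by polynomials over F_q(t). After multiplication
  by a power of t their coefficients lie in F_q[[t]], which \<open>s0\<close> fixes, so f(Y) = 0
  specializes to f(\<kappa>(Y)) = 0; Zariski closedness gives membership.\<close>

lemma specialize_group_point:
  fixes Y :: "'a fls^'n::finite^'n"
  assumes G: "linear_algebraic_group_over (to_ac ` rational_functions_over (GF q)) G"
    and Y: "\<And>i j. Y $ i $ j \<in> power_series_over \<O>" "map_matrix to_ac Y \<in> G"
    and inv: "map_matrix s0 Y ** Z = mat 1" "Z ** map_matrix s0 Y = mat 1"
  shows "map_matrix to_ac (map_matrix s0 Y) \<in> G"
proof -
  let ?Y0 = "map_matrix s0 Y"
  let ?g = "map_matrix to_ac ?Y0"
  interpret ac: subring_hom UNIV "to_ac :: 'a fls \<Rightarrow> _"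
    by unfold_locales simp_all
  interpret evY0: subring_hom UNIV "ev ?Y0" by (rule ev_hom)
  interpret evY: subring_hom UNIV "ev Y" by (rule ev_hom)
  interpret evg: subring_hom UNIV "ev ?g" by (rule ev_hom)
  have "?g ** map_matrix to_ac Z = mat 1" "map_matrix to_ac Z ** ?g = mat 1"
    using ac.map_matrix_mult[of ?Y0 Z] ac.map_matrix_mult[of Z ?Y0]
    unfolding inv ac.map_matrix_one by simp_all
  then have "?g \<in> GL UNIV" by (auto simp: GL_def)
  moreover have "vanishing_ideal G \<subseteq> {f. ev ?g f = 0}"
  proof -
    let ?S = "{f \<in> vanishing_ideal G.
      range (Poly_Mapping.lookup f) \<subseteq> to_ac ` rational_functions_over (GF q)}"
    let ?P = "ring_of_type_algebra :: ('n \<times> 'n, 'a fls alg_closure) mpoly ring"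
    interpret P: Ring.ring ?P by (rule ring_from_type_algebra)
    have "ideal {f. ev ?g f = 0} ?P"
    proof -
      have eq: "?P\<lparr>carrier := UNIV\<rparr> = ?P" by (simp add: ring_of_type_algebra_def)
      have "ideal {f. ev ?g f = 0} (?P\<lparr>carrier := UNIV\<rparr>)"
        using P.carrier_is_subring
        by (intro ideal_ring_onI) (auto simp: evg.hom_zero evg.hom_add evg.hom_mult)
      then show ?thesis by (simp only: eq)
    qed
    moreover have "?S \<subseteq> {f. ev ?g f = 0}"
    proof
      fix f assume f: "f \<in> ?S"
      \<comment> \<open>A left inverse of the embedding into the algebraic closure: it moves the
        coefficients of f back to K((t)), where \<open>s0\<close> acts.\<close>
      define h where "h = (inv_into UNIV to_ac :: 'a fls alg_closure \<Rightarrow> 'a fls)"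
      have h: "h (to_ac x) = x" for x by (simp add: h_def inj_to_ac)
      have h0: "h 0 = 0" using h[of 0] by simp
      define f0 where "f0 = mp_map h f"
      have lookup: "Poly_Mapping.lookup f0 m \<in> rational_functions_over (GF q)"
        "to_ac (Poly_Mapping.lookup f0 m) = Poly_Mapping.lookup f m" for m
      proof -
        have "Poly_Mapping.lookup f m \<in> to_ac ` rational_functions_over (GF q)"
          using f by blast
        then show "Poly_Mapping.lookup f0 m \<in> rational_functions_over (GF q)"
          "to_ac (Poly_Mapping.lookup f0 m) = Poly_Mapping.lookup f m"
          by (auto simp: f0_def lookup_mp_map[of h, OF h0] h)
      qed
      have f_eq: "f = mp_map to_ac f0"
        by (rule poly_mapping_eqI) (simp add: lookup_mp_map lookup(2))
      have ev_ac: "ev (map_matrix to_ac W) f = to_ac (ev W f0)" for W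
        unfolding f_eq using ac.hom_ev[of W f0] by simp
      have "eval_matrix_poly f (map_matrix to_ac Y) = 0"
        using f Y(2) by (simp add: vanishing_ideal_def)
      then have evY0: "ev Y f0 = 0"
        by (simp add: eval_matrix_poly_eq_ev ev_ac)
      have "f0 \<in> mpolys (laurent_series_over (GF q))"
        using lookup(1) rational_functions_over_GF_fixed fixed_iff by (auto simp: mpolys_def)
      then obtain N where N: "Cst (fls_X ^ N) * f0 \<in> mpolys (power_series_over (GF q))"
        by (rule clear_denominators)
      define f1 where "f1 = Cst (fls_X ^ N) * f0"
      have f1: "Poly_Mapping.lookup f1 m \<in> power_series_over (GF q)" for m
        using N by (simp add: f1_def mpolys_def)
      have sub: "power_series_over (GF q) \<subseteq> power_series_over \<O>"
        using GF_\<oo> \<oo>_\<O> unfolding power_series_over_def by blast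
      have "mp_map s0 f1 = f1"
        by (rule poly_mapping_eqI) (simp add: lookup_mp_map s0.hom_zero s0_GF[OF f1])
      moreover have "s0 (ev Y f1) = ev ?Y0 (mp_map s0 f1)"
        using f1 sub by (intro s0.hom_ev Y) (auto simp: mpolys_def)
      ultimately have "ev ?Y0 f1 = 0"
        using evY0 by (simp add: f1_def evY.hom_mult s0.hom_zero)
      then have "ev ?Y0 f0 = 0" by (simp add: f1_def evY0.hom_mult)
      then show "f \<in> {f. ev ?g f = 0}" by (simp add: ev_ac)
    qed
    ultimately have "Idl\<^bsub>?P\<^esub> ?S \<subseteq> {f. ev ?g f = 0}"
      by (rule P.genideal_minimal)
    then show ?thesis
      using G unfolding linear_algebraic_group_over_def by metis
  qed
  ultimately show ?thesis
    using G unfolding linear_algebraic_group_over_def eval_matrix_poly_eq_ev by blast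
qed

lemma GL_I:
  fixes Y Z :: "'b::comm_ring_1^'n::finite^'n"
  assumes "\<And>i j. Y $ i $ j \<in> A" "\<And>i j. Z $ i $ j \<in> A" "Y ** Z = mat 1" "Z ** Y = mat 1"
  shows "Y \<in> GL A"
  using assms by (auto simp: GL_def)

text \<open>The images \<open>Y0\<close> and \<open>Y1\<close> of Y under \<open>s0\<close> and
  \<open>s1\<close> solve the same specialized system because \<open>s0\<close> and
  \<open>s1\<close> agree on \<open>D\<close>. So A = Y1^-1 Y0 is fixed by \<phi>, with entries in
  F_q((t)) that are power series. The relations for A come from the pair (s1, s0), those for its
  inverse from (s0, s1).\<close>

theorem specialized_point:
  fixes D Y :: "'a fls^'n::finite^'n"
  assumes \<O>: "valuation_ring_of (separable_closure_of k) \<O>"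
    and D: "D \<in> GL (F \<inter> power_series_over \<oo>)" and Y: "Y \<in> GL (power_series_over UNIV)"
    and pv: "picard_vessiot_ring F \<phi> D Y R"
  defines "Y0 \<equiv> map_matrix s0 Y"
  defines "A \<equiv> matrix_inv Y0 ** map_matrix s0 (twisted_product \<phi> D d) ** Y0"
  shows "Y \<in> GL (power_series_over \<O>)" "Y0 \<in> GL (s0 ` power_series_over \<O>)"
    "A \<in> galois_group_points F \<phi> R Y (laurent_series_over (GF q))"
    "A \<in> GL (power_series_over (GF q))"
proof -
  obtain Di where D: "\<And>i j. D $ i $ j \<in> F \<inter> power_series_over \<oo>"
    "\<And>i j. Di $ i $ j \<in> F \<inter> power_series_over \<oo>" "D ** Di = mat 1" "Di ** D = mat 1"
    using D by (auto simp: GL_def)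
  obtain Yi where Y: "\<And>i j. Y $ i $ j \<in> power_series_over UNIV"
    "\<And>i j. Yi $ i $ j \<in> power_series_over UNIV" "Y ** Yi = mat 1" "Yi ** Y = mat 1"
    using Y by (auto simp: GL_def)
  have DYY: "D ** map_matrix \<phi> Y = Y"
    using pv by (simp add: picard_vessiot_ring_def fundamental_matrix_def)
  have "Di ** (D ** map_matrix \<phi> Y) = Di ** Y" by (simp only: DYY)
  then have fund: "map_matrix \<phi> Y = Di ** Y"
    by (simp add: matrix_mul_assoc D)
  have "map_matrix \<phi> Y ** map_matrix \<phi> Yi = mat 1"
    using frobenius.map_matrix_mult[of Y Yi] unfolding Y(3) frobenius.map_matrix_one by simp
  then have "(Yi ** D) ** (Di ** Y) ** map_matrix \<phi> Yi = Yi ** D"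
    by (simp add: fund matrix_mul_assoc[symmetric])
  moreover have "(Yi ** D) ** (Di ** Y) = mat 1"
  proof -
    have "(Yi ** D) ** (Di ** Y) = Yi ** (D ** Di) ** Y" by (simp add: matrix_mul_assoc)
    then show ?thesis by (simp add: D Y)
  qed
  ultimately have fund': "map_matrix \<phi> Yi = Yi ** D" by simp
  have YO: "Y $ i $ j \<in> power_series_over \<O>" for i j
    using fundamental_matrix_integral[OF \<O> Y(1) fund, of D] D by blast
  have YiO: "Yi $ i $ j \<in> power_series_over \<O>" for i j
  proof -
    \<comment> \<open>In \<phi>(Yi) = Yi D the factor stands on the right; transposition produces
      the form required by \<open>fundamental_matrix_integral\<close>.\<close>
    have eq: "map_matrix \<phi> (Finite_Cartesian_Product.transpose Yi) = Finite_Cartesian_Product.transpose D ** Finite_Cartesian_Product.transpose Yi"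
      using arg_cong[OF fund', of Finite_Cartesian_Product.transpose]
      by (simp add: matrix_transpose_mul) (simp add: vec_eq_iff transpose_def)
    have inv: "Finite_Cartesian_Product.transpose D ** Finite_Cartesian_Product.transpose Di = mat 1"
      using arg_cong[OF D(4), of Finite_Cartesian_Product.transpose] by (simp add: matrix_transpose_mul transpose_mat)
    have "Finite_Cartesian_Product.transpose Yi $ j $ i \<in> power_series_over \<O>"
      by (rule fundamental_matrix_integral[OF \<O> _ eq _ _ inv])
        (use D Y in \<open>auto simp: transpose_def\<close>)
    then show ?thesis by (simp add: transpose_def)
  qed
  show "Y \<in> GL (power_series_over \<O>)"
    by (rule GL_I[OF YO YiO Y(3,4)])
  define Yi0 where "Yi0 = map_matrix s0 Yi"
  define Y1 where "Y1 = map_matrix s1 Y"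
  define Yi1 where "Yi1 = map_matrix s1 Yi"
  have Y0: "Y0 ** Yi0 = mat 1" "Yi0 ** Y0 = mat 1"
    unfolding Y0_def Yi0_def
    by (simp_all add: s0.map_matrix_mult[symmetric] YO YiO Y s0.map_matrix_one)
  have Y1: "Y1 ** Yi1 = mat 1" "Yi1 ** Y1 = mat 1"
    unfolding Y1_def Yi1_def
    by (simp_all add: s1.map_matrix_mult[symmetric] YO YiO Y s1.map_matrix_one)
  show "Y0 \<in> GL (s0 ` power_series_over \<O>)"
    by (rule GL_I[OF _ _ Y0]) (simp_all add: Y0_def Yi0_def YO YiO)
  have D_O: "D $ i $ j \<in> power_series_over \<O>" "Di $ i $ j \<in> power_series_over \<O>" for i j
    using D(1,2) power_series_\<oo>_\<O> by blast+
  define A' where "A' = Yi0 ** Y1"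
  have A_eq: "A = Yi1 ** Y0"
  proof -
    have iter: "map_matrix s0 (map_matrix (\<phi> ^^ d) Y) = Y1"
      by (simp add: Y1_def vec_eq_iff s0_frobenius_iter YO s1_def)
    have "Y0 = map_matrix s0 (twisted_product \<phi> D d ** map_matrix (\<phi> ^^ d) Y)"
      by (simp add: Y0_def twisted_product_fundamental[OF DYY])
    also have "\<dots> = map_matrix s0 (twisted_product \<phi> D d) ** Y1"
      by (subst s0.map_matrix_mult)
        (simp_all add: iter twisted_product_closed D_O power_series_frobenius_iter YO)
    \<comment> \<open>Cancelling \<open>Y1\<close> identifies the specialized twisted product as
      \<open>Y0 ** Yi1\<close>, so its conjugate by \<open>Y0\<close> is
      \<open>Yi1 ** Y0\<close>.\<close>
    finally have "Y0 ** Yi1 = map_matrix s0 (twisted_product \<phi> D d) ** Y1 ** Yi1" by simp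
    then have tw: "map_matrix s0 (twisted_product \<phi> D d) = Y0 ** Yi1"
      by (simp add: Y1 flip: matrix_mul_assoc)
    show ?thesis
      unfolding A_def tw matrix_inv_eqI[OF Y0]
      by (simp add: matrix_mul_assoc Y0)
  qed
  have AA': "A ** A' = mat 1" "A' ** A = mat 1"
  proof -
    have "A ** A' = Yi1 ** (Y0 ** Yi0) ** Y1" "A' ** A = Yi0 ** (Y1 ** Yi1) ** Y0"
      by (simp_all add: A_eq A'_def matrix_mul_assoc)
    then show "A ** A' = mat 1" "A' ** A = mat 1" by (simp_all add: Y0 Y1)
  qed
  have s01: "map_matrix s1 D = map_matrix s0 D" "map_matrix s1 Di = map_matrix s0 Di"
    using D by (simp_all add: vec_eq_iff s1_eq_s0)
  have phi: "map_matrix \<phi> Y0 = map_matrix s0 Di ** Y0" "map_matrix \<phi> Yi0 = Yi0 ** map_matrix s0 D"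
    "map_matrix \<phi> Y1 = map_matrix s0 Di ** Y1" "map_matrix \<phi> Yi1 = Yi1 ** map_matrix s0 D"
  proof -
    have "map_matrix \<phi> (map_matrix s0 W) = map_matrix s0 (map_matrix \<phi> W)"
      "map_matrix \<phi> (map_matrix s1 W) = map_matrix s1 (map_matrix \<phi> W)"
      if "\<And>i j. W $ i $ j \<in> power_series_over \<O>" for W :: "'a fls^'n^'n"
      using that by (simp_all add: vec_eq_iff s0_frobenius s1_frobenius)
    note swap = this[of Y] this[of Yi]
    show "map_matrix \<phi> Y0 = map_matrix s0 Di ** Y0" "map_matrix \<phi> Yi0 = Yi0 ** map_matrix s0 D"
      "map_matrix \<phi> Y1 = map_matrix s0 Di ** Y1" "map_matrix \<phi> Yi1 = Yi1 ** map_matrix s0 D"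
      unfolding Y0_def Yi0_def Y1_def Yi1_def
      by (simp_all add: swap YO YiO fund fund' s0.map_matrix_mult s1.map_matrix_mult D_O s01)
  qed
  have D0: "map_matrix s0 D ** map_matrix s0 Di = mat 1"
    by (simp add: s0.map_matrix_mult[symmetric] D_O D s0.map_matrix_one)
  have fixed: "map_matrix \<phi> A = A" "map_matrix \<phi> A' = A'"
  proof -
    have "map_matrix \<phi> A = Yi1 ** (map_matrix s0 D ** map_matrix s0 Di) ** Y0"
      "map_matrix \<phi> A' = Yi0 ** (map_matrix s0 D ** map_matrix s0 Di) ** Y1"
      unfolding A_eq A'_def by (simp_all add: frobenius.map_matrix_mult phi matrix_mul_assoc)
    then show "map_matrix \<phi> A = A" "map_matrix \<phi> A' = A'"
      by (simp_all add: D0 A_eq A'_def)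
  qed
  have A_GF: "A $ i $ j \<in> laurent_series_over (GF q)" "A' $ i $ j \<in> laurent_series_over (GF q)" for i j
    using fixed by (simp_all add: vec_eq_iff flip: fixed_iff)
  interpret PS: subring_set "power_series_over (UNIV :: 'a set)"
    by (rule subring_power_series_over[OF subring_set_UNIV])
  have PS_s: "s0 x \<in> power_series_over UNIV" "s1 x \<in> power_series_over UNIV"
    if "x \<in> power_series_over \<O>" for x
    using that q_gt_1
    by (simp_all add: power_series_over_def nth_s0 nth_s1 \<kappa>.hom_zero power_0_left)
  have A_PS: "A $ i $ j \<in> power_series_over UNIV" "A' $ i $ j \<in> power_series_over UNIV" for i j
    unfolding A_eq A'_def Y0_def Yi0_def Y1_def Yi1_def
    by (intro PS.matrix_mult_closed; simp add: PS_s YO YiO)+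
  have "A $ i $ j \<in> power_series_over (GF q)" "A' $ i $ j \<in> power_series_over (GF q)" for i j
    using A_GF[of i j] A_PS[of i j] by (simp_all add: power_series_over_def laurent_series_over_def)
  then show "A \<in> GL (power_series_over (GF q))"
    by (rule GL_I[OF _ _ AA'])
  have R: "subring R ring_of_type_algebra" "F \<subseteq> R" "\<phi> \<in> ring_hom (ring_on R) (ring_on R)"
    "simple_difference_ring \<phi> R" "constants \<phi> R = constants \<phi> F" "R = matrix_algebra F Y" "Y \<in> GL R"
    using pv by (auto simp: picard_vessiot_ring_def fundamental_matrix_def)
  have phi_R: "\<phi> r \<in> R" if "r \<in> R" for r
    using ring_hom_closed[OF R(3)] that by simp
  interpret RR: subring_set R by (rule subring_imp_subring_set[OF R(1)])
  interpret SS: subring_set "laurent_series_over (GF q) :: 'a fls set"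
    by (rule subring_laurent_series_over[OF subring_GF])
  have "difference_tensor \<phi> F R (laurent_series_over (GF q))"
  proof unfold_locales
    show "constants \<phi> F \<subseteq> laurent_series_over (GF q)"
      by (auto simp: constants_def fixed_iff)
    fix J :: "('a fls \<times> 'a fls) set" and r s
    assume "finite J" "\<And>i. i \<in> J \<Longrightarrow> r i \<in> R" "\<And>i. i \<in> J \<Longrightarrow> s i \<in> laurent_series_over (GF q)"
      "(\<Sum>i\<in>J. r i * s i) = 0" "\<exists>i\<in>J. r i \<noteq> 0"
    then show "\<exists>c. (\<forall>i\<in>J. c i \<in> constants \<phi> F) \<and> (\<exists>i\<in>J. c i \<noteq> 0) \<and> (\<Sum>i\<in>J. c i * s i) = 0"
      using frobenius.linearly_disjoint_fixed[OF R(1) phi_R R(4), of J r s] R(5)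
      by (simp add: fixed_iff)
  qed (use R(2) frobenius_F phi_R in \<open>auto simp: fixed_iff\<close>)
  then interpret T: difference_tensor \<phi> F R "laurent_series_over (GF q)" .
  have YiR: "Yi $ i $ j \<in> R" for i j
  proof -
    obtain Z where Z: "\<And>i j. Z $ i $ j \<in> R" "Y ** Z = mat 1" "Z ** Y = mat 1"
      using R(7) by (auto simp: GL_def)
    have "Yi = Yi ** (Y ** Z)" by (simp add: Z)
    also have "\<dots> = Z" by (simp add: matrix_mul_assoc Y)
    finally show ?thesis using Z(1) by simp
  qed
  show "A \<in> galois_group_points F \<phi> R Y (laurent_series_over (GF q))"
  proof (rule T.galois_group_points_matrixI[OF R(6) A_GF AA' YiR Y(3,4) _ fund])
    show "Di $ i $ j \<in> F" for i j using D(2)[of i j] by blast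
    fix f assume f: "f \<in> mpolys F" "ev Y f = 0"
    have DiF: "Di $ i $ j \<in> F" for i j using D(2)[of i j] by blast
    note transfer = relation_specializes[OF _ _ YO YiO Y(3) DiF D(3) fund fund']
    have fr: "f \<in> relations Y" using f by (simp add: relations_def)
    show "ev (Y ** A) f = 0"
      using transfer[of s1 s0, OF _ _ fr] by (simp add: A_eq Yi1_def Y0_def)
    show "ev (Y ** A') f = 0"
      using transfer[of s0 s1, OF _ _ fr] by (simp add: A'_def Yi0_def Y1_def)
  qed
qed

end

section \<open>From the stated hypotheses to the specialization setting\<close>

lemma subfield_imp_subfield_set:
  fixes k :: "'a::field set"
  assumes "subfield k ring_of_type_algebra"
  shows "subfield_set k"
proof -
  interpret Ring.ring "ring_of_type_algebra :: 'a ring" by (rule ring_from_type_algebra)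
  interpret subring_set k
    by (rule subring_imp_subring_set[OF subfieldE(1)[OF assms]])
  show ?thesis
  proof
    fix x assume x: "x \<in> k"
    show "inverse x \<in> k"
    proof (cases "x = 0")
      case False
      then have "x \<in> k - {\<zero>\<^bsub>ring_of_type_algebra\<^esub>}" using x by simp
      note m_inv = subfield_m_inv[OF assms this]
      have "inverse x = inv\<^bsub>ring_of_type_algebra\<^esub> x"
        using m_inv(2) by (intro inverse_unique) simp
      then show ?thesis using m_inv(1) by simp
    qed (use x in simp)
  qed
qed

text \<open>Every element of \<open>GF m\<close> satisfies x^m = x, and any isomorphism whatsoever
  transports this equation back to the residue field.\<close>

lemma quotient_iso_GF_power:
  fixes \<oo> \<pp> :: "'a::field set"
  assumes "ideal \<pp> (ring_on \<oo>)" "subring_set \<oo>"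
    and iso: "ring_on \<oo> Quot \<pp> \<simeq> ring_on (GF m :: 'a set)" and x: "x \<in> \<oo>"
  shows "x ^ m - x \<in> \<pp>"
proof -
  interpret \<pp>: ideal \<pp> "ring_on \<oo>" by fact
  interpret \<oo>: subring_set \<oo> by fact
  obtain h where "h \<in> ring_iso (ring_on \<oo> Quot \<pp>) (ring_on (GF m :: 'a set))"
    using iso by (auto simp: is_ring_iso_def)
  then have h: "h \<in> ring_hom (ring_on \<oo> Quot \<pp>) (ring_on (GF m))"
    and inj: "inj_on h (carrier (ring_on \<oo> Quot \<pp>))"
    by (auto simp: ring_iso_def bij_betw_def)
  define g where "g = h \<circ> (\<lambda>a. \<pp> +>\<^bsub>ring_on \<oo>\<^esub> a)"
  have g: "g \<in> ring_hom (ring_on \<oo>) (ring_on (GF m))"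
    unfolding g_def by (rule ring_hom_trans[OF \<pp>.rcos_ring_hom h])
  have pow: "g (x ^ n) = g x ^ n" for n
  proof (induction n)
    case 0
    then show ?case using ring_hom_one[OF g] by simp
  next
    case (Suc n)
    then show ?case
      using ring_hom_mult[OF g, of x "x ^ n"] x by (simp add: \<oo>.power_closed)
  qed
  have "g x \<in> GF m" using ring_hom_closed[OF g, of x] x by simp
  then have "g (x ^ m) = g x" unfolding pow by (simp add: GF_def)
  then have "\<pp> +>\<^bsub>ring_on \<oo>\<^esub> (x ^ m) = \<pp> +>\<^bsub>ring_on \<oo>\<^esub> x"
    using inj ring_hom_closed[OF \<pp>.rcos_ring_hom] x \<oo>.power_closed[OF x]
    by (auto simp: g_def dest!: inj_onD)
  moreover have "x ^ m \<in> \<pp> +>\<^bsub>ring_on \<oo>\<^esub> (x ^ m)"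
    using \<pp>.a_rcos_self[of "x ^ m"] x \<oo>.power_closed[OF x] by simp
  ultimately obtain y where "y \<in> \<pp>" "x ^ m = y + x"
    by (auto simp: a_r_coset_def')
  then show ?thesis by simp
qed

theorem theorem4p12:
  fixes p e q d :: nat
    and v :: "'K::{alg_closed_field, complete_space} \<Rightarrow> real"
    and k \<oo> \<pp> \<O> \<P> :: "'K set"
    and \<kappa> :: "'K \<Rightarrow> 'K"
    and \<G> :: "('K fls alg_closure^'n::finite^'n) set"
    and F R E :: "'K fls set"
    and M :: "('K fls, 'm) module" and \<Phi> :: "'m \<Rightarrow> 'm" and b :: "'n \<Rightarrow> 'm"
    and D Y :: "'K fls^'n^'n"
    and \<H> :: "'K fls set \<Rightarrow> ('K fls^'n^'n) set"
  assumes "Factorial_Ring.prime p" and "e \<ge> 1" and "q = p ^ e" and "CHAR('K) = p"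
    and "subfield k ring_of_type_algebra" and "GF q \<subseteq> k"
    and "completed_alg_closure_of v k" and "\<exists>x\<in>k. x \<noteq> 0 \<and> v x \<noteq> 1"
    and "d \<ge> 1"
    and "valuation_ring_of k \<oo>" and "maximalideal \<pp> (ring_on \<oo>)"
    and "ring_on \<oo> Quot \<pp> \<simeq> ring_on (GF (q ^ d) :: 'K set)"
    and "valuation_ring_of (separable_closure_of k) \<O>" and "maximalideal \<P> (ring_on \<O>)"
    and "\<O> \<inter> k = \<oo>" and "\<P> \<inter> k = \<pp>"
    and "residue_homomorphism q \<O> \<P> \<kappa>"
    and "F = rational_functions_over k"
    and "linear_algebraic_group_over (to_ac ` rational_functions_over (GF q)) \<G>"
    and "difference_module F (frobenius q) M \<Phi>"
    and "module_basis F M b" and "representing_matrix M \<Phi> b D"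
    and "D \<in> group_points \<G> (F \<inter> power_series_over \<oo>)"
    and "Y \<in> group_points \<G> (power_series_over UNIV)"
    and "R = matrix_algebra F Y" and "E = quotient_field R"
    and "picard_vessiot_ring F (frobenius q) D Y R"
    and "separable_extension F E"
    and "\<H> = galois_group_points F (frobenius q) R Y"
  shows "Y \<in> GL (power_series_over \<O>) \<and>
    (\<exists>g \<in> group_points \<G> (power_series_over (algebraic_closure_of (GF q))).
       matrix_inv g ** map_matrix (fls_map \<kappa>) (twisted_product (frobenius q) D d) ** g
         \<in> \<H> (laurent_series_over (GF q)) \<inter> GL (power_series_over (GF q))) \<and>
    map_matrix (fls_map \<kappa>) Y
      \<in> group_points \<G> (power_series_over (algebraic_closure_of (GF q))) \<and>
    matrix_inv (map_matrix (fls_map \<kappa>) Y)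
      ** map_matrix (fls_map \<kappa>) (twisted_product (frobenius q) D d)
      ** map_matrix (fls_map \<kappa>) Y
        \<in> \<H> (laurent_series_over (GF q)) \<inter> GL (power_series_over (GF q))"
proof -
  have p: "CHAR('K) = p" "Factorial_Ring.prime p" by fact+
  have q: "q = CHAR('K) ^ e" using assms(3) p by simp
  interpret frobenius_power q "TYPE('K)"
  proof
    show "q > 1" using one_less_power[OF prime_gt_1_nat[OF p(2)], of e] assms(2,3) by simp
    show "(x + y) ^ q = x ^ q + y ^ q" for x y :: 'K
      by (rule freshmans_dream'[OF _ q]) (use p in simp)
    show "of_nat q = (0 :: 'K)"
      unfolding of_nat_eq_0_iff_char_dvd q using assms(2) by (simp add: dvd_power)
  qed
  interpret k: subfield_set k by (rule subfield_imp_subfield_set) fact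
  have \<oo>: "subring_set \<oo>" "\<oo> \<subseteq> k" "\<And>x. x \<in> k \<Longrightarrow> x \<in> \<oo> \<or> inverse x \<in> \<oo>"
    using assms(10) subring_imp_subring_set by (auto simp: valuation_ring_of_def)
  interpret \<oo>: subring_set \<oo> by fact
  have \<O>: "subring_set \<O>"
    using assms(13) subring_imp_subring_set by (auto simp: valuation_ring_of_def)
  interpret \<O>: subring_set \<O> by fact
  have \<kappa>: "\<kappa> \<in> ring_hom (ring_on \<O>) (ring_on (algebraic_closure_of (GF q)))"
    "\<kappa> ` \<O> = algebraic_closure_of (GF q)" "\<And>x. x \<in> \<O> \<Longrightarrow> \<kappa> x = 0 \<longleftrightarrow> x \<in> \<P>"
    "\<And>x. x \<in> GF q \<Longrightarrow> \<kappa> x = x"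
    using assms(17) by (auto simp: residue_homomorphism_def)
  interpret \<kappa>: subring_hom \<O> \<kappa>
    using ring_hom_add[OF \<kappa>(1)] ring_hom_mult[OF \<kappa>(1)] ring_hom_one[OF \<kappa>(1)]
    by unfold_locales auto
  have \<oo>_\<O>: "\<oo> \<subseteq> \<O>" using assms(15) by blast
  have GF_\<oo>: "GF q \<subseteq> \<oo>"
  proof
    fix x :: 'K assume x: "x \<in> GF q"
    show "x \<in> \<oo>"
    proof (cases "x \<in> \<oo> \<or> x = 0")
      case False
      then have inv: "inverse x \<in> \<oo>" using x assms(6) \<oo>(3) by blast
      \<comment> \<open>n = q - 2: a nonzero x in F_q satisfies x^(q-1) = 1, so it is the power of
        1/x with exponent q - 2 and lies in \<oo> together with 1/x.\<close>
      obtain n where n: "q = Suc (Suc n)"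
        using q_gt_1 by (metis One_nat_def less_imp_Suc_add add_Suc_right add_Suc plus_nat.add_0)
      have "x ^ q = x" using x by (simp add: GF_def)
      then have "x * x ^ n = 1" using False by (simp add: n)
      then have "x = inverse x ^ n"
        by (metis inverse_unique inverse_inverse_eq power_inverse mult.commute)
      then show ?thesis using \<oo>.power_closed[OF inv, of n] by simp
    qed (use \<oo>.zero_closed in auto)
  qed
  \<comment> \<open>The residue field of \<oo> has q^d elements, so x^(q^d) - x lies in \<pp>, hence
    in \<P>, and \<kappa> kills it.\<close>
  have \<kappa>_\<oo>: "\<kappa> x ^ (q ^ d) = \<kappa> x" if x: "x \<in> \<oo>" for x
  proof -
    have xO: "x \<in> \<O>" using x \<oo>_\<O> by blast
    have "x ^ (q ^ d) - x \<in> \<pp>"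
      using assms(11,12) x by (intro quotient_iso_GF_power[OF maximalideal.axioms(1) \<oo>(1)])
    then have "\<kappa> (x ^ (q ^ d) - x) = 0"
      using \<kappa>(3) assms(16) xO by (auto simp: \<O>.diff_closed \<O>.power_closed)
    then show ?thesis
      using xO by (simp add: \<kappa>.hom_diff \<kappa>.hom_power \<O>.power_closed)
  qed
  interpret specialization q "TYPE('K)" k \<oo> \<O> \<kappa> d
    using \<oo> \<oo>_\<O> GF_\<oo> \<kappa>(4) \<kappa>_\<oo> by unfold_locales auto
  have s0: "fls_map \<kappa> = s0" by (simp add: s0_def fun_eq_iff)
  have D: "D \<in> GL (rational_functions_over k \<inter> power_series_over \<oo>)"
    and Y: "Y \<in> GL (power_series_over UNIV)" "map_matrix to_ac Y \<in> \<G>"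
    using assms(18,23,24) by (auto simp: group_points_def)
  let ?Y0 = "map_matrix s0 Y"
  let ?A = "matrix_inv ?Y0 ** map_matrix s0 (twisted_product (frobenius q) D d) ** ?Y0"
  note main = specialized_point[OF assms(13) D Y(1) assms(27)[unfolded assms(18)]]
  have "s0 ` power_series_over \<O> \<subseteq> power_series_over (algebraic_closure_of (GF q))"
    using \<kappa>(2) by (auto simp: power_series_over_def nth_s0 \<kappa>.hom_zero)
  then have Y0: "?Y0 \<in> GL (power_series_over (algebraic_closure_of (GF q)))"
    using main(2) unfolding GL_def by blast
  have "map_matrix to_ac ?Y0 \<in> \<G>"
  proof -
    obtain Z where "?Y0 ** Z = mat 1" "Z ** ?Y0 = mat 1" using Y0 by (auto simp: GL_def)
    then show ?thesis
      using main(1) Y(2) by (intro specialize_group_point[OF assms(19)]) (auto simp: GL_def)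
  qed
  with Y0 have point: "?Y0 \<in> group_points \<G> (power_series_over (algebraic_closure_of (GF q)))"
    by (simp add: group_points_def)
  have "?A \<in> \<H> (laurent_series_over (GF q)) \<inter> GL (power_series_over (GF q))"
    using main(3,4) unfolding assms(29,18) by blast
  with main(1) point show ?thesis unfolding s0 by blast
qed

end
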